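(* Let $(\mathbb G,D,\langle\cdot,\cdot\rangle)$ be a sub-Riemannian stratified Lie group of dimension $n$, let $M$ be an oriented $(n-p)$-dimensional manifold and let $i:M\to\mathbb G$ be an immersion of $M$ as a non-horizontal submanifold. Let $F:(-\epsilon,\epsilon)\times M\to\mathbb G$ be a variation of $i$ through immersions, i.e. $F$ is smooth, each $F_u=F(u,\cdot)$ is a (non-horizontal) immersion and $F_0=i$, and let $W=\frac{d}{du}F\big|_{u=0}$ be its variation vector field. Let $\tilde\Gamma(u)$ be the volume form of the $\mu$-measure on $F_u(M)$ in accordance with the given orientation of $M$, and let $\Gamma(u)=F_u^*(\tilde\Gamma(u))$, $\dot\Gamma(0)=\frac{d}{du}\Gamma(u)\big|_{u=0}$. Then $$\dot\Gamma(0)=i^*\left(H_{W^\perp}+\sigma_{W^\perp}\right)\Gamma(0)+d\left(i_*^{-1}(W^\top)\lrcorner\,\Gamma(0)\right),$$ where $H$ is the mean curvature and $\sigma$ is the mean torsion of $i(M)$.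
   Context: Stratified group: $\mathbb G$ is a connected, simply connected nilpotent Lie group of dimension $n$ whose Lie algebra (of left-invariant vector fields) is $\mathfrak g=\mathfrak g^1\oplus\cdots\oplus\mathfrak g^r$ with $[\mathfrak g^1,\mathfrak g^j]=\mathfrak g^{j+1}$ for $1\le j\le r-1$ and $[\mathfrak g^j,\mathfrak g^r]=0$ for all $j$. Put $d_1=\dim\mathfrak g^1$. $D\subset T\mathbb G$ is the left-invariant distribution spanned by $\mathfrak g^1$, with a left-invariant scalar product $\langle\cdot,\cdot\rangle$. It is extended to $\mathfrak g$ (and left-invariantly to $T\mathbb G$) by declaring the $\mathfrak g^j$ mutually orthogonal and, inductively, requiring that the bracket map $B:\mathfrak g^1\otimes\mathfrak g^k\to\mathfrak g^{k+1}$, $B(X\otimes Y)=[X,Y]$, restrict to an isometry $(\ker B)^\perp\to\mathfrak g^{k+1}$. Fix an orthonormal basis $e_1,\dots,e_n$ of $\mathfrak g$ adapted to the stratification (so $e_1,\dots,e_{d_1}$ spans $\mathfrak g^1$), with dual basis $e^1,\dots,e^n$. $\overline\nabla$ is the flat connection on $T\mathbb G$ with $\overline\nabla e_j=0$ for all $j$; its torsion $\overline T$ satisfies $\overline T(e_i,e_j)=-[e_i,e_j]$. A submanifold (or immersed submanifold) $M$ of codimension $p$ is non-horizontal if $TM+D=T\mathbb G$ along $M$. $TM^\perp$ is the orthogonal complement of $TM\cap D$ inside $D$ (rank $p$); then $T\mathbb G=TM\oplus TM^\perp$ along $M$ (in general not orthogonal), and $v=v^\top+v^\perp$ denotes the corresponding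 decomposition of a vector $v$. Adapted basis: a local frame $f_1,\dots,f_n$ with $f_1,\dots,f_{d_1}$ an orthonormal frame of $D$, such that along $M$ the fields $f_1,\dots,f_p$ span $TM^\perp$, $f_{p+1},\dots,f_{d_1}$ span $TM\cap D$, and for $j>d_1$ one has $f_j=e_j-\sum_{\alpha=1}^pA_j^\alpha f_\alpha$ with functions $A_j^\alpha$ such that $f_j$ is tangent to $M$. Dual coframe: $f^1,\dots,f^n$. The volume form of the $\mu$-measure on an oriented $M$ is $f^{p+1}\wedge\cdots\wedge f^n$ restricted to $M$, with adapted basis chosen positively oriented. Weingarten operator: for $\xi$ a section of $TM^\perp$ and $X\in TM$, $A_\xi(X)=-(\overline\nabla_X\xi)^\top\in TM$. Mean curvature: $H:TM^\perp\to\mathbb R$, $H_\xi=-\operatorname{trace}A_\xi$. Mean torsion: $\sigma:TM^\perp\to\mathbb R$, $\sigma_\xi=\sum_{j=d_1+1}^nf^j(\overline T(\xi,f_j))$. The symbol $\lrcorner$ denotes contraction (interior product) of a vector with a form. $i_*^{-1}(W^\top)$ is the vector field on $M$ whose image under $i_*$ is $W^\top$. *)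

theory Defs
  imports "HOL-Analysis.Analysis"
begin

section \<open>Smooth manifolds\<close>

text \<open>
  A chart is a pair of its domain and its coordinate map; the manifold is the whole type \<open>'m\<close>.
  The model space is only required to be a finite-dimensional normed space, so that
  zero-dimensional manifolds are not excluded (\<open>euclidean_space\<close> forces positive dimension).
\<close>

type_synonym ('m, 'b) chart = "'m set \<times> ('m \<Rightarrow> 'b)"
type_synonym ('m, 'b) atlas = "('m, 'b) chart set"

definition chart_inv :: "('m, 'b) chart \<Rightarrow> 'b \<Rightarrow> 'm" where
  "chart_inv c = inv_into (fst c) (snd c)"

text \<open>
  Iterated directional derivatives; on an open subset of a finite-dimensional space, having them
  to every order is the usual notion of being of class \<open>C\<^sup>\<infinity>\<close>.
\<close>

primrec times_differentiable_on ::
  "nat \<Rightarrow> 'a::real_normed_vector set \<Rightarrow> ('a \<Rightarrow> 'c::real_normed_vector) \<Rightarrow> bool" where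
  "times_differentiable_on 0 S f \<longleftrightarrow> continuous_on S f"
| "times_differentiable_on (Suc k) S f \<longleftrightarrow>
     (\<forall>x\<in>S. f differentiable (at x)) \<and>
     (\<forall>v. times_differentiable_on k S (\<lambda>x. frechet_derivative f (at x) v))"

definition smooth_on :: "'a::real_normed_vector set \<Rightarrow> ('a \<Rightarrow> 'c::real_normed_vector) \<Rightarrow> bool" where
  "smooth_on S f \<longleftrightarrow> (\<forall>k. times_differentiable_on k S f)"

definition smooth_manifold ::
  "('m::{t2_space,second_countable_topology}, 'b::real_normed_vector) atlas \<Rightarrow> nat \<Rightarrow> bool" where
  "smooth_manifold A k \<longleftrightarrow>
     (\<exists>B::'b set. finite B \<and> independent B \<and> span B = UNIV \<and> card B = k) \<and>
     (\<Union>c\<in>A. fst c) = UNIV \<and>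
     (\<forall>c\<in>A. open (fst c) \<and> open (snd c ` fst c) \<and> inj_on (snd c) (fst c) \<and>
        homeomorphism (fst c) (snd c ` fst c) (snd c) (chart_inv c)) \<and>
     (\<forall>c\<in>A. \<forall>c'\<in>A. smooth_on (snd c ` (fst c \<inter> fst c')) (snd c' \<circ> chart_inv c))"

definition prod_atlas :: "('m, 'b) atlas \<Rightarrow> ('n, 'c) atlas \<Rightarrow> ('m \<times> 'n, 'b \<times> 'c) atlas" where
  "prod_atlas A A' = {(fst c \<times> fst c', map_prod (snd c) (snd c')) | c c'. c \<in> A \<and> c' \<in> A'}"

definition real_atlas :: "(real, real) atlas" where
  "real_atlas = {(UNIV, id)}"

text \<open>\<open>S\<close> is meant to be an open subset of the source manifold.\<close>

definition smooth_map ::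
  "('m::topological_space, 'b::real_normed_vector) atlas \<Rightarrow>
   ('n::topological_space, 'c::real_normed_vector) atlas \<Rightarrow> 'm set \<Rightarrow> ('m \<Rightarrow> 'n) \<Rightarrow> bool" where
  "smooth_map A A' S f \<longleftrightarrow> continuous_on S f \<and>
     (\<forall>c\<in>A. \<forall>c'\<in>A'. smooth_on (snd c ` (fst c \<inter> S \<inter> f -` fst c')) (snd c' \<circ> f \<circ> chart_inv c))"

text \<open>
  The tangent space at \<open>x\<close> is the model space: a tangent vector at \<open>x\<close> is given by its components
  in a preferred chart \<open>chart_at A x\<close> around \<open>x\<close>, chosen once and for all.  Then
  \<open>coord A c x\<close> turns a tangent vector at \<open>x\<close> into its components in another chart \<open>c\<close>, and
  \<open>uncoord A c x\<close> is the inverse operation.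
\<close>

definition chart_at :: "('m, 'b) atlas \<Rightarrow> 'm \<Rightarrow> ('m, 'b) chart" where
  "chart_at A x = (SOME c. c \<in> A \<and> x \<in> fst c)"

definition tangent_map ::
  "('m, 'b::real_normed_vector) atlas \<Rightarrow> ('n, 'c::real_normed_vector) atlas \<Rightarrow>
   ('m \<Rightarrow> 'n) \<Rightarrow> 'm \<Rightarrow> 'b \<Rightarrow> 'c" where
  "tangent_map A A' f x =
     frechet_derivative (snd (chart_at A' (f x)) \<circ> f \<circ> chart_inv (chart_at A x))
       (at (snd (chart_at A x) x))"

definition coord :: "('m, 'b::real_normed_vector) atlas \<Rightarrow> ('m, 'b) chart \<Rightarrow> 'm \<Rightarrow> 'b \<Rightarrow> 'b" where
  "coord A c x =
     frechet_derivative (snd c \<circ> chart_inv (chart_at A x)) (at (snd (chart_at A x) x))"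

definition uncoord :: "('m, 'b::real_normed_vector) atlas \<Rightarrow> ('m, 'b) chart \<Rightarrow> 'm \<Rightarrow> 'b \<Rightarrow> 'b" where
  "uncoord A c x = frechet_derivative (snd (chart_at A x) \<circ> chart_inv c) (at (snd c x))"

text \<open>A vector field assigns to \<open>x\<close> a tangent vector at \<open>x\<close>.\<close>

definition lie_bracket ::
  "('m, 'b::real_normed_vector) atlas \<Rightarrow> ('m \<Rightarrow> 'b) \<Rightarrow> ('m \<Rightarrow> 'b) \<Rightarrow> 'm \<Rightarrow> 'b" where
  "lie_bracket A X Y x =
     (let c = chart_at A x;
          X' = (\<lambda>y. coord A c (chart_inv c y) (X (chart_inv c y)));
          Y' = (\<lambda>y. coord A c (chart_inv c y) (Y (chart_inv c y)))
      in frechet_derivative Y' (at (snd c x)) (X x) - frechet_derivative X' (at (snd c x)) (Y x))"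


section \<open>Differential forms\<close>

text \<open>
  A \<open>k\<close>-form takes at each point a sequence of tangent vectors, of which only those with
  index \<open>0, \<dots>, k - 1\<close> matter.
\<close>

definition alternating_form :: "nat \<Rightarrow> ((nat \<Rightarrow> 'b::real_vector) \<Rightarrow> real) \<Rightarrow> bool" where
  "alternating_form k \<alpha> \<longleftrightarrow>
     (\<forall>v w. (\<forall>i<k. v i = w i) \<longrightarrow> \<alpha> v = \<alpha> w) \<and>
     (\<forall>v. \<forall>i<k. linear (\<lambda>a. \<alpha> (v(i := a)))) \<and>
     (\<forall>v i j. i < j \<and> j < k \<and> v i = v j \<longrightarrow> \<alpha> v = 0)"

definition form_in_chart ::
  "('m, 'b::real_normed_vector) atlas \<Rightarrow> ('m, 'b) chart \<Rightarrow> ('m \<Rightarrow> (nat \<Rightarrow> 'b) \<Rightarrow> real) \<Rightarrow>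
   'b \<Rightarrow> (nat \<Rightarrow> 'b) \<Rightarrow> real" where
  "form_in_chart A c \<omega> y w = \<omega> (chart_inv c y) (\<lambda>j. uncoord A c (chart_inv c y) (w j))"

text \<open>
  The orientation of a \<open>k\<close>-dimensional manifold, represented by a continuous nowhere vanishing
  \<open>k\<close>-form: a basis \<open>v\<close> of the tangent space at \<open>x\<close> is positively oriented iff \<open>\<omega> x v > 0\<close>.
\<close>

definition orientation_form ::
  "('m, 'b::real_normed_vector) atlas \<Rightarrow> nat \<Rightarrow> ('m \<Rightarrow> (nat \<Rightarrow> 'b) \<Rightarrow> real) \<Rightarrow> bool" where
  "orientation_form A k \<omega> \<longleftrightarrow>
     (\<forall>x. alternating_form k (\<omega> x) \<and> (\<exists>v. \<omega> x v \<noteq> 0)) \<and>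
     (\<forall>c\<in>A. \<forall>w. continuous_on (snd c ` fst c) (\<lambda>y. form_in_chart A c \<omega> y w))"

text \<open>
  Here \<open>k\<close> is the degree of the result: \<open>exterior_derivative A k \<omega>\<close> is the \<open>k\<close>-form \<open>d\<omega>\<close> of a
  \<open>(k - 1)\<close>-form \<open>\<omega>\<close> (and zero if \<open>k = 0\<close>), computed at \<open>x\<close> in the preferred chart around \<open>x\<close>.
\<close>

definition exterior_derivative ::
  "('m, 'b::real_normed_vector) atlas \<Rightarrow> nat \<Rightarrow> ('m \<Rightarrow> (nat \<Rightarrow> 'b) \<Rightarrow> real) \<Rightarrow>
   'm \<Rightarrow> (nat \<Rightarrow> 'b) \<Rightarrow> real" where
  "exterior_derivative A k \<omega> x v =
     (let c = chart_at A x in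
      \<Sum>i<k. (-1) ^ i *
        frechet_derivative
          (\<lambda>y. form_in_chart A c \<omega> y (\<lambda>j. if j < i then v j else v (Suc j)))
          (at (snd c x)) (v i))"

definition interior_product ::
  "('m \<Rightarrow> 'b) \<Rightarrow> ('m \<Rightarrow> (nat \<Rightarrow> 'b) \<Rightarrow> real) \<Rightarrow> 'm \<Rightarrow> (nat \<Rightarrow> 'b) \<Rightarrow> real" where
  "interior_product X \<omega> x v = \<omega> x (case_nat (X x) v)"

text \<open>The form \<open>\<theta> 0 \<and> \<dots> \<and> \<theta> (k - 1)\<close> for covectors \<open>\<theta> i\<close>.\<close>

definition wedge :: "nat \<Rightarrow> (nat \<Rightarrow> 'a \<Rightarrow> real) \<Rightarrow> (nat \<Rightarrow> 'a) \<Rightarrow> real" where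
  "wedge k \<theta> v = (\<Sum>\<pi> | \<pi> permutes {..<k}. of_int (sign \<pi>) * (\<Prod>i<k. \<theta> i (v (\<pi> i))))"


section \<open>Sub-Riemannian stratified Lie groups\<close>

text \<open>
  The Lie algebra of left-invariant vector fields is identified with the tangent space at the
  unit, that is with \<open>'a\<close>.  Layers are numbered from 1, \<open>layer G j\<close> being \<open>\<gg>\<^sup>j\<close> for
  \<open>1 \<le> j \<le> step G\<close>.  Frames are numbered from 0, \<open>bas G i\<close> for \<open>i < DIM('a)\<close> being the basis
  vector called \<open>e\<^sub>i\<^sub>+\<^sub>1\<close> in one-based numbering.
\<close>

record ('g, 'a) stratified_group =
  charts :: "('g, 'a) atlas"
  mul :: "'g \<Rightarrow> 'g \<Rightarrow> 'g"
  unt :: 'g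
  ginv :: "'g \<Rightarrow> 'g"
  step :: nat
  layer :: "nat \<Rightarrow> 'a set"
  ip :: "'a \<Rightarrow> 'a \<Rightarrow> real"
  bas :: "nat \<Rightarrow> 'a"

definition lie_group ::
  "('g::{t2_space,second_countable_topology}, 'a::euclidean_space) stratified_group \<Rightarrow> bool" where
  "lie_group G \<longleftrightarrow>
     smooth_manifold (charts G) DIM('a) \<and>
     group (mul G) (unt G) (ginv G) \<and>
     smooth_map (prod_atlas (charts G) (charts G)) (charts G) UNIV (\<lambda>(x, y). mul G x y) \<and>
     smooth_map (charts G) (charts G) UNIV (ginv G)"

definition subgroup_of :: "('g, 'a) stratified_group \<Rightarrow> 'g set \<Rightarrow> bool" where
  "subgroup_of G H \<longleftrightarrow> unt G \<in> H \<and> (\<forall>x\<in>H. \<forall>y\<in>H. mul G x y \<in> H) \<and> (\<forall>x\<in>H. ginv G x \<in> H)"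

primrec lower_central_series :: "('g, 'a) stratified_group \<Rightarrow> nat \<Rightarrow> 'g set" where
  "lower_central_series G 0 = UNIV"
| "lower_central_series G (Suc k) =
     \<Inter> {H. subgroup_of G H \<and>
          (\<forall>x\<in>lower_central_series G k. \<forall>y. mul G (mul G x y) (mul G (ginv G x) (ginv G y)) \<in> H)}"

definition nilpotent :: "('g, 'a) stratified_group \<Rightarrow> bool" where
  "nilpotent G \<longleftrightarrow> (\<exists>k. lower_central_series G k = {unt G})"

definition left_field ::
  "('g, 'a::real_normed_vector) stratified_group \<Rightarrow> 'a \<Rightarrow> 'g \<Rightarrow> 'a" where
  "left_field G v x = tangent_map (charts G) (charts G) (mul G x) (unt G) v"

definition bracket ::
  "('g, 'a::real_normed_vector) stratified_group \<Rightarrow> 'a \<Rightarrow> 'a \<Rightarrow> 'a" where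
  "bracket G v w = lie_bracket (charts G) (left_field G v) (left_field G w) (unt G)"

definition stratified :: "('g, 'a::euclidean_space) stratified_group \<Rightarrow> bool" where
  "stratified G \<longleftrightarrow>
     1 \<le> step G \<and>
     (\<forall>j\<in>{1..step G}. subspace (layer G j)) \<and>
     (\<forall>v. \<exists>!w. (\<forall>j\<in>{1..step G}. w j \<in> layer G j) \<and> (\<forall>j. j \<notin> {1..step G} \<longrightarrow> w j = 0) \<and>
        v = (\<Sum>j=1..step G. w j)) \<and>
     (\<forall>j. 1 \<le> j \<and> j < step G \<longrightarrow>
        span {bracket G v w | v w. v \<in> layer G 1 \<and> w \<in> layer G j} = layer G (Suc j)) \<and>
     (\<forall>j\<in>{1..step G}. \<forall>v\<in>layer G j. \<forall>w\<in>layer G (step G). bracket G v w = 0)"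

definition layer_indices :: "('g, 'a::euclidean_space) stratified_group \<Rightarrow> nat \<Rightarrow> nat set" where
  "layer_indices G k = {(\<Sum>j=1..<k. dim (layer G j)) ..< (\<Sum>j=1..k. dim (layer G j))}"

definition orthonormal_adapted :: "('g, 'a::euclidean_space) stratified_group \<Rightarrow> bool" where
  "orthonormal_adapted G \<longleftrightarrow>
     (\<forall>i<DIM('a). \<forall>j<DIM('a). ip G (bas G i) (bas G j) = (if i = j then 1 else 0)) \<and>
     (\<forall>k\<in>{1..step G}. span (bas G ` layer_indices G k) = layer G k)"

text \<open>
  An element of \<open>\<gg>\<^sup>1 \<otimes> \<gg>\<^sup>k\<close> is given by its coefficients \<open>t i j\<close> in the basis
  \<open>e\<^sub>i \<otimes> e\<^sub>j\<close>, which is orthonormal for the scalar product of the tensor product.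
  The map \<open>tensor_bracket G k\<close> is then \<open>X \<otimes> Y \<mapsto> [X, Y]\<close>, and \<open>bracket_isometry G k\<close> says that it is
  isometric on the orthogonal complement of its kernel.
\<close>

definition tensor_inner ::
  "('g, 'a::euclidean_space) stratified_group \<Rightarrow> nat \<Rightarrow>
   (nat \<Rightarrow> nat \<Rightarrow> real) \<Rightarrow> (nat \<Rightarrow> nat \<Rightarrow> real) \<Rightarrow> real" where
  "tensor_inner G k s t = (\<Sum>i\<in>layer_indices G 1. \<Sum>j\<in>layer_indices G k. s i j * t i j)"

definition tensor_bracket ::
  "('g, 'a::euclidean_space) stratified_group \<Rightarrow> nat \<Rightarrow> (nat \<Rightarrow> nat \<Rightarrow> real) \<Rightarrow> 'a" where
  "tensor_bracket G k t =
     (\<Sum>i\<in>layer_indices G 1. \<Sum>j\<in>layer_indices G k. t i j *\<^sub>R bracket G (bas G i) (bas G j))"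

definition bracket_isometry :: "('g, 'a::euclidean_space) stratified_group \<Rightarrow> nat \<Rightarrow> bool" where
  "bracket_isometry G k \<longleftrightarrow>
     (let K = {s. tensor_bracket G k s = 0};
          K' = {t. \<forall>s\<in>K. tensor_inner G k s t = 0}
      in \<forall>s\<in>K'. \<forall>t\<in>K'. ip G (tensor_bracket G k s) (tensor_bracket G k t) = tensor_inner G k s t)"

definition sub_riemannian_stratified_group ::
  "('g::{t2_space,second_countable_topology}, 'a::euclidean_space) stratified_group \<Rightarrow> bool" where
  "sub_riemannian_stratified_group G \<longleftrightarrow>
     lie_group G \<and> connected (UNIV::'g set) \<and> simply_connected (UNIV::'g set) \<and> nilpotent G \<and>
     stratified G \<and>
     (\<forall>v. linear (ip G v)) \<and> (\<forall>v w. ip G v w = ip G w v) \<and> (\<forall>v. v \<noteq> 0 \<longrightarrow> ip G v v > 0) \<and>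
     (\<forall>j\<in>{1..step G}. \<forall>k\<in>{1..step G}. j \<noteq> k \<longrightarrow>
        (\<forall>v\<in>layer G j. \<forall>w\<in>layer G k. ip G v w = 0)) \<and>
     (\<forall>k. 1 \<le> k \<and> k < step G \<longrightarrow> bracket_isometry G k) \<and>
     orthonormal_adapted G"

abbreviation hdim :: "('g, 'a::euclidean_space) stratified_group \<Rightarrow> nat" where
  "hdim G \<equiv> dim (layer G 1)"

definition horizontal ::
  "('g, 'a::euclidean_space) stratified_group \<Rightarrow> 'g \<Rightarrow> 'a set" where
  "horizontal G g = (\<lambda>v. left_field G v g) ` layer G 1"

definition metric ::
  "('g, 'a::euclidean_space) stratified_group \<Rightarrow> 'g \<Rightarrow> 'a \<Rightarrow> 'a \<Rightarrow> real" where
  "metric G g v w =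
     (let back = tangent_map (charts G) (charts G) (mul G (ginv G g)) g in ip G (back v) (back w))"

definition dual :: "(nat \<Rightarrow> 'a::euclidean_space) \<Rightarrow> nat \<Rightarrow> 'a \<Rightarrow> real" where
  "dual f j v = representation (f ` {..<DIM('a)}) v (f j)"

definition frame ::
  "('g, 'a::euclidean_space) stratified_group \<Rightarrow> 'g \<Rightarrow> nat \<Rightarrow> 'a" where
  "frame G g j = left_field G (bas G j) g"

text \<open>
  The torsion of the flat connection, from \<open>T(e\<^sub>i, e\<^sub>j) = -[e\<^sub>i, e\<^sub>j]\<close> by bilinearity.
\<close>

definition torsion ::
  "('g, 'a::euclidean_space) stratified_group \<Rightarrow> 'g \<Rightarrow> 'a \<Rightarrow> 'a \<Rightarrow> 'a" where
  "torsion G g v w =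
     (\<Sum>i<DIM('a). \<Sum>j<DIM('a). (dual (frame G g) i v * dual (frame G g) j w) *\<^sub>R
        (- lie_bracket (charts G) (\<lambda>x. frame G x i) (\<lambda>x. frame G x j) g))"


section \<open>Non-horizontal immersions\<close>

definition immersion ::
  "('g::topological_space, 'a::euclidean_space) stratified_group \<Rightarrow>
   ('m::topological_space, 'b::real_normed_vector) atlas \<Rightarrow> ('m \<Rightarrow> 'g) \<Rightarrow> bool" where
  "immersion G A \<iota> \<longleftrightarrow>
     smooth_map A (charts G) UNIV \<iota> \<and> (\<forall>x. inj (tangent_map A (charts G) \<iota> x))"

definition tangent_image ::
  "('g, 'a::euclidean_space) stratified_group \<Rightarrow> ('m, 'b::real_normed_vector) atlas \<Rightarrow>
   ('m \<Rightarrow> 'g) \<Rightarrow> 'm \<Rightarrow> 'a set" where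
  "tangent_image G A \<iota> x = range (tangent_map A (charts G) \<iota> x)"

definition non_horizontal ::
  "('g, 'a::euclidean_space) stratified_group \<Rightarrow> ('m, 'b::real_normed_vector) atlas \<Rightarrow>
   ('m \<Rightarrow> 'g) \<Rightarrow> bool" where
  "non_horizontal G A \<iota> \<longleftrightarrow>
     (\<forall>x. {v + w | v w. v \<in> tangent_image G A \<iota> x \<and> w \<in> horizontal G (\<iota> x)} = UNIV)"

text \<open>
  In what follows \<open>T\<close> stands for the tangent space of the submanifold at one of its points \<open>g\<close>
  (for an immersion, of the sheet under consideration).
\<close>

definition normal_space ::
  "('g, 'a::euclidean_space) stratified_group \<Rightarrow> 'g \<Rightarrow> 'a set \<Rightarrow> 'a set" where
  "normal_space G g T = {w \<in> horizontal G g. \<forall>v \<in> T \<inter> horizontal G g. metric G g v w = 0}"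

definition tan_part ::
  "('g, 'a::euclidean_space) stratified_group \<Rightarrow> 'g \<Rightarrow> 'a set \<Rightarrow> 'a \<Rightarrow> 'a" where
  "tan_part G g T v = (THE t. t \<in> T \<and> v - t \<in> normal_space G g T)"

definition perp_part ::
  "('g, 'a::euclidean_space) stratified_group \<Rightarrow> 'g \<Rightarrow> 'a set \<Rightarrow> 'a \<Rightarrow> 'a" where
  "perp_part G g T v = v - tan_part G g T v"

text \<open>
  The value at \<open>g\<close> of an adapted basis; \<open>p\<close> is the codimension.  The volume form and the mean
  torsion at \<open>g\<close> only involve this value, and every such value is attained by a local
  adapted frame.  They do not depend on which adapted basis is chosen, except that the
  volume form changes sign with the orientation.
\<close>

definition adapted_basis ::
  "('g, 'a::euclidean_space) stratified_group \<Rightarrow> nat \<Rightarrow> 'g \<Rightarrow> 'a set \<Rightarrow> (nat \<Rightarrow> 'a) \<Rightarrow> bool" where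
  "adapted_basis G p g T f \<longleftrightarrow>
     (\<forall>i<hdim G. \<forall>j<hdim G. metric G g (f i) (f j) = (if i = j then 1 else 0)) \<and>
     span (f ` {..<hdim G}) = horizontal G g \<and>
     span (f ` {..<p}) = normal_space G g T \<and>
     span (f ` {p..<hdim G}) = T \<inter> horizontal G g \<and>
     (\<forall>j\<in>{hdim G..<DIM('a)}.
        (\<exists>a. f j = frame G g j - (\<Sum>\<alpha><p. a \<alpha> *\<^sub>R f \<alpha>)) \<and> f j \<in> T)"

definition some_adapted_basis ::
  "('g, 'a::euclidean_space) stratified_group \<Rightarrow> nat \<Rightarrow> 'g \<Rightarrow> 'a set \<Rightarrow> nat \<Rightarrow> 'a" where
  "some_adapted_basis G p g T = (SOME f. adapted_basis G p g T f)"

text \<open>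
  The volume form of the \<open>\<mu>\<close>-measure at \<open>\<iota> x\<close>, on vectors of \<open>tangent_image G A \<iota> x\<close>; the orientation
  \<open>\<omega>\<close> of the source is carried over by \<open>\<iota>\<close>.  For a positively oriented adapted basis it is
  \<open>dual f p \<and> \<dots> \<and> dual f (n - 1)\<close> with \<open>n = DIM('a)\<close>.  The sign factor makes it the same form for the other
  adapted bases; it is needed because for \<open>p = hdim G\<close> the vectors \<open>f j\<close> with \<open>j \<ge> p\<close> are
  determined by \<open>bas G\<close>, so that an adapted basis cannot be reoriented without changing \<open>bas G\<close>.
\<close>

definition mu_volume_form ::
  "('g, 'a::euclidean_space) stratified_group \<Rightarrow> nat \<Rightarrow> ('m, 'b::real_normed_vector) atlas \<Rightarrow>
   ('m \<Rightarrow> (nat \<Rightarrow> 'b) \<Rightarrow> real) \<Rightarrow> ('m \<Rightarrow> 'g) \<Rightarrow> 'm \<Rightarrow> (nat \<Rightarrow> 'a) \<Rightarrow> real" where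
  "mu_volume_form G p A \<omega> \<iota> x w =
     (let f = some_adapted_basis G p (\<iota> x) (tangent_image G A \<iota> x)
      in sgn (\<omega> x (\<lambda>k. inv (tangent_map A (charts G) \<iota> x) (f (p + k)))) *
         wedge (DIM('a) - p) (\<lambda>k. dual f (p + k)) w)"

definition pulled_back_volume ::
  "('g, 'a::euclidean_space) stratified_group \<Rightarrow> nat \<Rightarrow> ('m, 'b::real_normed_vector) atlas \<Rightarrow>
   ('m \<Rightarrow> (nat \<Rightarrow> 'b) \<Rightarrow> real) \<Rightarrow> ('m \<Rightarrow> 'g) \<Rightarrow> 'm \<Rightarrow> (nat \<Rightarrow> 'b) \<Rightarrow> real" where
  "pulled_back_volume G p A \<omega> \<iota> x v =
     mu_volume_form G p A \<omega> \<iota> x (\<lambda>k. tangent_map A (charts G) \<iota> x (v k))"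

text \<open>
  The flat connection for which the left-invariant fields are parallel, acting on a field \<open>\<xi>\<close>
  along \<open>\<iota>\<close> (so \<open>\<xi> y\<close> is tangent to the group at \<open>\<iota> y\<close>): it differentiates the components
  of \<open>\<xi>\<close> in the frame \<open>e\<^sub>j\<close> in the direction \<open>X\<close>, a tangent vector of the source at \<open>x\<close>.
\<close>

definition flat_connection ::
  "('g, 'a::euclidean_space) stratified_group \<Rightarrow> ('m, 'b::real_normed_vector) atlas \<Rightarrow>
   ('m \<Rightarrow> 'g) \<Rightarrow> ('m \<Rightarrow> 'a) \<Rightarrow> 'm \<Rightarrow> 'b \<Rightarrow> 'a" where
  "flat_connection G A \<iota> \<xi> x X =
     (\<Sum>j<DIM('a). tangent_map A real_atlas (\<lambda>y. dual (frame G (\<iota> y)) j (\<xi> y)) x X *\<^sub>R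
        frame G (\<iota> x) j)"

text \<open>As an endomorphism of the tangent space of the source at \<open>x\<close>, identified with its image.\<close>

definition weingarten ::
  "('g, 'a::euclidean_space) stratified_group \<Rightarrow> ('m, 'b::real_normed_vector) atlas \<Rightarrow>
   ('m \<Rightarrow> 'g) \<Rightarrow> ('m \<Rightarrow> 'a) \<Rightarrow> 'm \<Rightarrow> 'b \<Rightarrow> 'b" where
  "weingarten G A \<iota> \<xi> x X =
     inv (tangent_map A (charts G) \<iota> x)
       (- tan_part G (\<iota> x) (tangent_image G A \<iota> x) (flat_connection G A \<iota> \<xi> x X))"

definition endo_trace :: "('b::real_vector \<Rightarrow> 'b) \<Rightarrow> real" where
  "endo_trace L =
     (let B = (SOME B. independent B \<and> span B = UNIV) in \<Sum>b\<in>B. representation B (L b) b)"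

definition mean_curvature ::
  "('g, 'a::euclidean_space) stratified_group \<Rightarrow> ('m, 'b::real_normed_vector) atlas \<Rightarrow>
   ('m \<Rightarrow> 'g) \<Rightarrow> ('m \<Rightarrow> 'a) \<Rightarrow> 'm \<Rightarrow> real" where
  "mean_curvature G A \<iota> \<xi> x = - endo_trace (weingarten G A \<iota> \<xi> x)"

definition mean_torsion ::
  "('g, 'a::euclidean_space) stratified_group \<Rightarrow> nat \<Rightarrow> ('m, 'b::real_normed_vector) atlas \<Rightarrow>
   ('m \<Rightarrow> 'g) \<Rightarrow> ('m \<Rightarrow> 'a) \<Rightarrow> 'm \<Rightarrow> real" where
  "mean_torsion G p A \<iota> \<xi> x =
     (let f = some_adapted_basis G p (\<iota> x) (tangent_image G A \<iota> x)
      in \<Sum>j\<in>{hdim G..<DIM('a)}. dual f j (torsion G (\<iota> x) (\<xi> x) (f j)))"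


section \<open>Variations\<close>

definition variation ::
  "('g::topological_space, 'a::euclidean_space) stratified_group \<Rightarrow>
   ('m::topological_space, 'b::real_normed_vector) atlas \<Rightarrow> ('m \<Rightarrow> 'g) \<Rightarrow>
   real \<Rightarrow> (real \<Rightarrow> 'm \<Rightarrow> 'g) \<Rightarrow> bool" where
  "variation G A \<iota> \<epsilon> F \<longleftrightarrow>
     0 < \<epsilon> \<and>
     smooth_map (prod_atlas real_atlas A) (charts G) ({-\<epsilon><..<\<epsilon>} \<times> UNIV) (\<lambda>(u, x). F u x) \<and>
     (\<forall>u\<in>{-\<epsilon><..<\<epsilon>}. immersion G A (F u) \<and> non_horizontal G A (F u)) \<and>
     F 0 = \<iota>"

definition variation_field ::
  "('g, 'a::euclidean_space) stratified_group \<Rightarrow> (real \<Rightarrow> 'm \<Rightarrow> 'g) \<Rightarrow> 'm \<Rightarrow> 'a" where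
  "variation_field G F x = tangent_map real_atlas (charts G) (\<lambda>u. F u x) 0 1"

end

(*
  The left-invariant frame turns the differential of F into a form theta on the product of the
  time interval and M with values in a fixed Euclidean space; it satisfies the Maurer-Cartan
  equation.  If nu_1, ..., nu_p is an orthonormal basis of the normal space, then
  Gamma(v) = +-Omega(nu, theta v_1, ..., theta v_k) for the left-invariant volume form Omega.
  When the point moves, nu_a changes only by horizontal vectors; the parts tangent to M and the
  skew-symmetric rotation of the normal space do not contribute.  Hence the derivative of Gamma
  in a direction V is Gamma times the trace of w -> (D_V theta(w))^top.  For V = (1, -Z), where Z is
  the tangential part of W, the Maurer-Cartan equation gives
  D_V theta(w) = D_w W^perp + theta(D_w Z) - [W^perp, theta w].  The three traces are the mean
  curvature, the divergence of Z, and the mean torsion: brackets of horizontal vectors lie in the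
  second layer, so that only the non-horizontal vectors of an adapted basis contribute to it.
  The derivative along Z and the divergence combine to d(Z _| Gamma).
*)
theory Submission
  imports Defs
begin

section \<open>Alternating forms\<close>

text \<open>The adapted basis at a point is produced by a choice operator, so neither the normal
  vectors nor the volume form come with any regularity along the variation, and no differentiable
  adapted frame is constructed. What is differentiated is the square of the density: the squared
  values of the invariant volume form are summed over all tuples of fixed horizontal frame vectors
  in the first \<open>p\<close> slots. At each single point an adapted basis may replace the fixed
  frame, since such sums are the same for all orthonormal frames, and then every tuple with a
  tangential entry drops out. Thus the normal vectors never have to be differentiated. The remaining
  \<open>p!\<close> permutations of the normal vectors account for the constant
  \<open>fact p\<close>. The sign lost by squaring is recovered from the orientation form, which is
  continuous and nowhere zero, hence of locally constant sign on a fixed basis in a chart. The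
  tangential part of the variation is differentiable because Cramer's rule expresses it through the
  same kind of sums.\<close>

definition multilinear_form :: "nat \<Rightarrow> ((nat \<Rightarrow> 'b::real_vector) \<Rightarrow> real) \<Rightarrow> bool" where
  "multilinear_form k \<alpha> \<longleftrightarrow>
     (\<forall>v w. (\<forall>i<k. v i = w i) \<longrightarrow> \<alpha> v = \<alpha> w) \<and> (\<forall>v. \<forall>i<k. linear (\<lambda>a. \<alpha> (v(i := a))))"

lemma alternating_form_iff:
  "alternating_form k \<alpha> \<longleftrightarrow>
     multilinear_form k \<alpha> \<and> (\<forall>v i j. i < j \<and> j < k \<and> v i = v j \<longrightarrow> \<alpha> v = 0)"
  by (auto simp: alternating_form_def multilinear_form_def)

lemma alternating_form_imp_multilinear: "alternating_form k \<alpha> \<Longrightarrow> multilinear_form k \<alpha>"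
  by (simp add: alternating_form_iff)

lemma multilinear_form_cong:
  "multilinear_form k \<alpha> \<Longrightarrow> (\<And>i. i < k \<Longrightarrow> v i = w i) \<Longrightarrow> \<alpha> v = \<alpha> w"
  by (auto simp: multilinear_form_def)

lemma multilinear_form_linear: "multilinear_form k \<alpha> \<Longrightarrow> i < k \<Longrightarrow> linear (\<lambda>a. \<alpha> (v(i := a)))"
  by (auto simp: multilinear_form_def)

lemma alternating_form_eq_0:
  assumes "alternating_form k \<alpha>" "i < k" "j < k" "i \<noteq> j" "v i = v j"
  shows "\<alpha> v = 0"
  using assms unfolding alternating_form_def by (metis linorder_neqE_nat)

text \<open>The set \<open>A\<close> of slots already expanded is a parameter so that the induction
  can open one slot at a time; the other slots keep their entry of \<open>v\<close>.\<close>

lemma multilinear_form_expand_slots: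
  assumes m: "multilinear_form k \<alpha>" and J: "finite J" and A: "A \<subseteq> {..<k}"
    and v: "\<And>i. i \<in> A \<Longrightarrow> v i = (\<Sum>j\<in>J. c i j *\<^sub>R b j)"
  shows "\<alpha> v = (\<Sum>f\<in>A \<rightarrow>\<^sub>E J. (\<Prod>i\<in>A. c i (f i)) * \<alpha> (\<lambda>i. if i \<in> A then b (f i) else v i))"
proof -
  have "finite A" using A finite_subset by blast
  then show ?thesis using A v
  proof (induction A rule: finite_induct)
    case empty
    then show ?case by simp
  next
    case (insert a A)
    \<comment> \<open>Slot \<open>a\<close> is expanded in an arbitrary tuple \<open>u\<close>,
      because the slots of \<open>A\<close> will already hold vectors \<open>b (f i)\<close> when
      this is applied.\<close>
    have one: "\<alpha> u = (\<Sum>j\<in>J. c a j * \<alpha> (u(a := b j)))" if "u a = v a" for u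
    proof -
      have lin: "linear (\<lambda>t. \<alpha> (u(a := t)))"
        using m insert.prems(1) by (intro multilinear_form_linear) auto
      have "\<alpha> u = \<alpha> (u(a := (\<Sum>j\<in>J. c a j *\<^sub>R b j)))"
        using that insert.prems(2)[of a] by (metis fun_upd_triv insertI1)
      also have "\<dots> = (\<Sum>j\<in>J. c a j * \<alpha> (u(a := b j)))"
        by (simp add: linear_sum[OF lin] linear_cmul[OF lin])
      finally show ?thesis .
    qed
    have eq: "(\<lambda>i. if i \<in> insert a A then b ((f(a := j)) i) else v i) =
        (\<lambda>i. if i \<in> A then b (f i) else v i)(a := b j)" for f j
      using insert.hyps by auto
    have "(\<Sum>f\<in>insert a A \<rightarrow>\<^sub>E J. (\<Prod>i\<in>insert a A. c i (f i)) *
             \<alpha> (\<lambda>i. if i \<in> insert a A then b (f i) else v i))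
        = (\<Sum>(j, f)\<in>J \<times> (A \<rightarrow>\<^sub>E J). (\<Prod>i\<in>insert a A. c i ((f(a := j)) i)) *
             \<alpha> (\<lambda>i. if i \<in> insert a A then b ((f(a := j)) i) else v i))"
      unfolding PiE_insert_eq using insert.hyps
      by (subst sum.reindex) (use inj_combinator[of a A "\<lambda>_. J"] in
          \<open>simp_all only: case_prod_unfold o_def not_False_eq_True\<close>)
    also have "\<dots> = (\<Sum>(j, f)\<in>J \<times> (A \<rightarrow>\<^sub>E J). (\<Prod>i\<in>A. c i (f i)) * (c a j *
             \<alpha> ((\<lambda>i. if i \<in> A then b (f i) else v i)(a := b j))))"
    proof -
      have "(\<Prod>i\<in>insert a A. c i ((f(a := j)) i)) = c a j * (\<Prod>i\<in>A. c i (f i))" for f j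
        using insert.hyps by (subst prod.insert) (auto intro!: prod.cong)
      then show ?thesis by (intro sum.cong) (auto simp only: eq mult_ac split: prod.splits)
    qed
    also have "\<dots> = (\<Sum>f\<in>A \<rightarrow>\<^sub>E J. \<Sum>j\<in>J. (\<Prod>i\<in>A. c i (f i)) * (c a j *
             \<alpha> ((\<lambda>i. if i \<in> A then b (f i) else v i)(a := b j))))"
      by (subst sum.swap) (simp add: sum.cartesian_product)
    also have "\<dots> = (\<Sum>f\<in>A \<rightarrow>\<^sub>E J. (\<Prod>i\<in>A. c i (f i)) * \<alpha> (\<lambda>i. if i \<in> A then b (f i) else v i))"
      using insert.hyps by (subst one) (auto simp: sum_distrib_left)
    also have "\<dots> = \<alpha> v"
      using insert by simp
    finally show ?case by simp
  qed
qed

lemma multilinear_form_expand: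
  assumes m: "multilinear_form k \<alpha>" and J: "finite J"
    and v: "\<And>i. i < k \<Longrightarrow> v i = (\<Sum>j\<in>J. c i j *\<^sub>R b j)"
  shows "\<alpha> v = (\<Sum>f\<in>{..<k} \<rightarrow>\<^sub>E J. (\<Prod>i<k. c i (f i)) * \<alpha> (b \<circ> f))"
proof -
  have "\<alpha> (\<lambda>i. if i \<in> {..<k} then b (f i) else v i) = \<alpha> (b \<circ> f)" for f
    by (rule multilinear_form_cong[OF m]) auto
  then show ?thesis
    using multilinear_form_expand_slots[OF m J, of "{..<k}" v c b] v by simp
qed

text \<open>Polarisation: the form vanishes when both slots hold \<open>v i + v j\<close>, and so do
  the two diagonal terms of the expansion; the two mixed terms are left.\<close>

lemma alternating_form_swap:
  assumes a: "alternating_form k \<alpha>" and ij: "i < k" "j < k" "i \<noteq> j"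
  shows "\<alpha> (v(i := v j, j := v i)) = - \<alpha> v"
proof -
  note m = alternating_form_imp_multilinear[OF a]
  define \<beta> where "\<beta> s t = \<alpha> (v(i := s, j := t))" for s t
  have add1: "\<beta> (s + s') t = \<beta> s t + \<beta> s' t" for s s' t
    using linear_add[OF multilinear_form_linear[OF m ij(1), of "v(j := t)"]] ij
    by (simp add: \<beta>_def fun_upd_twist)
  have add2: "\<beta> s (t + t') = \<beta> s t + \<beta> s t'" for s t t'
    using linear_add[OF multilinear_form_linear[OF m ij(2), of "v(i := s)"]] by (simp add: \<beta>_def)
  have diag: "\<beta> s s = 0" for s
    unfolding \<beta>_def using ij by (intro alternating_form_eq_0[OF a ij]) auto
  have "\<beta> (v i) (v j) + \<beta> (v j) (v i) = 0"
    using diag[of "v i + v j"] diag[of "v i"] diag[of "v j"]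
    by (simp only: add1 add2)
  then show ?thesis by (simp add: \<beta>_def)
qed

lemma alternating_form_permutes:
  assumes a: "alternating_form k \<alpha>" and \<pi>: "\<pi> permutes {..<k}"
  shows "\<alpha> (v \<circ> \<pi>) = of_int (sign \<pi>) * \<alpha> v"
  using \<pi> finite_lessThan
proof (induction arbitrary: v rule: permutes_induct)
  case id
  then show ?case by simp
next
  case (swap i j p)
  let ?t = "Transposition.transpose i j"
  have perm: "permutation p" "permutation ?t"
    using swap.hyps permutes_imp_permutation[of "{..<k}" p] by (auto intro: permutation_swap_id)
  have v: "v \<circ> ?t = v(i := v j, j := v i)"
    by (auto simp: Transposition.transpose_def)
  have "\<alpha> (v \<circ> (?t \<circ> p)) = of_int (sign p) * \<alpha> (v \<circ> ?t)"
    using swap.IH[of "v \<circ> ?t"] by (simp only: o_assoc)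
  also have "\<alpha> (v \<circ> ?t) = of_int (sign ?t) * \<alpha> v"
    using alternating_form_swap[OF a, of i j v] swap.hyps by (cases "i = j")
        (auto simp: v sign_swap_id)
  finally show ?case
    using sign_compose[OF perm(2,1)] by (simp only: of_int_mult mult_ac)
qed

section \<open>Wedge products of covectors\<close>

lemma multilinear_form_wedge:
  assumes \<theta>: "\<And>i. i < k \<Longrightarrow> linear (\<theta> i)"
  shows "multilinear_form k (wedge k \<theta>)"
  unfolding multilinear_form_def
proof (intro conjI allI impI)
  fix v w :: "nat \<Rightarrow> 'a"
  assume "\<forall>i<k. v i = w i"
  then show "wedge k \<theta> v = wedge k \<theta> w"
    unfolding wedge_def using permutes_in_image[of _ "{..<k}"]
    by (intro sum.cong arg_cong2[of _ _ _ _ "(*)"] prod.cong refl) auto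
next
  fix v :: "nat \<Rightarrow> 'a" and i assume i: "i < k"
  have "linear (\<lambda>a. of_int (sign \<pi>) * (\<Prod>m<k. \<theta> m ((v(i := a)) (\<pi> m))))" if \<pi>: "\<pi> permutes {..<k}"
      for \<pi>
  proof -
    \<comment> \<open>In the term of \<open>\<pi>\<close>, the entry of slot \<open>i\<close> is
      seen by exactly one factor, the one with index \<open>l\<close>.\<close>
    define l where "l = inv \<pi> i"
    have l: "l < k" "\<pi> l = i" "\<And>m. \<pi> m = i \<longleftrightarrow> m = l"
      using \<pi> i permutes_inverses[OF \<pi>] permutes_in_image[OF permutes_inv[OF \<pi>], of i]
          by (auto simp: l_def)
    have "(\<Prod>m<k. \<theta> m ((v(i := a)) (\<pi> m))) = (\<Prod>m\<in>{..<k}-{l}. \<theta> m (v (\<pi> m))) * \<theta> l a" for a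
    proof -
      have "(\<Prod>m<k. \<theta> m ((v(i := a)) (\<pi> m))) = \<theta> l a * (\<Prod>m\<in>{..<k}-{l}. \<theta> m ((v(i := a)) (\<pi> m)))"
        using l by (subst prod.remove[of _ l]) auto
      also have "(\<Prod>m\<in>{..<k}-{l}. \<theta> m ((v(i := a)) (\<pi> m))) = (\<Prod>m\<in>{..<k}-{l}. \<theta> m (v (\<pi> m)))"
        using l by (intro prod.cong) auto
      finally show ?thesis by simp
    qed
    then show ?thesis
      using linear_add[OF \<theta>[OF l(1)]] linear_cmul[OF \<theta>[OF l(1)]]
      by (intro linearI) (simp_all add: algebra_simps)
  qed
  then show "linear (\<lambda>a. wedge k \<theta> (v(i := a)))"
    unfolding wedge_def by (intro linear_compose_sum) auto
qed

text \<open>If two entries agree, composing all permutations with their transposition keeps every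
  product and reverses every sign, so the sum equals its own negative.\<close>

lemma alternating_form_wedge:
  assumes \<theta>: "\<And>i. i < k \<Longrightarrow> linear (\<theta> i)"
  shows "alternating_form k (wedge k \<theta>)"
  unfolding alternating_form_iff
proof (intro conjI allI impI)
  show "multilinear_form k (wedge k \<theta>)" by (rule multilinear_form_wedge[OF \<theta>])
next
  fix v :: "nat \<Rightarrow> 'a" and i j
  assume H: "i < j \<and> j < k \<and> v i = v j"
  let ?t = "Transposition.transpose i j"
  have t: "?t permutes {..<k}" using H by (intro permutes_swap_id) auto
  have vt: "v (?t m) = v m" for m using H by (auto simp: Transposition.transpose_def)
  have "wedge k \<theta> v = (\<Sum>\<pi> | \<pi> permutes {..<k}. of_int (sign (?t \<circ> \<pi>)) *
      (\<Prod>m<k. \<theta> m (v ((?t \<circ> \<pi>) m))))"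
    unfolding wedge_def by (rule setum_permutations_compose_left[OF t])
  also have "\<dots> = (\<Sum>\<pi> | \<pi> permutes {..<k}. - (of_int (sign \<pi>) * (\<Prod>m<k. \<theta> m (v (\<pi> m)))))"
  proof (intro sum.cong refl)
    fix \<pi> assume "\<pi> \<in> {\<pi>. \<pi> permutes {..<k}}"
    then have "permutation \<pi>" "permutation ?t"
      using t permutes_imp_permutation[of "{..<k}"] by auto
    then have "sign (?t \<circ> \<pi>) = - sign \<pi>" using H by (simp add: sign_compose sign_swap_id)
    then show "of_int (sign (?t \<circ> \<pi>)) * (\<Prod>m<k. \<theta> m (v ((?t \<circ> \<pi>) m))) =
      - (of_int (sign \<pi>) * (\<Prod>m<k. \<theta> m (v (\<pi> m))))" by (simp add: vt)
  qed
  also have "\<dots> = - wedge k \<theta> v" unfolding wedge_def by (simp add: sum_negf)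
  finally show "wedge k \<theta> v = 0" by simp
qed

text \<open>An injective self-map of a finite set is a permutation. The restriction mediates between
  two encodings: extensional functions are \<open>undefined\<close> outside \<open>{..<k}\<close>,
  permutations are the identity there.\<close>

lemma sum_PiE_permutes:
  fixes t :: "(nat \<Rightarrow> nat) \<Rightarrow> real"
  assumes t: "\<And>f. f \<in> {..<k} \<rightarrow>\<^sub>E {..<k} \<Longrightarrow> \<not> inj_on f {..<k} \<Longrightarrow> t f = 0"
  shows "(\<Sum>f\<in>{..<k} \<rightarrow>\<^sub>E {..<k}. t f) = (\<Sum>\<pi> | \<pi> permutes {..<k}. t (restrict \<pi> {..<k}))"
proof -
  let ?P = "{\<pi>. \<pi> permutes {..<k}}"
  let ?r = "\<lambda>\<pi>. restrict \<pi> {..<k}"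
  have "(\<Sum>f\<in>{..<k} \<rightarrow>\<^sub>E {..<k}. t f) = (\<Sum>f\<in>?r ` ?P. t f)"
  proof (rule sum.mono_neutral_right)
    show "?r ` ?P \<subseteq> {..<k} \<rightarrow>\<^sub>E {..<k}"
      using permutes_in_image[of _ "{..<k}"]
      by (intro image_subsetI) (auto simp: PiE_iff simp del: lessThan_iff)
    show "\<forall>f\<in>({..<k} \<rightarrow>\<^sub>E {..<k}) - ?r ` ?P. t f = 0"
    proof
      fix f assume f: "f \<in> ({..<k} \<rightarrow>\<^sub>E {..<k}) - ?r ` ?P"
      have "\<not> inj_on f {..<k}"
      proof
        assume "inj_on f {..<k}"
        moreover have "f ` {..<k} \<subseteq> {..<k}" using f by (auto simp: PiE_iff)
        ultimately have "bij_betw f {..<k} {..<k}"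
          by (simp add: bij_betw_def endo_inj_surj)
        then have "bij_betw (\<lambda>i. if i \<in> {..<k} then f i else i) {..<k} {..<k}"
          using bij_betw_cong[of "{..<k}" f "\<lambda>i. if i \<in> {..<k} then f i else i" "{..<k}"] by simp
        then have "(\<lambda>i. if i \<in> {..<k} then f i else i) permutes {..<k}"
          by (rule bij_imp_permutes) simp
        moreover have "f = ?r (\<lambda>i. if i \<in> {..<k} then f i else i)"
          using f by (auto simp: PiE_iff extensional_def restrict_def)
        ultimately show False using f by blast
      qed
      then show "t f = 0" using t f by blast
    qed
  qed (auto intro: finite_PiE)
  also have "\<dots> = (\<Sum>\<pi>\<in>?P. t (?r \<pi>))"
  proof (rule sum.reindex_cong[OF _ refl refl])
    show "inj_on ?r ?P"
    proof (rule inj_onI)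
      fix p q assume H: "p \<in> ?P" "q \<in> ?P" "?r p = ?r q"
      show "p = q"
      proof
        fix i
        have "?r p i = ?r q i" by (simp only: H(3))
        then show "p i = q i" using H(1,2) by (cases "i < k") (auto simp: permutes_def)
      qed
    qed
  qed
  finally show ?thesis .
qed

lemma alternating_form_not_inj:
  assumes a: "alternating_form k \<alpha>" and f: "\<not> inj_on f {..<k}"
  shows "\<alpha> (b \<circ> f) = 0"
proof -
  obtain i j where "i < k" "j < k" "i \<noteq> j" "f i = f j" using f by (auto simp: inj_on_def)
  then show ?thesis by (intro alternating_form_eq_0[OF a, of i j]) auto
qed

lemma alternating_form_restrict_permutes:
  assumes a: "alternating_form k \<alpha>" and \<pi>: "\<pi> permutes {..<k}"
  shows "\<alpha> (v \<circ> restrict \<pi> {..<k}) = of_int (sign \<pi>) * \<alpha> v"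
proof -
  have "\<alpha> (v \<circ> restrict \<pi> {..<k}) = \<alpha> (v \<circ> \<pi>)"
    by (rule multilinear_form_cong[OF alternating_form_imp_multilinear[OF a]]) auto
  then show ?thesis by (simp only: alternating_form_permutes[OF a \<pi>])
qed

text \<open>Leibniz expansion of a determinant. The covectors \<open>\<theta>\<close> and the
  vectors \<open>w\<close> may live on another space than \<open>b\<close>: this later compares the
  orientation form of the source with the dual coframe in the group.\<close>

lemma alternating_form_top:
  assumes a: "alternating_form k \<alpha>"
    and v: "\<And>i. i < k \<Longrightarrow> v i = (\<Sum>j<k. \<theta> j (w i) *\<^sub>R b j)"
  shows "\<alpha> v = \<alpha> b * wedge k \<theta> w"
proof -
  note m = alternating_form_imp_multilinear[OF a]
  let ?P = "{\<pi>. \<pi> permutes {..<k}}"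
  let ?t = "\<lambda>f. (\<Prod>i<k. \<theta> (f i) (w i)) * \<alpha> (b \<circ> f)"
  have "\<alpha> v = (\<Sum>f\<in>{..<k} \<rightarrow>\<^sub>E {..<k}. ?t f)"
    using multilinear_form_expand[OF m, of "{..<k}" v "\<lambda>i j. \<theta> j (w i)" b] v by simp
  also have "\<dots> = (\<Sum>\<pi>\<in>?P. ?t (restrict \<pi> {..<k}))"
    by (rule sum_PiE_permutes) (simp add: alternating_form_not_inj[OF a] del: comp_apply)
  also have "\<dots> = (\<Sum>\<pi>\<in>?P. \<alpha> b * (of_int (sign \<pi>) * (\<Prod>i<k. \<theta> (\<pi> i) (w i))))"
    by (intro sum.cong refl) (simp add: alternating_form_restrict_permutes[OF a] mult_ac)
  also have "\<dots> = \<alpha> b * (\<Sum>\<pi>\<in>?P. of_int (sign \<pi>) * (\<Prod>i<k. \<theta> (\<pi> i) (w i)))"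
    by (simp add: sum_distrib_left)
  \<comment> \<open>The expansion permutes the covectors, whereas \<open>wedge\<close> permutes the
    arguments; summing over inverse permutations, which have the same sign, passes from one to the
    other.\<close>
  also have "(\<Sum>\<pi>\<in>?P. of_int (sign \<pi>) * (\<Prod>i<k. \<theta> (\<pi> i) (w i))) =
      (\<Sum>\<pi>\<in>?P. of_int (sign (inv \<pi>)) * (\<Prod>i<k. \<theta> (inv \<pi> i) (w i)))"
    by (rule sum_permutations_inverse)
  also have "\<dots> = wedge k \<theta> w"
    unfolding wedge_def
  proof (intro sum.cong refl)
    fix \<pi> assume "\<pi> \<in> ?P"
    then have \<pi>: "\<pi> permutes {..<k}" by simp
    have "(\<Prod>i<k. \<theta> (inv \<pi> i) (w i)) = (\<Prod>i<k. \<theta> i (w (\<pi> i)))"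
      using prod.permute[OF \<pi>, of "\<lambda>i. \<theta> (inv \<pi> i) (w i)"] permutes_inverses[OF \<pi>] by simp
    moreover have "sign (inv \<pi>) = sign \<pi>"
      using \<pi> permutes_imp_permutation[of "{..<k}"] by (intro sign_inverse) auto
    ultimately show "of_int (sign (inv \<pi>)) * (\<Prod>i<k. \<theta> (inv \<pi> i) (w i)) =
       real_of_int (sign \<pi>) * (\<Prod>i<k. \<theta> i (w (\<pi> i)))" by simp
  qed
  finally show ?thesis .
qed

section \<open>Bases indexed by natural numbers\<close>

text \<open>A basis is a family rather than a set, so that it can be put into the slots of a form;
  \<open>k = 0\<close> is allowed.\<close>

definition tuple_basis :: "nat \<Rightarrow> (nat \<Rightarrow> 'b::real_vector) \<Rightarrow> bool" where
  "tuple_basis k b \<longleftrightarrow> inj_on b {..<k} \<and> independent (b ` {..<k}) \<and> span (b ` {..<k}) = UNIV"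

definition component :: "nat \<Rightarrow> (nat \<Rightarrow> 'b::real_vector) \<Rightarrow> nat \<Rightarrow> 'b \<Rightarrow> real" where
  "component k b j v = representation (b ` {..<k}) v (b j)"

lemma dual_eq_component: "dual f = component DIM('a) (f :: nat \<Rightarrow> 'a::euclidean_space)"
  by (simp add: dual_def component_def fun_eq_iff)

lemma sum_component:
  assumes "tuple_basis k b"
  shows "(\<Sum>j<k. component k b j v *\<^sub>R b j) = v"
proof -
  have "(\<Sum>j<k. component k b j v *\<^sub>R b j) = (\<Sum>x\<in>b ` {..<k}. representation (b ` {..<k}) v x *\<^sub>R x)"
    using assms by (subst sum.reindex) (auto simp: tuple_basis_def component_def)
  also have "\<dots> = v"
    using assms by (intro sum_representation_eq) (auto simp: tuple_basis_def)
  finally show ?thesis .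
qed

lemma linear_component:
  assumes "tuple_basis k b"
  shows "linear (component k b j)"
  using assms unfolding component_def[abs_def] tuple_basis_def
  by (intro linearI) (auto simp: representation_add representation_scale)

lemma component_basis:
  assumes "tuple_basis k b" "i < k" "j < k"
  shows "component k b i (b j) = (if i = j then 1 else 0)"
proof -
  have "component k b i (b j) = (if b j = b i then 1 else 0)"
    using assms unfolding component_def tuple_basis_def
    by (subst representation_basis) auto
  then show ?thesis using assms by (auto simp: tuple_basis_def inj_on_def)
qed

lemma component_sum:
  assumes "tuple_basis k b" "i < k"
  shows "component k b i (\<Sum>j<k. c j *\<^sub>R b j) = c i"
  using assms linear_component[OF assms(1), of i]
  by (simp add: linear_sum linear_cmul component_basis if_distrib[of "\<lambda>x. _ * x"] cong: if_cong)

lemma tuple_basisI: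
  assumes span: "\<And>v. v \<in> span (b ` {..<k})"
    and ind: "\<And>c. (\<Sum>j<k. c j *\<^sub>R b j) = 0 \<Longrightarrow> \<forall>j<k. c j = 0"
  shows "tuple_basis k b"
proof -
  have inj: "inj_on b {..<k}"
  proof (rule inj_onI, rule ccontr)
    fix i j assume H: "i \<in> {..<k}" "j \<in> {..<k}" "b i = b j" "i \<noteq> j"
    \<comment> \<open>Two equal entries would satisfy the nontrivial relation
      \<open>b i - b j = 0\<close>.\<close>
    have "(\<Sum>l<k. (if l = i then 1 else if l = j then - 1 else 0) *\<^sub>R b l) =
        (\<Sum>l<k. (if l = i then b l else 0) - (if l = j then b l else 0))"
      using H by (intro sum.cong) auto
    also have "\<dots> = 0" using H by (simp add: sum_subtractf)
    finally show False using ind H by fastforce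
  qed
  have "independent (b ` {..<k})"
  proof (rule independent_if_scalars_zero)
    fix f x assume f: "(\<Sum>x\<in>b ` {..<k}. f x *\<^sub>R x) = 0" and x: "x \<in> b ` {..<k}"
    have "(\<Sum>j<k. f (b j) *\<^sub>R b j) = 0" using f inj by (simp add: sum.reindex)
    then show "f x = 0" using ind[of "f \<circ> b"] x by auto
  qed simp
  then show ?thesis using inj span by (auto simp: tuple_basis_def)
qed

lemma tuple_basis_image:
  assumes b: "tuple_basis k b" and L: "linear L" "bij L"
  shows "tuple_basis k (\<lambda>i. L (b i))" "component k (\<lambda>i. L (b i)) j (L v) = component k b j v"
proof -
  have im: "(\<lambda>i. L (b i)) ` {..<k} = L ` (b ` {..<k})" by auto
  have inj: "inj L" using L by (simp add: bij_is_inj)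
  show tb: "tuple_basis k (\<lambda>i. L (b i))"
    unfolding tuple_basis_def im
  proof (intro conjI)
    show "inj_on (\<lambda>i. L (b i)) {..<k}"
      using b inj by (auto simp: tuple_basis_def inj_on_def)
    show "independent (L ` b ` {..<k})"
      using b L inj by (intro linear_independent_injective_image) (auto simp: tuple_basis_def)
    show "span (L ` b ` {..<k}) = UNIV"
      using b L by (simp add: linear_span_image tuple_basis_def bij_is_surj)
  qed
  show "component k (\<lambda>i. L (b i)) j (L v) = component k b j v"
  proof (cases "j < k")
    case True
    have "L v = (\<Sum>i<k. component k b i v *\<^sub>R L (b i))"
      by (subst sum_component[OF b, of v, symmetric])
          (simp add: linear_sum[OF L(1)] linear_cmul[OF L(1)])
    then show ?thesis using component_sum[OF tb True] by simp
  next
    \<comment> \<open>For \<open>j \<ge> k\<close> the vector \<open>b j\<close> is unconstrained: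
      it may repeat a basis vector, or lie outside the basis, where the representation is 0 on both
      sides.\<close>
    case False
    have 1: "representation (b ` {..<k}) v x = 0" if "x \<notin> b ` {..<k}" for x
      using that representation_ne_zero by blast
    have 2: "representation ((\<lambda>i. L (b i)) ` {..<k}) (L v) x = 0" if "x \<notin> (\<lambda>i. L (b i)) ` {..<k}"
        for x
      using that representation_ne_zero by blast
    show ?thesis
    proof (cases "b j \<in> b ` {..<k}")
      case True
      then obtain i where i: "i < k" "b j = b i" by auto
      have "L v = (\<Sum>i<k. component k b i v *\<^sub>R L (b i))"
        by (subst sum_component[OF b, of v, symmetric])
            (simp add: linear_sum[OF L(1)] linear_cmul[OF L(1)])
      then have "component k (\<lambda>i. L (b i)) i (L v) = component k b i v"
        using component_sum[OF tb i(1)] by simp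
      then show ?thesis by (simp add: component_def i)
    next
      case False
      then have "L (b j) \<notin> (\<lambda>i. L (b i)) ` {..<k}" using inj by (auto simp: inj_eq image_iff)
      then show ?thesis using False 1 2 by (simp add: component_def)
    qed
  qed
qed

lemma wedge_dual_basis:
  assumes "\<And>i j. i < k \<Longrightarrow> j < k \<Longrightarrow> \<theta> i (b j) = (if i = j then 1 else 0)"
  shows "wedge k \<theta> b = 1"
proof -
  have "wedge k \<theta> b = (\<Sum>\<pi>\<in>{id}. of_int (sign \<pi>) * (\<Prod>i<k. \<theta> i (b (\<pi> i))))"
    unfolding wedge_def
  proof (rule sum.mono_neutral_right)
    show "\<forall>\<pi>\<in>{\<pi>. \<pi> permutes {..<k}} - {id}. real_of_int (sign \<pi>) * (\<Prod>i<k. \<theta> i (b (\<pi> i))) = 0"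
    proof
      fix \<pi> assume "\<pi> \<in> {\<pi>. \<pi> permutes {..<k}} - {id}"
      then have \<pi>: "\<pi> permutes {..<k}" "\<pi> \<noteq> id" by auto
      then obtain i where i: "\<pi> i \<noteq> i" by (auto simp: fun_eq_iff)
      then have "i < k" "\<pi> i < k" using \<pi>(1) permutes_in_image[OF \<pi>(1)] by (auto simp: permutes_def)
      then have "(\<Prod>i<k. \<theta> i (b (\<pi> i))) = 0"
        using assms i by (intro prod_zero bexI[of _ i]) auto
      then show "real_of_int (sign \<pi>) * (\<Prod>i<k. \<theta> i (b (\<pi> i))) = 0" by simp
    qed
  qed (auto simp: finite_permutations permutes_id)
  also have "\<dots> = 1" using assms by simp
  finally show ?thesis .
qed

section \<open>Top-degree forms and traces\<close>

lemma alternating_form_basis: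
  assumes "alternating_form k \<alpha>" "tuple_basis k b"
  shows "\<alpha> v = \<alpha> b * wedge k (component k b) v"
  by (rule alternating_form_top[OF assms(1)]) (simp add: sum_component[OF assms(2)])

text \<open>The derivation induced by \<open>L\<close>, applied to \<open>\<alpha>\<close>. If
  \<open>v i = v j\<close>, only the terms at \<open>i\<close> and \<open>j\<close> survive, and
  they differ by a swap.\<close>

lemma alternating_form_trace_sum:
  assumes a: "alternating_form k \<alpha>" and L: "linear L"
  shows "alternating_form k (\<lambda>v. \<Sum>i<k. \<alpha> (v(i := L (v i))))"
  unfolding alternating_form_def
proof (intro conjI allI impI)
  note m = alternating_form_imp_multilinear[OF a]
  fix v w :: "nat \<Rightarrow> 'a" assume "\<forall>i<k. v i = w i"
  then show "(\<Sum>i<k. \<alpha> (v(i := L (v i)))) = (\<Sum>i<k. \<alpha> (w(i := L (w i))))"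
    by (intro sum.cong refl multilinear_form_cong[OF m]) auto
next
  note m = alternating_form_imp_multilinear[OF a]
  fix v :: "nat \<Rightarrow> 'a" and l assume l: "l < k"
  have "linear (\<lambda>a. \<alpha> ((v(l := a))(i := L ((v(l := a)) i))))" if "i < k" for i
  proof (cases "i = l")
    case True
    have "linear ((\<lambda>a. \<alpha> (v(l := a))) \<circ> L)"
      by (rule linear_compose[OF L multilinear_form_linear[OF m l]])
    then show ?thesis using True by (simp add: o_def)
  next
    case False
    then have "(v(l := a))(i := L ((v(l := a)) i)) = (v(i := L (v i)))(l := a)" for a by auto
    then show ?thesis using multilinear_form_linear[OF m l, of "v(i := L (v i))"] by simp
  qed
  then show "linear (\<lambda>a. \<Sum>i<k. \<alpha> ((v(l := a))(i := L ((v(l := a)) i))))"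
    by (intro linear_compose_sum) auto
next
  fix v :: "nat \<Rightarrow> 'a" and i j assume H: "i < j \<and> j < k \<and> v i = v j"
  have "(\<Sum>l<k. \<alpha> (v(l := L (v l)))) = (\<Sum>l\<in>{i, j}. \<alpha> (v(l := L (v l))))"
  proof (rule sum.mono_neutral_right)
    show "\<forall>l\<in>{..<k} - {i, j}. \<alpha> (v(l := L (v l))) = 0"
      using H by (intro ballI alternating_form_eq_0[OF a, of i j]) auto
  qed (use H in auto)
  also have "\<dots> = \<alpha> (v(i := L (v j))) + \<alpha> (v(j := L (v j)))" using H by simp
  also have "\<alpha> (v(i := L (v j))) = - \<alpha> (v(j := L (v j)))"
  proof -
    have "(v(j := L (v j)))(i := (v(j := L (v j))) j, j := (v(j := L (v j))) i) = v(i := L (v j))"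
      using H by auto
    then show ?thesis
      using alternating_form_swap[OF a, of i j "v(j := L (v j))"] H by simp
  qed
  finally show "(\<Sum>l<k. \<alpha> (v(l := L (v l)))) = 0" by (simp del: fun_upd_apply)
qed

lemma alternating_form_upd_basis:
  assumes a: "alternating_form k \<alpha>" and b: "tuple_basis k b" and i: "i < k"
  shows "\<alpha> (b(i := z)) = component k b i z * \<alpha> b"
proof -
  note lin = multilinear_form_linear[OF alternating_form_imp_multilinear[OF a] i, of b]
  have "\<alpha> (b(i := z)) = \<alpha> (b(i := (\<Sum>j<k. component k b j z *\<^sub>R b j)))"
    by (simp add: sum_component[OF b])
  also have "\<dots> = (\<Sum>j<k. component k b j z * \<alpha> (b(i := b j)))"
    by (simp add: linear_sum[OF lin] linear_cmul[OF lin])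
  also have "\<dots> = (\<Sum>j\<in>{i}. component k b j z * \<alpha> (b(i := b j)))"
  proof (rule sum.mono_neutral_right)
    show "\<forall>j\<in>{..<k} - {i}. component k b j z * \<alpha> (b(i := b j)) = 0"
      using i alternating_form_eq_0[OF a, of i] by auto
  qed (use i in auto)
  finally show ?thesis by simp
qed

text \<open>Top-degree forms are multiples of each other, so the derivation induced by
  \<open>L\<close> acts on them by a scalar; evaluation on \<open>b\<close> identifies this scalar
  as the sum of the diagonal entries.\<close>

lemma alternating_form_sum_eq_trace:
  assumes a: "alternating_form k \<alpha>" and L: "linear L" and b: "tuple_basis k b"
  shows "(\<Sum>i<k. \<alpha> (v(i := L (v i)))) = (\<Sum>i<k. component k b i (L (b i))) * \<alpha> v"
proof -
  have "(\<Sum>i<k. \<alpha> (b(i := L (b i)))) = (\<Sum>i<k. component k b i (L (b i))) * \<alpha> b"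
    by (simp add: alternating_form_upd_basis[OF a b] sum_distrib_right del: fun_upd_apply)
  then show ?thesis
    using alternating_form_basis[OF alternating_form_trace_sum[OF a L] b, of v]
      alternating_form_basis[OF a b, of v] by simp
qed

lemma alternating_form_component:
  assumes "tuple_basis k b"
  shows "alternating_form k (wedge k (component k b))" "wedge k (component k b) b = 1"
  using assms by (auto intro!: alternating_form_wedge linear_component wedge_dual_basis simp:
      component_basis)

lemma ex_tuple_basis:
  assumes "independent B" "span B = (UNIV :: 'b::real_vector set)" "finite B"
  obtains b where "tuple_basis (card B) b" "b ` {..<card B} = B"
proof -
  obtain b where "bij_betw b {..<card B} B"
    using ex_bij_betw_nat_finite[OF assms(3)] by (auto simp: atLeast0LessThan)
  then show ?thesis using that[of b] assms by (auto simp: tuple_basis_def bij_betw_def)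
qed

text \<open>Both the chosen basis and \<open>b\<close> compute the same scalar, by which
  \<open>L\<close> acts on a nonzero top-degree form. Hence the choice made in
  \<open>endo_trace\<close> is immaterial.\<close>

lemma endo_trace_eq:
  fixes b :: "nat \<Rightarrow> 'b::real_vector"
  assumes b: "tuple_basis k b" and L: "linear L"
  shows "endo_trace L = (\<Sum>i<k. component k b i (L (b i)))"
proof -
  define B where "B = (SOME B::'b set. independent B \<and> span B = UNIV)"
  have B: "independent B" "span B = UNIV"
    using someI[of "\<lambda>B::'b set. independent B \<and> span B = UNIV" "b ` {..<k}"] b
    by (auto simp: B_def tuple_basis_def)
  have bb: "independent (b ` {..<k})" "span (b ` {..<k}) = UNIV" "card (b ` {..<k}) = k"
    using b by (auto simp: tuple_basis_def card_image)
  \<comment> \<open>The chosen basis is an arbitrary independent spanning set; only comparison with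
    \<open>b\<close> shows that it has \<open>k\<close> elements and can be enumerated.\<close>
  have fin: "finite B" "card B \<le> k"
    using independent_span_bound[of "b ` {..<k}" B] B bb by auto
  have "card B = k"
    using independent_span_bound[of B "b ` {..<k}"] B bb fin by auto
  then obtain c where c: "tuple_basis k c" "c ` {..<k} = B"
    using ex_tuple_basis[OF B fin(1)] by metis
  have "endo_trace L = (\<Sum>x\<in>c ` {..<k}. representation B (L x) x)"
    by (simp add: endo_trace_def B_def[symmetric] Let_def c(2))
  also have "\<dots> = (\<Sum>i<k. component k c i (L (c i)))"
    using c by (subst sum.reindex) (auto simp: component_def tuple_basis_def)
  also have "\<dots> = (\<Sum>i<k. component k b i (L (b i)))"
    using alternating_form_sum_eq_trace[OF alternating_form_component(1)[OF c(1)] L c(1), of c]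
      alternating_form_sum_eq_trace[OF alternating_form_component(1)[OF c(1)] L b, of c]
      alternating_form_component(2)[OF c(1)] by simp
  finally show ?thesis .
qed

lemma alternating_form_endo_trace:
  fixes b :: "nat \<Rightarrow> 'b::real_vector"
    and L :: "'b \<Rightarrow> 'b"
  assumes "alternating_form k \<alpha>" "linear L" "tuple_basis k b"
  shows "(\<Sum>i<k. \<alpha> (v(i := L (v i)))) = endo_trace L * \<alpha> v"
  using alternating_form_sum_eq_trace[OF assms] endo_trace_eq[OF assms(3,2)] by simp

lemma endo_trace_add:
  fixes b :: "nat \<Rightarrow> 'b::real_vector" and L L' :: "'b \<Rightarrow> 'b"
  assumes "tuple_basis k b" "linear L" "linear L'"
  shows "endo_trace (\<lambda>x. L x + L' x) = endo_trace L + endo_trace L'"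
  using assms linear_component[OF assms(1)]
  by (simp add: endo_trace_eq linear_compose_add linear_add sum.distrib)

lemma endo_trace_uminus:
  fixes b :: "nat \<Rightarrow> 'b::real_vector"
    and L :: "'b \<Rightarrow> 'b"
  assumes "tuple_basis k b" "linear L"
  shows "endo_trace (\<lambda>x. - L x) = - endo_trace L"
  using assms linear_component[OF assms(1)]
  by (simp add: endo_trace_eq linear_compose_neg linear_neg sum_negf)

text \<open>Used with \<open>l\<close> the differential of the density and \<open>z\<close> the
  tangential part of the variation, so that the trace becomes a directional derivative.\<close>

lemma endo_trace_rank_one:
  fixes b :: "nat \<Rightarrow> 'b::real_vector" and l :: "'b \<Rightarrow> real"
  assumes b: "tuple_basis k b" and l: "linear l"
  shows "endo_trace (\<lambda>x. l x *\<^sub>R z) = l z"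
proof -
  have "linear (\<lambda>x. l x *\<^sub>R z)" using l by (auto simp: linear_iff scaleR_left_distrib)
  then have "endo_trace (\<lambda>x. l x *\<^sub>R z) = (\<Sum>i<k. l (b i) * component k b i z)"
    using endo_trace_eq[OF b, of "\<lambda>x. l x *\<^sub>R z"] linear_component[OF b] by (simp add: linear_cmul)
  also have "\<dots> = l (\<Sum>i<k. component k b i z *\<^sub>R b i)"
    using l by (simp add: linear_sum linear_cmul mult.commute)
  finally show ?thesis by (simp add: sum_component[OF b])
qed

lemma alternating_form_compose_linear:
  assumes a: "alternating_form k \<alpha>" and L: "linear L"
  shows "alternating_form k (\<lambda>v. \<alpha> (\<lambda>i. L (v i)))"
  unfolding alternating_form_def
proof (intro conjI allI impI)
  note m = alternating_form_imp_multilinear[OF a]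
  show "\<alpha> (\<lambda>i. L (v i)) = \<alpha> (\<lambda>i. L (w i))" if "\<forall>i<k. v i = w i" for v w
    using that by (intro multilinear_form_cong[OF m]) auto
  show "linear (\<lambda>a. \<alpha> (\<lambda>j. L ((v(i := a)) j)))" if "i < k" for v i
  proof -
    have "(\<lambda>j. L ((v(i := a)) j)) = (\<lambda>j. L (v j))(i := L a)" for a by auto
    then show ?thesis
      using linear_compose[OF L multilinear_form_linear[OF m that, of "\<lambda>j. L (v j)"]]
          by (simp add: o_def)
  qed
  show "\<alpha> (\<lambda>i. L (v i)) = 0" if "i < j \<and> j < k \<and> v i = v j" for v i j
    using that by (intro alternating_form_eq_0[OF a, of i j]) auto
qed

text \<open>The sign is that of the cycle which moves the first slot to position \<open>i\<close>.\<close>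

lemma alternating_form_case_nat:
  fixes v :: "nat \<Rightarrow> 'b::real_vector"
  assumes a: "alternating_form k \<alpha>" and i: "i < k"
  shows "\<alpha> (case_nat z (\<lambda>j. if j < i then v j else v (Suc j))) = (-1) ^ i * \<alpha> (v(i := z))"
  using i
proof (induction i arbitrary: v)
  case 0
  have "case_nat z (\<lambda>j. if j < 0 then v j else v (Suc j)) = v(0 := z)"
    by (auto simp: fun_eq_iff split: nat.splits)
  then show ?case by (simp only: power_0 mult_1)
next
  case (Suc i)
  let ?c = "\<lambda>i v. case_nat z (\<lambda>j. if j < i then v j else v (Suc j))"
  let ?v = "v(i := v (Suc i), Suc i := v i)"
  have "?c (Suc i) v = ?c i ?v"
    by (auto simp: fun_eq_iff split: nat.splits)
  then have "\<alpha> (?c (Suc i) v) = \<alpha> (?c i ?v)" by simp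
  also have "\<dots> = (-1) ^ i * \<alpha> (?v(i := z))"
    using Suc.prems by (intro Suc.IH) auto
  also have "?v(i := z) = (v(Suc i := z))(i := (v(Suc i := z)) (Suc i), Suc i := (v(Suc i := z)) i)"
    by auto
  also have "\<alpha> \<dots> = - \<alpha> (v(Suc i := z))"
    using Suc.prems by (intro alternating_form_swap[OF a]) auto
  finally show ?case by (simp del: fun_upd_apply)
qed

section \<open>Non-horizontal subspaces of a Euclidean space\<close>

lemma tuple_basis_DIM:
  fixes f :: "nat \<Rightarrow> 'a::euclidean_space"
  assumes "span (f ` {..<DIM('a)}) = UNIV"
  shows "tuple_basis DIM('a) f"
proof -
  have "DIM('a) \<le> card (f ` {..<DIM('a)})"
    using dim_le_card[of UNIV "f ` {..<DIM('a)}"] assms by (simp add: dim_UNIV)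
  moreover have "card (f ` {..<DIM('a)}) \<le> DIM('a)"
    using card_image_le[of "{..<DIM('a)}" f] by simp
  ultimately have c: "card (f ` {..<DIM('a)}) = DIM('a)" by simp
  then have "independent (f ` {..<DIM('a)})"
    using card_le_dim_spanning[of "f ` {..<DIM('a)}" UNIV] assms by (simp add: dim_UNIV)
  then show ?thesis
    using c assms by (simp add: tuple_basis_def eq_card_imp_inj_on)
qed

lemma ex_orthonormal_tuple:
  fixes S :: "'a::euclidean_space set"
  assumes "subspace S"
  obtains b :: "nat \<Rightarrow> 'a" where "span (b ` {..<dim S}) = S"
    "\<And>i j. i < dim S \<Longrightarrow> j < dim S \<Longrightarrow> b i \<bullet> b j = (if i = j then 1 else 0)"
proof -
  obtain B where B: "B \<subseteq> S" "pairwise orthogonal B" "\<And>x. x \<in> B \<Longrightarrow> norm x = 1"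
    "independent B" "card B = dim S" "span B = S"
    using orthonormal_basis_subspace[OF assms] by metis
  obtain b where b: "bij_betw b {..<dim S} B"
    using ex_bij_betw_nat_finite[OF finiteI_independent[OF B(4)]] B(5)
        by (auto simp: atLeast0LessThan)
  show ?thesis
  proof (rule that[of b])
    show "span (b ` {..<dim S}) = S" using b B by (simp add: bij_betw_def)
  next
    fix i j assume "i < dim S" "j < dim S"
    then have "b i \<in> B" "b j \<in> B" "b i = b j \<longleftrightarrow> i = j"
      using b by (auto simp: bij_betw_def inj_on_def)
    then show "b i \<bullet> b j = (if i = j then 1 else 0)"
      using B(2,3) by (auto simp: pairwise_def orthogonal_def norm_eq_1)
  qed
qed

section \<open>Sums over orthonormal frames\<close>

lemma orthonormal_expansion:
  fixes f :: "nat \<Rightarrow> 'a::real_inner"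
  assumes o: "\<And>i j. i < d \<Longrightarrow> j < d \<Longrightarrow> f i \<bullet> f j = (if i = j then 1 else 0)"
    and v: "v \<in> span (f ` {..<d})"
  shows "v = (\<Sum>l<d. (v \<bullet> f l) *\<^sub>R f l)"
  using v
proof (induction rule: span_induct_alt)
  case base
  then show ?case by simp
next
  case (step c x y)
  then obtain i where i: "i < d" "x = f i" by auto
  have "(\<Sum>l<d. (x \<bullet> f l) *\<^sub>R f l) = (\<Sum>l<d. if l = i then f l else 0)"
    using i o by (intro sum.cong) auto
  also have "\<dots> = x" using i by simp
  finally have x: "(\<Sum>l<d. (x \<bullet> f l) *\<^sub>R f l) = x" .
  have "(\<Sum>l<d. ((c *\<^sub>R x + y) \<bullet> f l) *\<^sub>R f l)
      = c *\<^sub>R (\<Sum>l<d. (x \<bullet> f l) *\<^sub>R f l) + (\<Sum>l<d. (y \<bullet> f l) *\<^sub>R f l)"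
    by (simp add: inner_add_left scaleR_add_left sum.distrib scaleR_sum_right)
  then show ?case using x step.IH by simp
qed

text \<open>The sum is the inner product of \<open>\<phi>\<close> and \<open>\<psi>\<close> as
  tensors on the common span, and so it is the same for every orthonormal frame. It is what permits
  replacing the fixed horizontal frame by an adapted one.\<close>

lemma multilinear_sum_orthonormal:
  fixes e f :: "nat \<Rightarrow> 'a::real_inner"
  assumes m: "multilinear_form p \<phi>" "multilinear_form p \<psi>"
    and oe: "\<And>i j. i < d \<Longrightarrow> j < d \<Longrightarrow> e i \<bullet> e j = (if i = j then 1 else 0)"
    and of: "\<And>i j. i < d \<Longrightarrow> j < d \<Longrightarrow> f i \<bullet> f j = (if i = j then 1 else 0)"
    and sp: "span (e ` {..<d}) = span (f ` {..<d})"
  shows "(\<Sum>I\<in>{..<p} \<rightarrow>\<^sub>E {..<d}. \<phi> (f \<circ> I) * \<psi> (f \<circ> I)) =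
      (\<Sum>I\<in>{..<p} \<rightarrow>\<^sub>E {..<d}. \<phi> (e \<circ> I) * \<psi> (e \<circ> I))"
proof -
  let ?X = "{..<p} \<rightarrow>\<^sub>E {..<d}"
  have ef: "e i = (\<Sum>l<d. (e i \<bullet> f l) *\<^sub>R f l)" if "i < d" for i
    using that sp by (intro orthonormal_expansion[OF of]) (auto intro: span_base)
  have fe: "f i = (\<Sum>l<d. (f i \<bullet> e l) *\<^sub>R e l)" if "i < d" for i
    using that sp by (intro orthonormal_expansion[OF oe]) (auto intro: span_base)
  have exp: "\<gamma> (f \<circ> I) = (\<Sum>J\<in>?X. (\<Prod>i<p. f (I i) \<bullet> e (J i)) * \<gamma> (e \<circ> J))"
    if "multilinear_form p \<gamma>" "I \<in> ?X" for \<gamma> I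
  proof (rule multilinear_form_expand[OF that(1)])
    fix i assume "i < p"
    then show "(f \<circ> I) i = (\<Sum>j<d. (f (I i) \<bullet> e j) *\<^sub>R e j)"
      using that(2) fe[of "I i"] by (auto simp: PiE_iff)
  qed simp
  \<comment> \<open>The sum over \<open>I\<close> factors into one sum for each slot, and each of
    these is an entry of the product of the orthogonal transition matrix with its transpose.\<close>
  have delta: "(\<Sum>I\<in>?X. (\<Prod>i<p. f (I i) \<bullet> e (J i)) * (\<Prod>i<p. f (I i) \<bullet> e (K i))) =
      (if J = K then 1 else 0)"
    if "J \<in> ?X" "K \<in> ?X" for J K
  proof -
    have JK: "J i < d" "K i < d" if "i < p" for i
      using that \<open>J \<in> ?X\<close> \<open>K \<in> ?X\<close> by (auto simp: PiE_iff)
    have "(\<Sum>I\<in>?X. (\<Prod>i<p. f (I i) \<bullet> e (J i)) * (\<Prod>i<p. f (I i) \<bullet> e (K i))) =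
        (\<Prod>i<p. \<Sum>l<d. (f l \<bullet> e (J i)) * (f l \<bullet> e (K i)))"
      by (subst prod_sum_PiE) (auto simp: prod.distrib)
    also have "\<dots> = (\<Prod>i<p. if J i = K i then 1 else 0)"
    proof (intro prod.cong refl)
      fix i assume "i \<in> {..<p}"
      then have i: "J i < d" "K i < d" using JK by auto
      have "(\<Sum>l<d. (f l \<bullet> e (J i)) * (f l \<bullet> e (K i))) = (\<Sum>l<d. (e (J i) \<bullet> f l) *\<^sub>R f l) \<bullet> e (K i)"
        by (simp only: inner_sum_left inner_scaleR_left inner_commute[of "e (J i)"])
      also have "\<dots> = (if J i = K i then 1 else 0)" using ef[OF i(1)] oe[OF i] by simp
      finally show "(\<Sum>l<d. (f l \<bullet> e (J i)) * (f l \<bullet> e (K i))) = (if J i = K i then 1 else 0)" .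
    qed
    also have "\<dots> = (if J = K then 1 else 0)"
    proof (cases "J = K")
      case False
      then obtain i where "J i \<noteq> K i" by auto
      moreover from this have "i < p"
        using \<open>J \<in> ?X\<close> \<open>K \<in> ?X\<close> by (auto simp: PiE_iff extensional_def) (metis lessThan_iff)
      ultimately show ?thesis using False by (intro trans[OF prod_zero]) auto
    qed simp
    finally show ?thesis .
  qed
  have fin: "finite ?X" by (intro finite_PiE) auto
  have "(\<Sum>I\<in>?X. \<phi> (f \<circ> I) * \<psi> (f \<circ> I)) =
     (\<Sum>I\<in>?X. \<Sum>J\<in>?X. \<Sum>K\<in>?X. (\<phi> (e \<circ> J) * \<psi> (e \<circ> K)) *
         ((\<Prod>i<p. f (I i) \<bullet> e (J i)) * (\<Prod>i<p. f (I i) \<bullet> e (K i))))"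
    by (intro sum.cong refl)
      (simp only: exp[OF m(1)] exp[OF m(2)] sum_product mult_ac)
  also have "\<dots> = (\<Sum>J\<in>?X. \<Sum>K\<in>?X. \<Sum>I\<in>?X. (\<phi> (e \<circ> J) * \<psi> (e \<circ> K)) *
      ((\<Prod>i<p. f (I i) \<bullet> e (J i)) * (\<Prod>i<p. f (I i) \<bullet> e (K i))))"
    by (rule trans[OF sum.swap sum.cong[OF refl sum.swap]])
  also have "\<dots> = (\<Sum>J\<in>?X. \<Sum>K\<in>?X. (\<phi> (e \<circ> J) * \<psi> (e \<circ> K)) * (if J = K then 1 else 0))"
    by (intro sum.cong refl) (simp only: sum_distrib_left[symmetric] delta)
  also have "\<dots> = (\<Sum>J\<in>?X. \<phi> (e \<circ> J) * \<psi> (e \<circ> J))"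
    using fin by (simp add: if_distrib[of "\<lambda>x. _ * x"] cong: if_cong)
  finally show ?thesis .
qed

section \<open>Splitting the slots of a form into normal and tangential ones\<close>

definition join :: "nat \<Rightarrow> (nat \<Rightarrow> 'a) \<Rightarrow> (nat \<Rightarrow> 'a) \<Rightarrow> nat \<Rightarrow> 'a" where
  "join p h w i = (if i < p then h i else w (i - p))"

lemma join_upd_left: "i < p \<Longrightarrow> join p (h(i := a)) w = (join p h w)(i := a)"
  by (auto simp: join_def fun_eq_iff)

lemma join_upd_right: "join p h (w(i := a)) = (join p h w)(p + i := a)"
  by (auto simp: join_def fun_eq_iff)

lemma join_shift: "join p f (\<lambda>k. f (p + k)) = f"
  by (auto simp: join_def fun_eq_iff)

lemma alternating_form_join_left:
  assumes a: "alternating_form n \<alpha>" and "p \<le> n"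
  shows "alternating_form p (\<lambda>h. \<alpha> (join p h w))"
  unfolding alternating_form_def
proof (intro conjI allI impI)
  note m = alternating_form_imp_multilinear[OF a]
  show "\<alpha> (join p v w) = \<alpha> (join p v' w)" if "\<forall>i<p. v i = v' i" for v v'
    using that by (intro multilinear_form_cong[OF m]) (auto simp: join_def)
  show "linear (\<lambda>a. \<alpha> (join p (v(i := a)) w))" if "i < p" for v i
    using that assms(2) by (simp add: join_upd_left multilinear_form_linear[OF m])
  show "\<alpha> (join p v w) = 0" if "i < j \<and> j < p \<and> v i = v j" for v i j
    using that assms(2) by (intro alternating_form_eq_0[OF a, of i j]) (auto simp: join_def)
qed

lemma alternating_form_join_right:
  assumes a: "alternating_form n \<alpha>" and "p \<le> n"
  shows "alternating_form (n - p) (\<lambda>w. \<alpha> (join p h w))"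
  unfolding alternating_form_def
proof (intro conjI allI impI)
  note m = alternating_form_imp_multilinear[OF a]
  show "\<alpha> (join p h v) = \<alpha> (join p h v')" if "\<forall>i<n - p. v i = v' i" for v v'
    using that by (intro multilinear_form_cong[OF m]) (auto simp: join_def)
  show "linear (\<lambda>a. \<alpha> (join p h (v(i := a))))" if "i < n - p" for v i
    using that assms(2) by (simp add: join_upd_right multilinear_form_linear[OF m])
  show "\<alpha> (join p h v) = 0" if "i < j \<and> j < n - p \<and> v i = v j" for v i j
    using that assms(2) by (intro alternating_form_eq_0[OF a, of "p + i" "p + j"])
        (auto simp: join_def)
qed

text \<open>Only permutations survive, and each contributes the same product because its sign occurs
  twice. This is the origin of the factor \<open>fact p\<close>.\<close>

lemma sum_PiE_alternating_product:
  assumes "alternating_form p \<phi>" "alternating_form p \<psi>"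
  shows "(\<Sum>I\<in>{..<p} \<rightarrow>\<^sub>E {..<p}. \<phi> (f \<circ> I) * \<psi> (f \<circ> I)) = fact p * (\<phi> f * \<psi> f)"
proof -
  have "(\<Sum>I\<in>{..<p} \<rightarrow>\<^sub>E {..<p}. \<phi> (f \<circ> I) * \<psi> (f \<circ> I)) =
      (\<Sum>\<pi> | \<pi> permutes {..<p}. \<phi> (f \<circ> restrict \<pi> {..<p}) * \<psi> (f \<circ> restrict \<pi> {..<p}))"
    by (rule sum_PiE_permutes) (simp add: alternating_form_not_inj[OF assms(1)] del: comp_apply)
  also have "\<dots> = (\<Sum>\<pi> | \<pi> permutes {..<p}. \<phi> f * \<psi> f)"
  proof (intro sum.cong refl)
    fix \<pi> assume "\<pi> \<in> {\<pi>. \<pi> permutes {..<p}}"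
    then have "\<phi> (f \<circ> restrict \<pi> {..<p}) * \<psi> (f \<circ> restrict \<pi> {..<p}) =
        (of_int (sign \<pi>) * of_int (sign \<pi>)) * (\<phi> f * \<psi> f)"
      by (simp add: alternating_form_restrict_permutes[OF assms(1)]
          alternating_form_restrict_permutes[OF assms(2)] mult_ac del: comp_apply)
    also have "real_of_int (sign \<pi>) * of_int (sign \<pi>) = 1"
      by (simp add: of_int_mult[symmetric] del: of_int_mult)
    finally show "\<phi> (f \<circ> restrict \<pi> {..<p}) * \<psi> (f \<circ> restrict \<pi> {..<p}) = \<phi> f * \<psi> f"
      by (simp only: mult_1)
  qed
  also have "\<dots> = fact p * (\<phi> f * \<psi> f)"
    using card_permutations[of "{..<p}" p] by simp
  finally show ?thesis .
qed

text \<open>In an orthonormal basis the form is a polynomial in the coordinates of its arguments,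
  and the product rule applies to each monomial.\<close>

lemma has_derivative_multilinear_form:
  fixes \<alpha> :: "(nat \<Rightarrow> 'a::euclidean_space) \<Rightarrow> real"
  assumes m: "multilinear_form n \<alpha>" and w: "\<And>i. i < n \<Longrightarrow> ((\<lambda>s. w s i) has_derivative D i)
      (at s within A)"
  shows "((\<lambda>s. \<alpha> (w s)) has_derivative (\<lambda>h. \<Sum>i<n. \<alpha> ((w s)(i := D i h)))) (at s within A)"
proof -
  define b where "b = from_nat_into (Basis :: 'a set)"
  have bij: "bij_betw b {..<DIM('a)} Basis"
    unfolding b_def by (rule bij_betw_from_nat_into_finite) simp
  have exp: "v = (\<Sum>j<DIM('a). (v \<bullet> b j) *\<^sub>R b j)" for v :: 'a
    using sum.reindex_bij_betw[OF bij, of "\<lambda>c. (v \<bullet> c) *\<^sub>R c"]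
        by (simp add: euclidean_representation)
  let ?X = "{..<n} \<rightarrow>\<^sub>E {..<DIM('a)}"
  have e1: "\<alpha> u = (\<Sum>I\<in>?X. (\<Prod>i<n. u i \<bullet> b (I i)) * \<alpha> (b \<circ> I))" for u
    by (rule multilinear_form_expand[OF m]) (use exp in auto)
  have "((\<lambda>s. \<Sum>I\<in>?X. (\<Prod>i<n. w s i \<bullet> b (I i)) * \<alpha> (b \<circ> I)) has_derivative
      (\<lambda>h. \<Sum>I\<in>?X. (\<Sum>i<n. (D i h \<bullet> b (I i)) * (\<Prod>j\<in>{..<n}-{i}. w s j \<bullet> b (I j))) * \<alpha> (b \<circ> I)))
          (at s within A)"
    by (intro has_derivative_sum has_derivative_mult_left has_derivative_prod
        has_derivative_inner_left w) auto
  also have "(\<lambda>h. \<Sum>I\<in>?X. (\<Sum>i<n. (D i h \<bullet> b (I i)) * (\<Prod>j\<in>{..<n}-{i}. w s j \<bullet> b (I j))) * \<alpha> (b \<circ> I)) =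
      (\<lambda>h. \<Sum>i<n. \<alpha> ((w s)(i := D i h)))"
  proof
    fix h
    have "\<alpha> ((w s)(i := D i h)) =
        (\<Sum>I\<in>?X. ((D i h \<bullet> b (I i)) * (\<Prod>j\<in>{..<n}-{i}. w s j \<bullet> b (I j))) * \<alpha> (b \<circ> I))" if i: "i <
            n" for i
      unfolding e1[of "(w s)(i := D i h)"]
    proof (intro sum.cong refl arg_cong2[of _ _ _ _ "(*)"])
      fix I
      have "(\<Prod>j<n. ((w s)(i := D i h)) j \<bullet> b (I j)) =
          (D i h \<bullet> b (I i)) * (\<Prod>j\<in>{..<n}-{i}. ((w s)(i := D i h)) j \<bullet> b (I j))"
        using i by (subst prod.remove[of _ i]) auto
      also have "(\<Prod>j\<in>{..<n}-{i}. ((w s)(i := D i h)) j \<bullet> b (I j)) =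
          (\<Prod>j\<in>{..<n}-{i}. w s j \<bullet> b (I j))"
        by (intro prod.cong) auto
      finally show "(\<Prod>j<n. ((w s)(i := D i h)) j \<bullet> b (I j)) =
          (D i h \<bullet> b (I i)) * (\<Prod>j\<in>{..<n}-{i}. w s j \<bullet> b (I j))" .
    qed
    then have "(\<Sum>i<n. \<alpha> ((w s)(i := D i h))) =
       (\<Sum>i<n. \<Sum>I\<in>?X. ((D i h \<bullet> b (I i)) * (\<Prod>j\<in>{..<n}-{i}. w s j \<bullet> b (I j))) * \<alpha> (b \<circ> I))" by simp
    then show "(\<Sum>I\<in>?X. (\<Sum>i<n. (D i h \<bullet> b (I i)) * (\<Prod>j\<in>{..<n}-{i}. w s j \<bullet> b (I j))) * \<alpha> (b \<circ> I)) =
        (\<Sum>i<n. \<alpha> ((w s)(i := D i h)))"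
      by (subst (asm) sum.swap) (simp add: sum_distrib_right)
  qed
  finally show ?thesis unfolding e1[symmetric] .
qed

text \<open>
  The tangent space of the group at a point, in the coordinates given by the frame: \<open>e\<close> is the
  left-invariant frame and \<open>H\<close> the horizontal space.
\<close>

locale frame_space =
  fixes e :: "nat \<Rightarrow> 'a::euclidean_space" and d :: nat
  assumes orthonormal: "\<And>i j. i < DIM('a) \<Longrightarrow> j < DIM('a) \<Longrightarrow> e i \<bullet> e j = (if i = j then 1 else 0)"
    and d_le: "d \<le> DIM('a)"
begin

definition H :: "'a set" where "H = span (e ` {..<d})"

definition N :: "'a set \<Rightarrow> 'a set" where
  "N T = {w \<in> H. \<forall>v \<in> T \<inter> H. v \<bullet> w = 0}"

definition adapted :: "nat \<Rightarrow> 'a set \<Rightarrow> (nat \<Rightarrow> 'a) \<Rightarrow> bool" where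
  "adapted p T f \<longleftrightarrow>
     (\<forall>i<d. \<forall>j<d. f i \<bullet> f j = (if i = j then 1 else 0)) \<and>
     span (f ` {..<d}) = H \<and> span (f ` {..<p}) = N T \<and> span (f ` {p..<d}) = T \<inter> H \<and>
     (\<forall>j\<in>{d..<DIM('a)}. (\<exists>a. f j = e j - (\<Sum>\<alpha><p. a \<alpha> *\<^sub>R f \<alpha>)) \<and> f j \<in> T)"

definition transversal :: "nat \<Rightarrow> 'a set \<Rightarrow> bool" where
  "transversal p T \<longleftrightarrow> subspace T \<and> p + dim T = DIM('a) \<and> (\<forall>v. \<exists>t\<in>T. \<exists>h\<in>H. v = t + h)"

definition tan_proj :: "'a set \<Rightarrow> 'a \<Rightarrow> 'a" where
  "tan_proj T v = (THE t. t \<in> T \<and> v - t \<in> N T)"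

definition Vol :: "(nat \<Rightarrow> 'a) \<Rightarrow> real" where
  "Vol = wedge DIM('a) (\<lambda>i v. v \<bullet> e i)"

text \<open>
  Summing over all tuples of horizontal frame vectors avoids the choice of an adapted basis: for
  vectors tangent to \<open>T\<close>, \<open>vol_product p w w\<close> is \<open>fact p\<close> times the square of the
  \<open>\<mu>\<close>-volume of \<open>w\<close>, and it is a polynomial in \<open>w\<close>.
\<close>

definition vol_product :: "nat \<Rightarrow> (nat \<Rightarrow> 'a) \<Rightarrow> (nat \<Rightarrow> 'a) \<Rightarrow> real" where
  "vol_product p w w' =
     (\<Sum>I\<in>{..<p} \<rightarrow>\<^sub>E {..<d}. Vol (join p (e \<circ> I) w) * Vol (join p (e \<circ> I) w'))"

lemma Vol_alternating: "alternating_form DIM('a) Vol"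
  unfolding Vol_def
  by (intro alternating_form_wedge) (auto intro: bounded_linear.linear bounded_linear_inner_left)

lemma Vol_join_left: "q \<le> DIM('a) \<Longrightarrow> alternating_form q (\<lambda>h. Vol (join q h w))"
  by (rule alternating_form_join_left[OF Vol_alternating])

lemma Vol_join_right: "q \<le> DIM('a) \<Longrightarrow> alternating_form (DIM('a) - q) (\<lambda>w. Vol (join q h w))"
  by (rule alternating_form_join_right[OF Vol_alternating])

lemma Vol_e: "Vol e = 1"
  unfolding Vol_def by (intro wedge_dual_basis) (auto simp: orthonormal inner_commute)

lemma subspace_H: "subspace H"
  by (simp add: H_def)

lemma subspace_N: "subspace (N T)"
  using subspace_H
  by (auto simp: N_def subspace_def inner_add_right)

lemma span_e: "span (e ` {..<DIM('a)}) = UNIV"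
proof -
  have inj: "inj_on e {..<DIM('a)}"
  proof (rule inj_onI)
    fix i j assume "i \<in> {..<DIM('a)}" "j \<in> {..<DIM('a)}" "e i = e j"
    then show "i = j" using orthonormal[of i j] orthonormal[of i i] by (auto split: if_splits)
  qed
  have "pairwise orthogonal (e ` {..<DIM('a)})" "0 \<notin> e ` {..<DIM('a)}"
    using orthonormal by (fastforce simp: pairwise_def orthogonal_def)+
  then have "independent (e ` {..<DIM('a)})" by (rule pairwise_orthogonal_independent)
  moreover have "card (e ` {..<DIM('a)}) = DIM('a)" using inj by (simp add: card_image)
  ultimately show ?thesis
    using card_eq_dim[of "e ` {..<DIM('a)}" UNIV] by (auto simp: dim_UNIV)
qed

lemma dim_H: "dim H = d"
proof -
  have sub: "{..<d} \<subseteq> {..<DIM('a)}" using d_le by auto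
  have tb: "tuple_basis DIM('a) e" by (rule tuple_basis_DIM[OF span_e])
  then have "independent (e ` {..<d})" "inj_on e {..<d}"
    using sub image_mono[OF sub, of e] by (auto simp: tuple_basis_def intro: inj_on_subset dest:
        dependent_mono)
  then show ?thesis by (simp add: H_def dim_span dim_eq_card_independent card_image)
qed

lemma T_inter_N: "w \<in> T \<Longrightarrow> w \<in> N T \<Longrightarrow> w = 0"
  using inner_eq_zero_iff[of w] by (auto simp: N_def)

lemma tan_proj_eqI:
  assumes T: "subspace T" and v: "t \<in> T" "v - t \<in> N T"
  shows "tan_proj T v = t"
  unfolding tan_proj_def
proof (rule the_equality)
  fix s assume s: "s \<in> T \<and> v - s \<in> N T"
  have "s - t \<in> T" using T s v(1) by (blast intro: subspace_diff)
  moreover have "(v - t) - (v - s) \<in> N T" by (rule subspace_diff[OF subspace_N])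
      (use s v(2) in blast)+
  ultimately show "s = t" using T_inter_N[of "s - t" T] by simp
qed (use v in blast)

section \<open>Adapted frames of a transversal subspace\<close>

context
  fixes p :: nat and T :: "'a set"
  assumes transversal: "transversal p T"
begin

lemma subspace_T: "subspace T" using transversal by (simp add: transversal_def)

text \<open>Dimension formula for \<open>T + H\<close>, which is the whole space by
  transversality.\<close>

lemma dim_T_inter_H: "p + dim (T \<inter> H) = d"
proof -
  have "{x + y |x y. x \<in> T \<and> y \<in> H} = UNIV"
    using transversal by (fastforce simp: transversal_def)
  then have "DIM('a) + dim (T \<inter> H) = dim T + d"
    using dim_sums_Int[OF subspace_T subspace_H] by (simp add: dim_H dim_UNIV)
  then show ?thesis using transversal by (simp add: transversal_def)
qed

lemma p_le: "p \<le> d" using dim_T_inter_H by simp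

lemma dim_N: "dim (N T) = p"
proof -
  have "N T = {y \<in> H. \<forall>x \<in> T \<inter> H. orthogonal x y}" by (simp add: N_def orthogonal_def)
  then have "dim (N T) + dim (T \<inter> H) = d"
    using dim_subspace_orthogonal_to_vectors[of "T \<inter> H" H] subspace_T subspace_H
    by (simp add: dim_H subspace_inter)
  then show ?thesis using dim_T_inter_H by simp
qed

text \<open>Orthonormal bases of \<open>N T\<close> and of \<open>T \<inter> H\<close> together form
  one of \<open>H\<close>, since the two spaces are orthogonal complements in \<open>H\<close>. The
  vertical frame vectors are then corrected by normal vectors until they are tangent.\<close>

lemma adapted_exists: "\<exists>f. adapted p T f"
proof -
  obtain a :: "nat \<Rightarrow> 'a" where a: "span (a ` {..<p}) = N T"
    "\<And>i j. i < p \<Longrightarrow> j < p \<Longrightarrow> a i \<bullet> a j = (if i = j then 1 else 0)"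
    using ex_orthonormal_tuple[OF subspace_N[of T]] dim_N by metis
  obtain b :: "nat \<Rightarrow> 'a" where b: "span (b ` {..<d - p}) = T \<inter> H"
    "\<And>i j. i < d - p \<Longrightarrow> j < d - p \<Longrightarrow> b i \<bullet> b j = (if i = j then 1 else 0)"
    using ex_orthonormal_tuple[of "T \<inter> H"] subspace_T subspace_H dim_T_inter_H
    by (metis subspace_inter add_diff_cancel_left')
  define g where "g = join p a b"
  have aN: "a i \<in> N T" if "i < p" for i using a(1) that by (metis imageI lessThan_iff span_base)
  have bT: "b i \<in> T \<inter> H" if "i < d - p" for i using b(1) that
      by (metis imageI lessThan_iff span_base)
  have ab: "a i \<bullet> b j = 0" "b j \<bullet> a i = 0" if "i < p" "j < d - p" for i j
    using aN[OF that(1)] bT[OF that(2)] inner_commute[of "a i" "b j"] by (auto simp: N_def)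
  have go: "g i \<bullet> g j = (if i = j then 1 else 0)" if "i < d" "j < d" for i j
    using that a(2) b(2) ab by (auto simp: g_def join_def)
  have "(\<lambda>i. i - p) ` {p..<d} = {..<d - p}"
  proof (intro equalityI subsetI)
    fix i assume "i \<in> {..<d - p}"
    then show "i \<in> (\<lambda>i. i - p) ` {p..<d}" by (intro image_eqI[of _ _ "i + p"]) auto
  qed auto
  moreover have "g ` {p..<d} = b ` (\<lambda>i. i - p) ` {p..<d}"
    by (auto simp: g_def join_def image_image)
  ultimately have gT: "span (g ` {p..<d}) = T \<inter> H" using b(1) by simp
  have "g ` {..<p} = a ` {..<p}" by (auto simp: g_def join_def)
  then have gN: "span (g ` {..<p}) = N T" using a(1) by simp
  have gin: "g i \<in> H" if "i < d" for i
    using that aN[of i] bT[of "i - p"] by (auto simp: g_def join_def N_def)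
  have indg: "independent (g ` {..<d})"
    using go by (intro pairwise_orthogonal_independent)
        (fastforce simp: pairwise_def orthogonal_def)+
  have "inj_on g {..<d}"
  proof (rule inj_onI)
    fix i j assume "i \<in> {..<d}" "j \<in> {..<d}" "g i = g j"
    then show "i = j" using go[of i j] go[of i i] by (auto split: if_splits)
  qed
  then have "H \<subseteq> span (g ` {..<d})"
    using card_eq_dim[of "g ` {..<d}" H] indg gin by (auto simp: card_image dim_H)
  then have gH: "span (g ` {..<d}) = H"
    using gin subspace_H by (intro span_subspace) auto
  \<comment> \<open>Write \<open>e j\<close> as a tangent plus a horizontal vector; removing the
    \<open>N T\<close>-part of the latter leaves only terms in \<open>T\<close>.\<close>
  have "\<exists>c. e j - (\<Sum>\<alpha><p. c \<alpha> *\<^sub>R g \<alpha>) \<in> T" for j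
  proof -
    obtain t h where th: "t \<in> T" "h \<in> H" "e j = t + h"
      using transversal unfolding transversal_def by blast
    have "h = (\<Sum>l<d. (h \<bullet> g l) *\<^sub>R g l)"
      using th gH by (intro orthonormal_expansion[OF go]) auto
    also have "{..<d} = {..<p} \<union> {p..<d}" using p_le by auto
    also have "(\<Sum>l\<in>{..<p} \<union> {p..<d}. (h \<bullet> g l) *\<^sub>R g l) =
        (\<Sum>l<p. (h \<bullet> g l) *\<^sub>R g l) + (\<Sum>l=p..<d. (h \<bullet> g l) *\<^sub>R g l)"
      by (intro sum.union_disjoint) auto
    finally have "e j - (\<Sum>l<p. (h \<bullet> g l) *\<^sub>R g l) = t + (\<Sum>l=p..<d. (h \<bullet> g l) *\<^sub>R g l)"
      using th by (simp add: algebra_simps)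
    also have "\<dots> \<in> T"
    proof (intro subspace_add[OF subspace_T] th subspace_sum[OF subspace_T]
        subspace_scale[OF subspace_T])
      fix l assume "l \<in> {p..<d}"
      then show "g l \<in> T" using gT by (metis IntD1 imageI span_base)
    qed
    finally show ?thesis by (rule exI[of _ "\<lambda>l. h \<bullet> g l"])
  qed
  then obtain c where c: "\<And>j. e j - (\<Sum>\<alpha><p. c j \<alpha> *\<^sub>R g \<alpha>) \<in> T" by metis
  define f where "f j = (if j < d then g j else e j - (\<Sum>\<alpha><p. c j \<alpha> *\<^sub>R g \<alpha>))" for j
  have "f ` {..<d} = g ` {..<d}" "f ` {..<p} = g ` {..<p}" "f ` {p..<d} = g ` {p..<d}"
    using p_le by (auto simp: f_def)
  moreover have "\<exists>a. f j = e j - (\<Sum>\<alpha><p. a \<alpha> *\<^sub>R f \<alpha>)" if "d \<le> j" for j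
    using that p_le by (intro exI[of _ "c j"]) (simp add: f_def)
  ultimately have "adapted p T f"
    unfolding adapted_def using go gT gN gH c by (auto simp: f_def)
  then show ?thesis by blast
qed

context
  fixes f :: "nat \<Rightarrow> 'a"
  assumes adapted: "adapted p T f"
begin

lemma adapted_H: "i < d \<Longrightarrow> f i \<in> H"
  using adapted span_base[of "f i" "f ` {..<d}"] by (auto simp: adapted_def)

lemma adapted_N: "i < p \<Longrightarrow> f i \<in> N T"
  using adapted span_base[of "f i" "f ` {..<p}"] by (auto simp: adapted_def)

lemma adapted_T: "p \<le> i \<Longrightarrow> i < DIM('a) \<Longrightarrow> f i \<in> T"
  using adapted span_base[of "f i" "f ` {p..<d}"] by (cases "i < d") (auto simp: adapted_def)

lemma adapted_shear: "d \<le> j \<Longrightarrow> j < DIM('a) \<Longrightarrow> \<exists>a. f j = e j - (\<Sum>\<alpha><p. a \<alpha> *\<^sub>R f \<alpha>)"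
  using adapted by (simp add: adapted_def)

lemma adapted_span: "span (f ` {..<DIM('a)}) = UNIV"
proof -
  have "e j \<in> span (f ` {..<DIM('a)})" if j: "j < DIM('a)" for j
  proof (cases "j < d")
    case True
    then have "e j \<in> H" by (auto simp: H_def intro: span_base)
    then have "e j \<in> span (f ` {..<d})" using adapted by (simp add: adapted_def)
    then show ?thesis using span_mono[of "f ` {..<d}" "f ` {..<DIM('a)}"]
        image_mono[of "{..<d}" "{..<DIM('a)}" f] d_le by blast
  next
    case False
    then obtain a where "f j = e j - (\<Sum>\<alpha><p. a \<alpha> *\<^sub>R f \<alpha>)"
      using adapted_shear[of j] j by auto
    then have "e j = f j + (\<Sum>\<alpha><p. a \<alpha> *\<^sub>R f \<alpha>)" by simp
    also have "\<dots> \<in> span (f ` {..<DIM('a)})"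
      using j p_le d_le by (intro span_add span_sum span_scale span_base) auto
    finally show ?thesis .
  qed
  then have "span (e ` {..<DIM('a)}) \<subseteq> span (f ` {..<DIM('a)})"
    by (intro span_minimal) auto
  then show ?thesis using span_e by auto
qed

lemma adapted_basis: "tuple_basis DIM('a) f"
  by (rule tuple_basis_DIM[OF adapted_span])

lemma adapted_split:
  "v = (\<Sum>i<p. component DIM('a) f i v *\<^sub>R f i) + (\<Sum>i=p..<DIM('a). component DIM('a) f i v *\<^sub>R f i)"
proof -
  have eq: "{..<DIM('a)} = {..<p} \<union> {p..<DIM('a)}" using p_le d_le by auto
  have "v = (\<Sum>i\<in>{..<p} \<union> {p..<DIM('a)}. component DIM('a) f i v *\<^sub>R f i)"
    using sum_component[OF adapted_basis, of v] by (simp add: eq)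
  then show ?thesis by (subst (asm) sum.union_disjoint) auto
qed

text \<open>The first \<open>p\<close> vectors of \<open>f\<close> lie in \<open>N T\<close> and the
  others in \<open>T\<close>, so the projection along \<open>N T\<close>, in general not orthogonal,
  just drops the first \<open>p\<close> terms of the expansion.\<close>

lemma tan_proj_adapted:
  shows "tan_proj T v = (\<Sum>i=p..<DIM('a). component DIM('a) f i v *\<^sub>R f i)"
    and "tan_proj T v \<in> T" "v - tan_proj T v \<in> N T"
proof -
  let ?t = "\<Sum>i=p..<DIM('a). component DIM('a) f i v *\<^sub>R f i"
  have t: "?t \<in> T"
    using adapted_T by (intro subspace_sum[OF subspace_T] subspace_scale[OF subspace_T]) auto
  have "v - ?t = (\<Sum>i<p. component DIM('a) f i v *\<^sub>R f i)"
    by (subst (1) adapted_split[of v]) simp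
  also have "\<dots> \<in> N T"
    using adapted_N by (intro subspace_sum[OF subspace_N] subspace_scale[OF subspace_N]) auto
  finally have n: "v - ?t \<in> N T" .
  show "tan_proj T v = ?t"
    by (rule tan_proj_eqI[OF subspace_T t n])
  then show "tan_proj T v \<in> T" "v - tan_proj T v \<in> N T" using t n by simp_all
qed

lemma component_T:
  assumes "v \<in> T" "i < p"
  shows "component DIM('a) f i v = 0"
proof -
  have "tan_proj T v = v"
    using assms by (intro tan_proj_eqI[OF subspace_T]) (simp_all add: subspace_0[OF subspace_N])
  then have v: "(\<Sum>i<p. component DIM('a) f i v *\<^sub>R f i) = 0"
    using adapted_split[of v] tan_proj_adapted(1)[of v] by simp
  let ?c = "\<lambda>i. if i < p then component DIM('a) f i v else 0"
  have "(\<Sum>j<DIM('a). ?c j *\<^sub>R f j) = (\<Sum>i<p. component DIM('a) f i v *\<^sub>R f i)"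
    using p_le d_le by (intro sum.mono_neutral_cong_right) auto
  then have "component DIM('a) f i 0 = ?c i"
    using component_sum[OF adapted_basis, of i ?c] assms p_le d_le v by simp
  then show ?thesis using assms by (simp add: linear_0[OF linear_component[OF adapted_basis]])
qed

lemma expansion_T:
  assumes "v \<in> T"
  shows "v = (\<Sum>j<DIM('a) - p. component DIM('a) f (p + j) v *\<^sub>R f (p + j))"
proof -
  have "v = (\<Sum>i=p..<DIM('a). component DIM('a) f i v *\<^sub>R f i)"
    using adapted_split[of v] component_T[OF assms] by simp
  also have "\<dots> = (\<Sum>j<DIM('a) - p. component DIM('a) f (p + j) v *\<^sub>R f (p + j))"
    by (rule sum.reindex_bij_witness[of _ "\<lambda>j. p + j" "\<lambda>i. i - p"]) auto
  finally show ?thesis .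
qed

text \<open>With the first \<open>p\<close> slots frozen, \<open>Vol\<close> is a form of top degree
  on \<open>T\<close>, hence a multiple of the wedge of the tangential coframe.\<close>

lemma Vol_join_T:
  assumes "\<And>i. i < DIM('a) - p \<Longrightarrow> w i \<in> T"
  shows "Vol (join p h w) = Vol (join p h (\<lambda>k. f (p + k))) *
           wedge (DIM('a) - p) (\<lambda>k. component DIM('a) f (p + k)) w"
proof (rule alternating_form_top[where \<alpha> = "\<lambda>w. Vol (join p h w)"])
  show "alternating_form (DIM('a) - p) (\<lambda>w. Vol (join p h w))"
    using p_le d_le by (intro Vol_join_right) auto
qed (use assms expansion_T in auto)

text \<open>The form would be evaluated on one vector more from \<open>T\<close> than
  \<open>T\<close> has dimensions. So the first \<open>p\<close> slots matter only modulo
  \<open>T\<close>.\<close>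

lemma Vol_join_eq_0:
  assumes w: "\<And>i. i < DIM('a) - p \<Longrightarrow> w i \<in> T" and i: "i < p" "h i \<in> T"
  shows "Vol (join p h w) = 0"
proof -
  have lin: "linear (\<lambda>a. Vol (join p (h(i := a)) (\<lambda>k. f (p + k))))"
    using p_le d_le i
    by (intro multilinear_form_linear[OF alternating_form_imp_multilinear[OF Vol_join_left]]) auto
  have z: "Vol (join p (h(i := f (p + j))) (\<lambda>k. f (p + k))) = 0" if "j < DIM('a) - p" for j
    using i that p_le d_le
    by (intro alternating_form_eq_0[OF Vol_alternating, of i "p + j"]) (auto simp: join_def)
  have "Vol (join p h (\<lambda>k. f (p + k))) =
      Vol (join p (h(i := (\<Sum>j<DIM('a) - p. component DIM('a) f (p + j) (h i) *\<^sub>R f (p + j))))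
          (\<lambda>k. f (p + k)))"
    by (simp add: expansion_T[OF i(2), symmetric])
  also have "\<dots> = 0"
    using z by (simp add: linear_sum[OF lin] linear_cmul[OF lin])
  finally show ?thesis using Vol_join_T[OF w] by simp
qed

lemma vol_product_orthonormal:
  assumes q: "q \<le> DIM('a)"
  shows "vol_product q w w' = (\<Sum>I\<in>{..<q} \<rightarrow>\<^sub>E {..<d}. Vol (join q (f \<circ> I) w) * Vol
      (join q (f \<circ> I) w'))"
  unfolding vol_product_def
proof (rule multilinear_sum_orthonormal[symmetric])
  show "multilinear_form q (\<lambda>h. Vol (join q h w))" "multilinear_form q (\<lambda>h. Vol (join q h w'))"
    using q by (auto intro!: alternating_form_imp_multilinear Vol_join_left)
  show "span (e ` {..<d}) = span (f ` {..<d})" using adapted by (simp add: adapted_def H_def)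
qed (use orthonormal d_le adapted in \<open>auto simp: adapted_def\<close>)

text \<open>After the exchange of \<open>e\<close> for \<open>f\<close>, a tuple with an entry
  \<open>f i\<close>, \<open>i \<ge> p\<close>, contributes 0 because this entry is tangent. Only
  \<open>w\<close> has to be tangent; \<open>w'\<close> stays free, so that one of its slots can
  hold a derivative pointing out of \<open>T\<close>.\<close>

lemma vol_product_adapted:
  assumes "\<And>i. i < DIM('a) - p \<Longrightarrow> w i \<in> T"
  shows "vol_product p w w' = fact p * (Vol (join p f w) * Vol (join p f w'))"
proof -
  have "vol_product p w w' =
      (\<Sum>I\<in>{..<p} \<rightarrow>\<^sub>E {..<d}. Vol (join p (f \<circ> I) w) * Vol (join p (f \<circ> I) w'))"
    using p_le d_le by (intro vol_product_orthonormal) auto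
  also have "\<dots> = (\<Sum>I\<in>{..<p} \<rightarrow>\<^sub>E {..<p}. Vol (join p (f \<circ> I) w) * Vol (join p (f \<circ> I) w'))"
  proof (rule sum.mono_neutral_right)
    show "finite ({..<p} \<rightarrow>\<^sub>E {..<d})" by (intro finite_PiE) auto
    show "{..<p} \<rightarrow>\<^sub>E {..<p} \<subseteq> {..<p} \<rightarrow>\<^sub>E {..<d}" using p_le by (intro PiE_mono) auto
    show "\<forall>I\<in>({..<p} \<rightarrow>\<^sub>E {..<d}) - ({..<p} \<rightarrow>\<^sub>E {..<p}). Vol (join p (f \<circ> I) w) * Vol
        (join p (f \<circ> I) w') = 0"
    proof
      fix I :: "nat \<Rightarrow> nat" assume I: "I \<in> ({..<p} \<rightarrow>\<^sub>E {..<d}) - ({..<p} \<rightarrow>\<^sub>E {..<p})"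
      then obtain i where i: "i < p" "\<not> I i < p" "I i < d" by (auto simp: PiE_iff)
      then have "(f \<circ> I) i \<in> T" using adapted_T[of "I i"] d_le by auto
      then show "Vol (join p (f \<circ> I) w) * Vol (join p (f \<circ> I) w') = 0"
        using Vol_join_eq_0[OF assms i(1), where h = "f \<circ> I"] by simp
    qed
  qed
  also have "\<dots> = fact p * (Vol (join p f w) * Vol (join p f w'))"
    using p_le d_le by (intro sum_PiE_alternating_product Vol_join_left) auto
  finally show ?thesis .
qed

text \<open>
  Comparing the two frames \<open>e\<close> and \<open>f\<close> of \<open>H\<close> gives the volume of the frame which coincides with
  \<open>f\<close> on \<open>H\<close> and with \<open>e\<close> elsewhere; passing to \<open>f\<close> from there is a shear.
\<close>

lemma Vol_adapted: "Vol f * Vol f = 1"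
proof -
  let ?e = "\<lambda>k. e (d + k)"
  have "fact d * (Vol (join d f ?e) * Vol (join d f ?e)) = vol_product d ?e ?e"
    unfolding vol_product_orthonormal[OF d_le]
    by (intro sum_PiE_alternating_product[symmetric] Vol_join_left d_le)
  also have "\<dots> = fact d * (Vol (join d e ?e) * Vol (join d e ?e))"
    unfolding vol_product_def
    by (intro sum_PiE_alternating_product Vol_join_left d_le)
  finally have 1: "Vol (join d f ?e) * Vol (join d f ?e) = 1"
    by (simp add: join_shift Vol_e)
  have "Vol (\<lambda>j. if j < m then f j else join d f ?e j) = Vol (join d f ?e)" if "m \<le> DIM('a)" for m
    using that
  proof (induction m)
    case (Suc m)
    let ?g = "\<lambda>j. if j < m then f j else join d f ?e j"
    have IH: "Vol ?g = Vol (join d f ?e)" using Suc by simp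
    have g: "(\<lambda>j. if j < Suc m then f j else join d f ?e j) = ?g(m := f m)"
      by (auto simp: fun_eq_iff)
    show ?case
    proof (cases "m < d")
      case True
      then have "?g(m := f m) = ?g" by (auto simp: fun_eq_iff join_def)
      then show ?thesis using IH by (simp only: g)
    next
      case False
      then obtain a where a: "f m = e m - (\<Sum>\<alpha><p. a \<alpha> *\<^sub>R f \<alpha>)"
        using adapted_shear[of m] Suc.prems by auto
      have lin: "linear (\<lambda>a. Vol (?g(m := a)))"
        using Suc.prems
        by (intro multilinear_form_linear[OF alternating_form_imp_multilinear[OF
            Vol_alternating]]) auto
      have z: "Vol (?g(m := f \<alpha>)) = 0" if "\<alpha> < p" for \<alpha>
        using that False Suc.prems p_le
        by (intro alternating_form_eq_0[OF Vol_alternating, of \<alpha> m]) (auto simp: join_def)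
      have "?g(m := e m) = ?g" using False by (auto simp: fun_eq_iff join_def)
      then have "Vol (?g(m := f m)) = Vol ?g"
        unfolding a using z by (simp add: linear_diff[OF lin] linear_sum[OF lin]
            linear_cmul[OF lin] del: fun_upd_apply)
      then show ?thesis using IH by (simp only: g)
    qed
  qed simp
  from this[of "DIM('a)"] have "Vol f = Vol (join d f ?e)"
    using multilinear_form_cong[OF alternating_form_imp_multilinear[OF Vol_alternating],
        of "\<lambda>j. if j < DIM('a) then f j else join d f ?e j" f] by simp
  then show ?thesis using 1 by simp
qed

text \<open>The difference of the two entries is a combination of the \<open>f \<alpha>\<close> with
  \<open>\<alpha> < p\<close>, which already occupy the first slots.\<close>

lemma Vol_join_tan_proj:
  assumes "\<And>j. j < DIM('a) - p \<Longrightarrow> j \<noteq> i \<Longrightarrow> w j \<in> T" "i < DIM('a) - p"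
  shows "Vol (join p f (w(i := v))) = Vol (join p f (w(i := tan_proj T v)))"
proof -
  have lin: "linear (\<lambda>a. Vol (join p f (w(i := a))))"
    using p_le d_le assms(2)
    by (intro multilinear_form_linear[OF alternating_form_imp_multilinear[OF Vol_join_right]]) auto
  have z: "Vol (join p f (w(i := f \<alpha>))) = 0" if "\<alpha> < p" for \<alpha>
    using that assms(2) p_le d_le
    by (intro alternating_form_eq_0[OF Vol_alternating, of \<alpha> "p + i"]) (auto simp: join_def)
  have "v = tan_proj T v + (\<Sum>i<p. component DIM('a) f i v *\<^sub>R f i)"
    using adapted_split[of v] by (simp add: tan_proj_adapted(1) add.commute)
  then have "Vol (join p f (w(i := v))) =
      Vol (join p f (w(i := tan_proj T v + (\<Sum>\<alpha><p. component DIM('a) f \<alpha> v *\<^sub>R f \<alpha>))))" by simp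
  also have "\<dots> = Vol (join p f (w(i := tan_proj T v)))"
    using z by (simp add: linear_add[OF lin] linear_sum[OF lin] linear_cmul[OF lin])
  finally show ?thesis .
qed

end

end

lemma tan_proj_in:
  assumes t: "transversal p T"
  shows "tan_proj T v \<in> T" "v - tan_proj T v \<in> N T"
proof -
  obtain f where "adapted p T f" using adapted_exists[OF t] by blast
  from tan_proj_adapted(2,3)[OF t this] show "tan_proj T v \<in> T" "v - tan_proj T v \<in> N T" .
qed

lemma tan_proj_ident: "transversal p T \<Longrightarrow> v \<in> T \<Longrightarrow> tan_proj T v = v"
  by (rule tan_proj_eqI[OF subspace_T]) (simp_all add: subspace_0[OF subspace_N])

lemma linear_tan_proj:
  assumes t: "transversal p T"
  shows "linear (tan_proj T)"
proof -
  obtain f where f: "adapted p T f" using adapted_exists[OF t] by blast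
  show ?thesis
    unfolding tan_proj_adapted(1)[OF t f, abs_def] using linear_component[OF adapted_basis[OF t f]]
    by (intro linear_compose_sum ballI linearI) (auto simp: linear_add linear_cmul scaleR_add_left)
qed

end

section \<open>Second derivatives and left-invariant frames in coordinates\<close>

text \<open>The mean value theorem is applied along \<open>a\<close> to the increment of
  \<open>f\<close> by \<open>t *\<^sub>R b\<close>; the differentiability of \<open>f' t a\<close>
  at \<open>s\<close> then compares the two values of the derivative.\<close>

lemma second_difference_estimate:
  fixes f :: "'x::real_normed_vector \<Rightarrow> real"
  assumes O: "open S" "s \<in> S" and f: "\<And>t. t \<in> S \<Longrightarrow> (f has_derivative f' t) (at t)"
    and L: "((\<lambda>t. f' t a) has_derivative L) (at s)" and e: "0 < e"
  shows "\<exists>\<delta>>0. \<forall>t. 0 < t \<and> t < \<delta> \<longrightarrow>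
    \<bar>f (s + t *\<^sub>R a + t *\<^sub>R b) - f (s + t *\<^sub>R a) - f (s + t *\<^sub>R b) + f s - t\<^sup>2 * L b\<bar> \<le> e * t\<^sup>2"
proof -
  define M where "M = norm a + norm b + 1"
  have M: "M > 0" by (simp add: M_def add_nonneg_pos)
  \<comment> \<open>The derivative will be compared at two points within distance
    \<open>t * M\<close> of \<open>s\<close>; with this tolerance each error is at most
    \<open>e * t / 2\<close>.\<close>
  have "0 < e / (2 * M)" using e M by simp
  then obtain d where d: "d > 0"
    "\<And>y. norm (y - s) < d \<Longrightarrow> norm (f' y a - f' s a - L (y - s)) \<le> e / (2 * M) * norm (y - s)"
    using L unfolding has_derivative_at_alt by blast
  obtain r where r: "r > 0" "ball s r \<subseteq> S" using O openE by blast
  define \<delta> where "\<delta> = min d r / M"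
  have \<delta>: "\<delta> > 0" using d r M by (simp add: \<delta>_def)
  have lin: "linear L" using L has_derivative_linear by blast
  have "\<bar>f (s + t *\<^sub>R a + t *\<^sub>R b) - f (s + t *\<^sub>R a) - f (s + t *\<^sub>R b) + f s - t\<^sup>2 * L b\<bar> \<le> e * t\<^sup>2"
    if t: "0 < t" "t < \<delta>" for t
  proof -
    have tM: "t * M < min d r" using t M by (simp add: \<delta>_def field_simps)
    have n1: "norm (\<tau> *\<^sub>R a + t *\<^sub>R b) \<le> t * M" "norm (\<tau> *\<^sub>R a) \<le> t * M" if "0 \<le> \<tau>" "\<tau> \<le> t" for \<tau>
    proof -
      have \<tau>a: "norm (\<tau> *\<^sub>R a) \<le> t * norm a" using that by (simp add: mult_right_mono)
      have "norm (t *\<^sub>R b) \<le> t * norm b" using t by simp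
      then show "norm (\<tau> *\<^sub>R a + t *\<^sub>R b) \<le> t * M"
        using \<tau>a norm_triangle_ineq[of "\<tau> *\<^sub>R a" "t *\<^sub>R b"] t unfolding M_def
            by (simp add: algebra_simps)
      have "t * norm a \<le> t * M" using t unfolding M_def by (intro mult_left_mono) auto
      with \<tau>a show "norm (\<tau> *\<^sub>R a) \<le> t * M" by linarith
    qed
    have inS: "s + (\<tau> *\<^sub>R a + t *\<^sub>R b) \<in> S" "s + \<tau> *\<^sub>R a \<in> S" if "0 \<le> \<tau>" "\<tau> \<le> t" for \<tau>
    proof -
      have "dist (s + (\<tau> *\<^sub>R a + t *\<^sub>R b)) s < r" "dist (s + \<tau> *\<^sub>R a) s < r"
        using n1[OF that] tM by (simp_all add: dist_norm)
      then show "s + (\<tau> *\<^sub>R a + t *\<^sub>R b) \<in> S" "s + \<tau> *\<^sub>R a \<in> S"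
        using r(2) by (auto simp: subset_iff dist_commute)
    qed
    define g where "g \<tau> = f (s + (\<tau> *\<^sub>R a + t *\<^sub>R b)) - f (s + \<tau> *\<^sub>R a)" for \<tau>
    define g' where "g' \<tau> = f' (s + (\<tau> *\<^sub>R a + t *\<^sub>R b)) a - f' (s + \<tau> *\<^sub>R a) a" for \<tau>
    have "DERIV g \<tau> :> g' \<tau>" if \<tau>: "0 \<le> \<tau>" "\<tau> \<le> t" for \<tau>
    proof -
      note i = inS[OF \<tau>]
      have l: "linear (f' (s + (\<tau> *\<^sub>R a + t *\<^sub>R b)))" "linear (f' (s + \<tau> *\<^sub>R a))"
        using f i has_derivative_linear by blast+
      have "((\<lambda>\<tau>. f (s + (\<tau> *\<^sub>R a + t *\<^sub>R b))) has_derivative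
          (\<lambda>h. f' (s + (\<tau> *\<^sub>R a + t *\<^sub>R b)) (h *\<^sub>R a))) (at \<tau>)"
        by (rule has_derivative_compose[of "\<lambda>\<tau>. s + (\<tau> *\<^sub>R a + t *\<^sub>R b)" "\<lambda>h. h *\<^sub>R a" \<tau> UNIV f])
          (auto intro!: derivative_eq_intros f i)
      moreover have "((\<lambda>\<tau>. f (s + \<tau> *\<^sub>R a)) has_derivative (\<lambda>h. f' (s + \<tau> *\<^sub>R a) (h *\<^sub>R a))) (at \<tau>)"
        by (rule has_derivative_compose[of "\<lambda>\<tau>. s + \<tau> *\<^sub>R a" "\<lambda>h. h *\<^sub>R a" \<tau> UNIV f])
          (auto intro!: derivative_eq_intros f i)
      ultimately have "(g has_derivative (\<lambda>h. f' (s + (\<tau> *\<^sub>R a + t *\<^sub>R b)) (h *\<^sub>R a) - f'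
          (s + \<tau> *\<^sub>R a) (h *\<^sub>R a))) (at \<tau>)"
        unfolding g_def by (rule has_derivative_diff)
      then show ?thesis
        unfolding has_field_derivative_def g'_def
        by (rule has_derivative_eq_rhs) (auto simp: linear_cmul[OF l(1)] linear_cmul[OF l(2)]
            algebra_simps)
    qed
    from MVT2[OF t(1) this] obtain \<tau> where \<tau>: "0 < \<tau>" "\<tau> < t" "g t - g 0 = (t - 0) * g' \<tau>" by blast
    have eq: "f (s + t *\<^sub>R a + t *\<^sub>R b) - f (s + t *\<^sub>R a) - f (s + t *\<^sub>R b) + f s = t * g' \<tau>"
      using \<tau>(3) by (simp add: g_def add.assoc)
    have n2: "norm (\<tau> *\<^sub>R a + t *\<^sub>R b) \<le> t * M" "norm (\<tau> *\<^sub>R a) \<le> t * M" using n1 \<tau> by auto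
    have "\<bar>f' (s + (\<tau> *\<^sub>R a + t *\<^sub>R b)) a - f' s a - L (\<tau> *\<^sub>R a + t *\<^sub>R b)\<bar> \<le> e / (2 * M) * norm
        (\<tau> *\<^sub>R a + t *\<^sub>R b)"
      using d(2)[of "s + (\<tau> *\<^sub>R a + t *\<^sub>R b)"] n2(1) tM by simp
    also have "\<dots> \<le> e / (2 * M) * (t * M)" using n2 e M by (intro mult_left_mono) auto
    finally have 1: "\<bar>f' (s + (\<tau> *\<^sub>R a + t *\<^sub>R b)) a - f' s a - L (\<tau> *\<^sub>R a + t *\<^sub>R b)\<bar> \<le> e * t / 2"
        using M by simp
    have "\<bar>f' (s + \<tau> *\<^sub>R a) a - f' s a - L (\<tau> *\<^sub>R a)\<bar> \<le> e / (2 * M) * norm (\<tau> *\<^sub>R a)"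
      using d(2)[of "s + \<tau> *\<^sub>R a"] n2(2) tM by simp
    also have "\<dots> \<le> e / (2 * M) * (t * M)" using n2 e M by (intro mult_left_mono) auto
    finally have 2: "\<bar>f' (s + \<tau> *\<^sub>R a) a - f' s a - L (\<tau> *\<^sub>R a)\<bar> \<le> e * t / 2" using M by simp
    have "L (\<tau> *\<^sub>R a + t *\<^sub>R b) = L (\<tau> *\<^sub>R a) + t * L b"
      by (simp add: linear_add[OF lin] linear_cmul[OF lin])
    then have "\<bar>g' \<tau> - t * L b\<bar> \<le> e * t" using 1 2 unfolding g'_def by linarith
    then have "t * \<bar>g' \<tau> - t * L b\<bar> \<le> t * (e * t)" using t by (intro mult_left_mono) auto
    moreover have "\<bar>t * g' \<tau> - t\<^sup>2 * L b\<bar> = t * \<bar>g' \<tau> - t * L b\<bar>"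
    proof -
      have "t * g' \<tau> - t\<^sup>2 * L b = t * (g' \<tau> - t * L b)"
          by (simp add: power2_eq_square algebra_simps)
      then show ?thesis using t by (simp add: abs_mult)
    qed
    ultimately show ?thesis unfolding eq by (simp add: power2_eq_square mult.left_commute)
  qed
  then show ?thesis using \<delta> by blast
qed

text \<open>The second difference is symmetric in \<open>a\<close> and \<open>b\<close>, and divided
  by the square of \<open>t\<close> it tends to \<open>La b\<close> as well as to
  \<open>Lb a\<close>.\<close>

lemma symmetric_second_derivative_real:
  fixes f :: "'x::real_normed_vector \<Rightarrow> real"
  assumes O: "open S" "s \<in> S" and f: "\<And>t. t \<in> S \<Longrightarrow> (f has_derivative f' t) (at t)"
    and La: "((\<lambda>t. f' t a) has_derivative La) (at s)" and Lb:
        "((\<lambda>t. f' t b) has_derivative Lb) (at s)"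
  shows "La b = Lb a"
proof -
  have "\<bar>La b - Lb a\<bar> \<le> 0 + e" if "e > 0" for e
  proof -
    have e2: "e / 2 > 0" using that by simp
    obtain \<delta> where \<delta>: "\<delta> > 0" "\<And>t. 0 < t \<Longrightarrow> t < \<delta> \<Longrightarrow>
      \<bar>f (s + t *\<^sub>R a + t *\<^sub>R b) - f (s + t *\<^sub>R a) - f (s + t *\<^sub>R b) + f s - t\<^sup>2 * La b\<bar> \<le> e / 2 * t\<^sup>2"
      using second_difference_estimate[OF O f La e2, of b] by blast
    obtain \<delta>' where \<delta>': "\<delta>' > 0" "\<And>t. 0 < t \<Longrightarrow> t < \<delta>' \<Longrightarrow>
      \<bar>f (s + t *\<^sub>R b + t *\<^sub>R a) - f (s + t *\<^sub>R b) - f (s + t *\<^sub>R a) + f s - t\<^sup>2 * Lb a\<bar> \<le> e / 2 * t\<^sup>2"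
      using second_difference_estimate[OF O f Lb e2, of a] by blast
    define t where "t = min \<delta> \<delta>' / 2"
    have t: "0 < t" "t < \<delta>" "t < \<delta>'" using \<delta> \<delta>' by (auto simp: t_def)
    have "s + t *\<^sub>R b + t *\<^sub>R a = s + t *\<^sub>R a + t *\<^sub>R b" by (simp add: algebra_simps)
    then have "\<bar>t\<^sup>2 * La b - t\<^sup>2 * Lb a\<bar> \<le> e / 2 * t\<^sup>2 + e / 2 * t\<^sup>2"
      using \<delta>(2)[OF t(1,2)] \<delta>'(2)[OF t(1,3)] by (simp only:)
    moreover have "\<bar>t\<^sup>2 * La b - t\<^sup>2 * Lb a\<bar> = t\<^sup>2 * \<bar>La b - Lb a\<bar>"
      by (simp add: right_diff_distrib[symmetric] abs_mult)
    ultimately have "t\<^sup>2 * \<bar>La b - Lb a\<bar> \<le> t\<^sup>2 * e" by (simp add: algebra_simps)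
    then show ?thesis using t by (simp add: mult_le_cancel_left)
  qed
  then have "\<bar>La b - Lb a\<bar> \<le> 0" by (rule field_le_epsilon)
  then show ?thesis by simp
qed

lemma symmetric_second_derivative:
  fixes f :: "'x::real_normed_vector \<Rightarrow> 'a::euclidean_space"
  assumes O: "open S" "s \<in> S" and f: "\<And>t. t \<in> S \<Longrightarrow> (f has_derivative f' t) (at t)"
    and La: "((\<lambda>t. f' t a) has_derivative La) (at s)" and Lb:
        "((\<lambda>t. f' t b) has_derivative Lb) (at s)"
  shows "La b = Lb a"
proof (rule euclidean_eqI)
  fix i :: 'a assume "i \<in> Basis"
  show "La b \<bullet> i = Lb a \<bullet> i"
    by (rule symmetric_second_derivative_real[OF O, of "\<lambda>t. f t \<bullet> i" "\<lambda>t h. f' t h \<bullet> i" a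
        "\<lambda>h. La h \<bullet> i" b "\<lambda>h. Lb h \<bullet> i"])
      (auto intro: has_derivative_inner_left f La Lb)
qed

text \<open>Differentiability of \<open>\<kappa>\<close> is given for each fixed vector separately;
  expanding the second argument in \<open>Basis\<close> reduces the joint dependence to the product
  rule.\<close>

lemma has_derivative_linear_field:
  fixes \<kappa> :: "'a::euclidean_space \<Rightarrow> 'a \<Rightarrow> 'c::real_normed_vector"
  assumes Z: "open Z" "g s \<in> Z" and lin: "\<And>z. z \<in> Z \<Longrightarrow> linear (\<kappa> z)"
    and \<kappa>: "\<And>v. (\<lambda>z. \<kappa> z v) differentiable (at (g s))"
    and g: "(g has_derivative g') (at s)" and w: "(w has_derivative w') (at s)"
  shows "((\<lambda>t. \<kappa> (g t) (w t)) has_derivative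
      (\<lambda>h. frechet_derivative (\<lambda>z. \<kappa> z (w s)) (at (g s)) (g' h) + \<kappa> (g s) (w' h))) (at s)"
proof -
  let ?D = "\<lambda>v. frechet_derivative (\<lambda>z. \<kappa> z v) (at (g s))"
  have D: "((\<lambda>z. \<kappa> z v) has_derivative ?D v) (at (g s))" for v
    using \<kappa> frechet_derivative_works by blast
  have exp: "\<kappa> z v = (\<Sum>i\<in>Basis. (v \<bullet> i) *\<^sub>R \<kappa> z i)" if "z \<in> Z" for z v
    by (subst (1) euclidean_representation[of v, symmetric])
      (simp add: linear_sum[OF lin[OF that]] linear_cmul[OF lin[OF that]])
  have "((\<lambda>z. \<Sum>i\<in>Basis. (w s \<bullet> i) *\<^sub>R \<kappa> z i) has_derivative (\<lambda>h. \<Sum>i\<in>Basis. (w s \<bullet> i) *\<^sub>R ?D i h))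
      (at (g s))"
    by (intro has_derivative_sum has_derivative_scaleR_right D)
  then have "((\<lambda>z. \<kappa> z (w s)) has_derivative (\<lambda>h. \<Sum>i\<in>Basis. (w s \<bullet> i) *\<^sub>R ?D i h)) (at (g s))"
    by (rule has_derivative_transform_within_open[OF _ Z]) (simp add: exp[of _ "w s"])
  then have Dw: "?D (w s) = (\<lambda>h. \<Sum>i\<in>Basis. (w s \<bullet> i) *\<^sub>R ?D i h)"
    using D has_derivative_unique by blast
  have "((\<lambda>t. \<Sum>i\<in>Basis. (w t \<bullet> i) *\<^sub>R \<kappa> (g t) i) has_derivative
     (\<lambda>h. \<Sum>i\<in>Basis. (w s \<bullet> i) *\<^sub>R ?D i (g' h) + (w' h \<bullet> i) *\<^sub>R \<kappa> (g s) i)) (at s)"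
    by (intro has_derivative_sum has_derivative_scaleR has_derivative_inner_left w
        has_derivative_compose[OF g D])
  also have "(\<lambda>h. \<Sum>i\<in>Basis. (w s \<bullet> i) *\<^sub>R ?D i (g' h) + (w' h \<bullet> i) *\<^sub>R \<kappa> (g s) i) =
      (\<lambda>h. ?D (w s) (g' h) + \<kappa> (g s) (w' h))"
    by (simp add: Dw sum.distrib exp[OF Z(2), of "w' _"])
  finally have *: "((\<lambda>t. \<Sum>i\<in>Basis. (w t \<bullet> i) *\<^sub>R \<kappa> (g t) i) has_derivative
     (\<lambda>h. ?D (w s) (g' h) + \<kappa> (g s) (w' h))) (at s)" .
  have "isCont g s" using g by (rule has_derivative_continuous)
  then have "\<exists>U. open U \<and> s \<in> U \<and> (\<forall>t\<in>U. g t \<in> Z)"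
    using Z by (simp add: continuous_at_open)
  then obtain U where U: "open U" "s \<in> U" "\<forall>t\<in>U. g t \<in> Z" by blast
  show ?thesis
    by (rule has_derivative_transform_within_open[OF * U(1,2)])
        (use U(3) in \<open>simp add: exp[of _ "w _"]\<close>)
qed

text \<open>
  Here \<open>\<kappa>\<close> is the Maurer-Cartan form and \<open>E\<close> the dual frame, both in a chart of the group, and
  the left-hand side is \<open>d(f\<^sup>*\<kappa>)(a, b)\<close>.
\<close>

lemma structure_equation:
  fixes \<kappa> :: "'a::euclidean_space \<Rightarrow> 'a \<Rightarrow> 'a" and f :: "'x::real_normed_vector \<Rightarrow> 'a"
  assumes O: "open S" "s \<in> S" and f: "\<And>t. t \<in> S \<Longrightarrow> (f has_derivative f' t) (at t)"
    and f2: "\<And>c. (\<lambda>t. f' t c) differentiable (at s)"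
    and Z: "open Z" "f s \<in> Z" and lin: "\<And>z. z \<in> Z \<Longrightarrow> linear (\<kappa> z)"
    and inj: "inj (\<kappa> (f s))"
    and \<kappa>: "\<And>v. (\<lambda>z. \<kappa> z v) differentiable (at (f s))"
    and E: "\<And>j. j < DIM('a) \<Longrightarrow> E j differentiable (at (f s))"
    and dual: "\<And>z j. z \<in> Z \<Longrightarrow> j < DIM('a) \<Longrightarrow> \<kappa> z (E j z) = e j"
    and e: "\<And>v::'a. v = (\<Sum>j<DIM('a). (v \<bullet> e j) *\<^sub>R e j)"
  defines "br \<equiv> \<lambda>i j. frechet_derivative (E j) (at (f s)) (E i (f s)) - frechet_derivative (E i)
      (at (f s)) (E j (f s))"
    and "\<theta> \<equiv> \<lambda>t c. \<kappa> (f t) (f' t c)"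
  shows "(\<lambda>t. \<theta> t c) differentiable (at s)"
    and "frechet_derivative (\<lambda>t. \<theta> t b) (at s) a - frechet_derivative (\<lambda>t. \<theta> t a) (at s) b =
      - (\<Sum>i<DIM('a). \<Sum>j<DIM('a). ((\<theta> s a \<bullet> e i) * (\<theta> s b \<bullet> e j)) *\<^sub>R \<kappa> (f s) (br i j))"
proof -
  define z where "z = f s"
  define K where "K u v = frechet_derivative (\<lambda>z. \<kappa> z v) (at (f s)) u" for u v
  define F2 where "F2 c = frechet_derivative (\<lambda>t. f' t c) (at s)" for c
  have F2: "((\<lambda>t. f' t c) has_derivative F2 c) (at s)" for c
    using f2 frechet_derivative_works unfolding F2_def by blast
  have \<theta>: "((\<lambda>t. \<theta> t c) has_derivative (\<lambda>h. K (f' s h) (f' s c) + \<kappa> z (F2 c h))) (at s)" for c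
    unfolding \<theta>_def K_def z_def
    by (rule has_derivative_linear_field[OF Z lin \<kappa> f[OF O(2)] F2])
  then show "(\<lambda>t. \<theta> t c) differentiable (at s)" using differentiableI by blast
  \<comment> \<open>The second derivatives of \<open>f\<close> will cancel in the antisymmetrised
    expression and leave the derivative of \<open>\<kappa>\<close> alone.\<close>
  have sym: "F2 a b = F2 b a"
    by (rule symmetric_second_derivative[OF O f F2 F2])
  have \<kappa>lin: "linear (\<kappa> z)" using lin Z by (simp add: z_def)
  have K1: "linear (\<lambda>u. K u v)" for v
    unfolding K_def using \<kappa> has_derivative_linear frechet_derivative_works by blast
  have Kd: "((\<lambda>z. \<kappa> z v) has_derivative (\<lambda>u. K u v)) (at z)" for v
    unfolding K_def z_def using \<kappa> frechet_derivative_works by blast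
  have K2: "linear (K u)" for u
  proof (rule linearI)
    fix v w c
    have "((\<lambda>z. \<kappa> z v + \<kappa> z w) has_derivative (\<lambda>u. K u v + K u w)) (at z)"
      by (intro has_derivative_add Kd)
    then have "((\<lambda>z. \<kappa> z (v + w)) has_derivative (\<lambda>u. K u v + K u w)) (at z)"
      by (rule has_derivative_transform_within_open[OF _ Z[folded z_def]])
          (simp add: linear_add[OF lin])
    then show "K u (v + w) = K u v + K u w" using has_derivative_unique[OF Kd] by metis
    have "((\<lambda>z. c *\<^sub>R \<kappa> z v) has_derivative (\<lambda>u. c *\<^sub>R K u v)) (at z)"
      by (intro has_derivative_scaleR_right Kd)
    then have "((\<lambda>z. \<kappa> z (c *\<^sub>R v)) has_derivative (\<lambda>u. c *\<^sub>R K u v)) (at z)"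
      by (rule has_derivative_transform_within_open[OF _ Z[folded z_def]])
          (simp add: linear_cmul[OF lin])
    then show "K u (c *\<^sub>R v) = c *\<^sub>R K u v" using has_derivative_unique[OF Kd] by metis
  qed
  \<comment> \<open>Differentiating the constant \<open>\<kappa> z (E j z) = e j\<close> trades the
    derivative of the form for that of the frame, from which the brackets arise.\<close>
  have KE: "K u (E j z) = - \<kappa> z (frechet_derivative (E j) (at z) u)" if j: "j < DIM('a)" for u j
  proof -
    have Ej: "(E j has_derivative frechet_derivative (E j) (at z)) (at z)"
      using E[OF j] frechet_derivative_works unfolding z_def by blast
    have "((\<lambda>z. \<kappa> (id z) (E j z)) has_derivative
       (\<lambda>h. K (id h) (E j z) + \<kappa> z (frechet_derivative (E j) (at z) h))) (at z)"
      using has_derivative_linear_field[of Z id z \<kappa> id "E j" "frechet_derivative (E j) (at z)"] Z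
          lin \<kappa> Ej has_derivative_id
      unfolding K_def z_def by simp
    moreover have "((\<lambda>z. \<kappa> (id z) (E j z)) has_derivative (\<lambda>_. 0)) (at z)"
      by (rule has_derivative_transform_within_open[OF has_derivative_const[of "e j"]
          Z[folded z_def]])
        (simp add: dual[OF _ j])
    ultimately have "(\<lambda>h. K (id h) (E j z) + \<kappa> z (frechet_derivative (E j) (at z) h)) = (\<lambda>_. 0)"
      by (rule has_derivative_unique)
    then have "K (id u) (E j z) + \<kappa> z (frechet_derivative (E j) (at z) u) = 0" by (rule fun_cong)
    then show ?thesis by (simp add: eq_neg_iff_add_eq_0)
  qed
  have exp: "u = (\<Sum>j<DIM('a). (\<kappa> z u \<bullet> e j) *\<^sub>R E j z)" for u
  proof (rule injD[OF inj[folded z_def]])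
    have "\<kappa> z (\<Sum>j<DIM('a). (\<kappa> z u \<bullet> e j) *\<^sub>R E j z) = (\<Sum>j<DIM('a). (\<kappa> z u \<bullet> e j) *\<^sub>R e j)"
      by (simp add: linear_sum[OF \<kappa>lin] linear_cmul[OF \<kappa>lin] dual[OF Z(2)[folded z_def]])
    then show "\<kappa> z u = \<kappa> z (\<Sum>j<DIM('a). (\<kappa> z u \<bullet> e j) *\<^sub>R E j z)" using e[of "\<kappa> z u"] by simp
  qed
  have Kexp: "K u v = (\<Sum>i<DIM('a). \<Sum>j<DIM('a). ((\<kappa> z u \<bullet> e i) * (\<kappa> z v \<bullet> e j)) *\<^sub>R K (E i z)
      (E j z))" for u v
  proof -
    have "K u v = K (\<Sum>i<DIM('a). (\<kappa> z u \<bullet> e i) *\<^sub>R E i z) (\<Sum>j<DIM('a). (\<kappa> z v \<bullet> e j) *\<^sub>R E j z)"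
      by (simp only: exp[symmetric])
    also have "\<dots> = (\<Sum>i<DIM('a). (\<kappa> z u \<bullet> e i) *\<^sub>R (\<Sum>j<DIM('a). (\<kappa> z v \<bullet> e j) *\<^sub>R K (E i z) (E j z)))"
      by (simp only: linear_sum[OF K1] linear_cmul[OF K1])
          (simp only: linear_sum[OF K2] linear_cmul[OF K2])
    finally show ?thesis by (simp add: scaleR_sum_right)
  qed
  have "K u v - K v u = - (\<Sum>i<DIM('a). \<Sum>j<DIM('a). ((\<kappa> z u \<bullet> e i) * (\<kappa> z v \<bullet> e j)) *\<^sub>R \<kappa> z
      (br i j))" for u v
  proof -
    have "K v u = (\<Sum>i<DIM('a). \<Sum>j<DIM('a). ((\<kappa> z u \<bullet> e i) * (\<kappa> z v \<bullet> e j)) *\<^sub>R K (E j z) (E i z))"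
      by (subst Kexp, subst sum.swap) (simp add: mult.commute)
    then have "K u v - K v u = (\<Sum>i<DIM('a). \<Sum>j<DIM('a). ((\<kappa> z u \<bullet> e i) * (\<kappa> z v \<bullet> e j)) *\<^sub>R
        (K (E i z) (E j z) - K (E j z) (E i z)))"
      by (simp add: Kexp[of u v] sum_subtractf scaleR_diff_right)
    also have "\<dots> = (\<Sum>i<DIM('a). \<Sum>j<DIM('a). - (((\<kappa> z u \<bullet> e i) * (\<kappa> z v \<bullet> e j)) *\<^sub>R \<kappa> z (br i j)))"
    proof (intro sum.cong refl)
      fix i j assume "i \<in> {..<DIM('a)}" "j \<in> {..<DIM('a)}"
      then have "K (E i z) (E j z) - K (E j z) (E i z) = - \<kappa> z (br i j)"
        by (simp add: KE br_def linear_diff[OF \<kappa>lin] z_def[symmetric])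
      then show "((\<kappa> z u \<bullet> e i) * (\<kappa> z v \<bullet> e j)) *\<^sub>R (K (E i z) (E j z) - K (E j z) (E i z)) =
         - (((\<kappa> z u \<bullet> e i) * (\<kappa> z v \<bullet> e j)) *\<^sub>R \<kappa> z (br i j))" by simp
    qed
    finally show ?thesis by (simp add: sum_negf)
  qed
  moreover have "frechet_derivative (\<lambda>t. \<theta> t c) (at s) =
      (\<lambda>h. K (f' s h) (f' s c) + \<kappa> z (F2 c h))" for c
    by (rule frechet_derivative_at[OF \<theta>, symmetric])
  ultimately show "frechet_derivative (\<lambda>t. \<theta> t b) (at s) a - frechet_derivative (\<lambda>t. \<theta> t a)
      (at s) b =
      - (\<Sum>i<DIM('a). \<Sum>j<DIM('a). ((\<theta> s a \<bullet> e i) * (\<theta> s b \<bullet> e j)) *\<^sub>R \<kappa> (f s) (br i j))"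
    using sym by (simp only:) (simp add: \<theta>_def z_def)
qed

section \<open>Variation of the volume density\<close>

context frame_space
begin

lemma vol_product_commute: "vol_product p w w' = vol_product p w' w"
  by (simp add: vol_product_def mult.commute)

lemma has_derivative_vol_product:
  assumes p: "p \<le> DIM('a)"
    and w: "\<And>i. i < DIM('a) - p \<Longrightarrow> ((\<lambda>s. w s i) has_derivative D i) (at s)"
    and w': "\<And>i. i < DIM('a) - p \<Longrightarrow> ((\<lambda>s. w' s i) has_derivative D' i) (at s)"
  shows "((\<lambda>s. vol_product p (w s) (w' s)) has_derivative
     (\<lambda>h. (\<Sum>i<DIM('a) - p. vol_product p (w s) ((w' s)(i := D' i h))) +
          (\<Sum>i<DIM('a) - p. vol_product p ((w s)(i := D i h)) (w' s)))) (at s)"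
proof -
  let ?X = "{..<p} \<rightarrow>\<^sub>E {..<d}"
  have d: "((\<lambda>s. Vol (join p h (u s))) has_derivative
      (\<lambda>t. \<Sum>i<DIM('a) - p. Vol (join p h ((u s)(i := D i t))))) (at s)"
    if "\<And>i. i < DIM('a) - p \<Longrightarrow> ((\<lambda>s. u s i) has_derivative D i) (at s)" for h u D
    using has_derivative_multilinear_form[OF alternating_form_imp_multilinear[OF
        Vol_join_right[OF p]], of u D s UNIV h] that
    by simp
  have "((\<lambda>s. \<Sum>I\<in>?X. Vol (join p (e \<circ> I) (w s)) * Vol (join p (e \<circ> I) (w' s))) has_derivative
      (\<lambda>h. \<Sum>I\<in>?X. Vol (join p (e \<circ> I) (w s)) * (\<Sum>i<DIM('a) - p. Vol
          (join p (e \<circ> I) ((w' s)(i := D' i h)))) +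
        (\<Sum>i<DIM('a) - p. Vol (join p (e \<circ> I) ((w s)(i := D i h)))) * Vol
            (join p (e \<circ> I) (w' s)))) (at s)"
    by (intro has_derivative_sum has_derivative_mult d w w')
  then show ?thesis
    unfolding vol_product_def sum.distrib sum_distrib_left sum_distrib_right sum.swap[of _ _ ?X] .
qed

text \<open>For \<open>i \<ge> d\<close> the vectors \<open>e i\<close> and \<open>f i\<close>
  differ by normal vectors only, so a vertical vector has no component along
  \<open>T \<inter> H\<close>.\<close>

lemma component_vertical:
  assumes T: "transversal p T" and f: "adapted p T f"
    and v: "\<And>i. i < d \<Longrightarrow> v \<bullet> e i = 0" and j: "p \<le> j" "j < d"
  shows "component DIM('a) f j v = 0"
proof -
  note tb = adapted_basis[OF T f]
  note lin = linear_component[OF tb, of j]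
  have comp: "component DIM('a) f j (e i) = 0" if i: "d \<le> i" "i < DIM('a)" for i
  proof -
    obtain a where a: "f i = e i - (\<Sum>\<alpha><p. a \<alpha> *\<^sub>R f \<alpha>)"
      using adapted_shear[OF T f i] by blast
    then have "e i = f i + (\<Sum>\<alpha><p. a \<alpha> *\<^sub>R f \<alpha>)" by simp
    then show ?thesis
      using i j d_le p_le[OF T]
      by (simp add: linear_add[OF lin] linear_sum[OF lin] linear_cmul[OF lin]
          component_basis[OF tb])
  qed
  have "v = (\<Sum>l<DIM('a). (v \<bullet> e l) *\<^sub>R e l)"
    by (rule orthonormal_expansion[OF orthonormal]) (auto simp: span_e)
  then have "component DIM('a) f j v = component DIM('a) f j (\<Sum>l<DIM('a). (v \<bullet> e l) *\<^sub>R e l)"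
    by (rule arg_cong)
  also have "\<dots> = (\<Sum>l<DIM('a). (v \<bullet> e l) * component DIM('a) f j (e l))"
    by (simp add: linear_sum[OF lin] linear_cmul[OF lin])
  also have "\<dots> = 0"
  proof (intro sum.neutral ballI)
    fix l assume "l \<in> {..<DIM('a)}"
    then show "(v \<bullet> e l) * component DIM('a) f j (e l) = 0"
      using v comp by (cases "l < d") auto
  qed
  finally show ?thesis .
qed

end

text \<open>
  A point \<open>s = (u, y)\<close> consists of the time of the variation and a point in a chart of the source.
  The form \<open>\<theta>\<close> is the pull-back of the Maurer-Cartan form: \<open>\<theta> s (0, w)\<close> is the differential of
  the immersion at time \<open>u\<close>, \<open>\<theta> s (1, 0)\<close> the variation field, and \<open>structure_eq\<close> is the
  Maurer-Cartan equation, \<open>C\<close> being the bracket in the coordinates given by the frame.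
\<close>

locale transversal_family = frame_space e d for e :: "nat \<Rightarrow> 'a::euclidean_space" and d +
  fixes p :: nat and S :: "(real \<times> 'b::real_normed_vector) set" and y0 :: 'b
    and \<theta> :: "real \<times> 'b \<Rightarrow> real \<times> 'b \<Rightarrow> 'a" and C :: "'a \<Rightarrow> 'a \<Rightarrow> 'a" and b :: "nat \<Rightarrow> 'b"
  assumes S: "open S" "(0, y0) \<in> S"
    and basis: "tuple_basis (DIM('a) - p) b"
    and linear_\<theta>: "\<And>s. s \<in> S \<Longrightarrow> linear (\<theta> s)"
    and transversal_range: "\<And>s. s \<in> S \<Longrightarrow> transversal p (range (\<lambda>w. \<theta> s (0, w)))"
    and inj_\<theta>: "\<And>s. s \<in> S \<Longrightarrow> inj (\<lambda>w. \<theta> s (0, w))"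
    and differentiable_\<theta>: "\<And>V. (\<lambda>s. \<theta> s V) differentiable (at (0, y0))"
    and structure_eq: "\<And>V V'. frechet_derivative (\<lambda>s. \<theta> s V') (at (0, y0)) V -
      frechet_derivative (\<lambda>s. \<theta> s V) (at (0, y0)) V' = - C (\<theta> (0, y0) V) (\<theta> (0, y0) V')"
    and linear_C: "\<And>v. linear (C v)"
begin

definition B :: "real \<times> 'b \<Rightarrow> 'b \<Rightarrow> 'a" where "B s w = \<theta> s (0, w)"

definition T :: "real \<times> 'b \<Rightarrow> 'a set" where "T s = range (B s)"

definition P :: "real \<times> 'b \<Rightarrow> 'a" where "P s = \<theta> s (1, 0)"

text \<open>The left inverse of \<open>B s\<close> that kills the normal space; \<open>inv\<close>
  is applied only to vectors in the range of \<open>B s\<close>.\<close>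

definition pull :: "real \<times> 'b \<Rightarrow> 'a \<Rightarrow> 'b" where "pull s v = inv (B s) (tan_proj (T s) v)"

definition Z :: "real \<times> 'b \<Rightarrow> 'b" where "Z s = pull s (P s)"

definition P_perp :: "real \<times> 'b \<Rightarrow> 'a" where "P_perp s = P s - tan_proj (T s) (P s)"

text \<open>A polynomial in the values of \<open>\<theta>\<close>, hence differentiable without a
  choice of frames. Its normalised root \<open>density\<close> is the ratio, up to sign, of the
  volume of the image to the constant form \<open>\<delta>\<close>.\<close>

definition Q :: "real \<times> 'b \<Rightarrow> real" where
  "Q s = vol_product p (\<lambda>i. B s (b i)) (\<lambda>i. B s (b i))"

definition density :: "real \<times> 'b \<Rightarrow> real" where
  "density s = sqrt (Q s / fact p)"

definition \<delta> :: "(nat \<Rightarrow> 'b) \<Rightarrow> real" where "\<delta> = wedge (DIM('a) - p) (component (DIM('a) - p) b)"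

lemma \<delta>: "alternating_form (DIM('a) - p) \<delta>"
  unfolding \<delta>_def by (rule alternating_form_component[OF basis])

lemma linear_B: "s \<in> S \<Longrightarrow> linear (B s)"
proof -
  assume "s \<in> S"
  moreover have "linear (\<lambda>w::'b. (0::real, w))" by (rule linearI) auto
  ultimately show ?thesis
    using linear_compose[of "\<lambda>w. (0, w)" "\<theta> s"] linear_\<theta> by (simp add: B_def[abs_def] o_def)
qed

lemma inj_B: "s \<in> S \<Longrightarrow> inj (B s)"
  using inj_\<theta> by (simp add: B_def[abs_def])

lemma transversal_T: "s \<in> S \<Longrightarrow> transversal p (T s)"
  using transversal_range by (simp add: T_def B_def[abs_def])

lemma p_le_DIM: "p \<le> DIM('a)"
  using p_le[OF transversal_T[OF S(2)]] d_le by simp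

lemma B_in_T: "B s w \<in> T s" by (simp add: T_def)

lemma B_pull: "s \<in> S \<Longrightarrow> B s (pull s v) = tan_proj (T s) v"
  using tan_proj_in(1)[OF transversal_T, of s v] unfolding pull_def
      by (auto simp: T_def f_inv_into_f)

lemma pull_B: "s \<in> S \<Longrightarrow> pull s (B s w) = w"
  by (simp add: pull_def tan_proj_ident[OF transversal_T B_in_T] inj_B)

lemma linear_pull:
  assumes s: "s \<in> S"
  shows "linear (pull s)"
proof (rule linearI)
  fix v w c
  note lin = linear_B[OF s] linear_tan_proj[OF transversal_T[OF s]]
  show "pull s (v + w) = pull s v + pull s w"
    by (rule injD[OF inj_B[OF s]])
      (simp only: B_pull[OF s] linear_add[OF lin(1)] linear_add[OF lin(2)])
  show "pull s (c *\<^sub>R v) = c *\<^sub>R pull s v"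
    by (rule injD[OF inj_B[OF s]])
      (simp only: B_pull[OF s] linear_cmul[OF lin(1)] linear_cmul[OF lin(2)])
qed

text \<open>What is needed from an adapted basis at one point: \<open>\<alpha>\<close> is the signed
  volume, determined only up to a sign that may jump with \<open>s\<close>, so it is used pointwise
  and never differentiated. The clause with \<open>u\<close> is the polarised formula in which one
  slot leaves the tangent space; it yields the derivative of \<open>Q\<close> and Cramer's
  rule.\<close>

definition density_form :: "real \<times> 'b \<Rightarrow> ((nat \<Rightarrow> 'b) \<Rightarrow> real) \<Rightarrow> bool" where
  "density_form s \<alpha> \<longleftrightarrow> alternating_form (DIM('a) - p) \<alpha> \<and> \<alpha> b \<noteq> 0 \<and>
     (\<forall>w w'. vol_product p (\<lambda>i. B s (w i)) (\<lambda>i. B s (w' i)) = fact p * (\<alpha> w * \<alpha> w')) \<and>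
     (\<forall>w u. \<forall>i<DIM('a) - p. vol_product p (\<lambda>i. B s (w i)) ((\<lambda>i. B s (w i))(i := u)) =
        fact p * (\<alpha> w * \<alpha> (w(i := pull s u)))) \<and>
     (\<forall>f w. adapted p (T s) f \<longrightarrow>
        \<bar>wedge (DIM('a) - p) (\<lambda>i. component DIM('a) f (p + i)) (\<lambda>i. B s (w i))\<bar> = \<bar>\<alpha> w\<bar>)"

lemma density_formD:
  assumes "density_form s \<alpha>"
  shows "alternating_form (DIM('a) - p) \<alpha>" "\<alpha> b \<noteq> 0"
    "vol_product p (\<lambda>i. B s (w i)) (\<lambda>i. B s (w' i)) = fact p * (\<alpha> w * \<alpha> w')"
    "i < DIM('a) - p \<Longrightarrow> vol_product p (\<lambda>i. B s (w i)) ((\<lambda>i. B s (w i))(i := u)) =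
        fact p * (\<alpha> w * \<alpha> (w(i := pull s u)))"
    "adapted p (T s) f \<Longrightarrow>
      \<bar>wedge (DIM('a) - p) (\<lambda>i. component DIM('a) f (p + i)) (\<lambda>i. B s (w i))\<bar> = \<bar>\<alpha> w\<bar>"
  using assms unfolding density_form_def by blast+

lemma ex_density_form:
  assumes s: "s \<in> S"
  shows "\<exists>\<alpha>. density_form s \<alpha>"
proof -
  note t = transversal_T[OF s]
  obtain f where f: "adapted p (T s) f" using adapted_exists[OF t] by blast
  define \<alpha> where "\<alpha> w = Vol (join p f (\<lambda>i. B s (w i)))" for w
  have alt: "alternating_form (DIM('a) - p) \<alpha>"
    unfolding \<alpha>_def[abs_def]
    by (rule alternating_form_compose_linear[OF Vol_join_right[OF p_le_DIM] linear_B[OF s]])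
  have vol: "vol_product p (\<lambda>i. B s (w i)) w' = fact p * (\<alpha> w * Vol (join p f w'))" for w w'
    unfolding \<alpha>_def by (rule vol_product_adapted[OF t f]) (rule B_in_T)
  \<comment> \<open>\<open>vol_product\<close> refers to the fixed frame, so any two adapted bases
    give the same square.\<close>
  have sq: "(\<alpha> w)\<^sup>2 = (wedge (DIM('a) - p) (\<lambda>i. component DIM('a) g (p + i)) (\<lambda>i. B s (w i)))\<^sup>2"
    if g: "adapted p (T s) g" for g w
  proof -
    have "fact p * (\<alpha> w * \<alpha> w) = vol_product p (\<lambda>i. B s (w i)) (\<lambda>i. B s (w i))"
      unfolding vol by (simp add: \<alpha>_def)
    also have "\<dots> = fact p * (Vol (join p g (\<lambda>i. B s (w i))) * Vol (join p g (\<lambda>i. B s (w i))))"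
      by (rule vol_product_adapted[OF t g]) (rule B_in_T)
    also have "Vol (join p g (\<lambda>i. B s (w i))) = Vol g * wedge (DIM('a) - p)
        (\<lambda>i. component DIM('a) g (p + i)) (\<lambda>i. B s (w i))"
      using Vol_join_T[OF t g, of "\<lambda>i. B s (w i)" g] B_in_T by (simp add: join_shift)
    finally show ?thesis using Vol_adapted[OF t g] by (simp add: power2_eq_square mult_ac)
  qed
  have "density_form s \<alpha>"
    unfolding density_form_def
  proof (intro conjI allI impI)
    show "alternating_form (DIM('a) - p) \<alpha>" by (rule alt)
    show "vol_product p (\<lambda>i. B s (w i)) (\<lambda>i. B s (w' i)) = fact p * (\<alpha> w * \<alpha> w')" for w w'
      unfolding vol by (simp add: \<alpha>_def)
    show "vol_product p (\<lambda>i. B s (w i)) ((\<lambda>i. B s (w i))(i := u)) = fact p *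
        (\<alpha> w * \<alpha> (w(i := pull s u)))"
      if "i < DIM('a) - p" for w i u
    proof -
      have "Vol (join p f ((\<lambda>i. B s (w i))(i := u))) = Vol
          (join p f ((\<lambda>i. B s (w i))(i := tan_proj (T s) u)))"
        by (rule Vol_join_tan_proj[OF t f]) (use that B_in_T in auto)
      also have "(\<lambda>i. B s (w i))(i := tan_proj (T s) u) = (\<lambda>j. B s ((w(i := pull s u)) j))"
        by (auto simp: B_pull[OF s])
      finally show ?thesis unfolding vol by (simp only: \<alpha>_def)
    qed
    show "\<bar>wedge (DIM('a) - p) (\<lambda>i. component DIM('a) g (p + i)) (\<lambda>i. B s (w i))\<bar> = \<bar>\<alpha> w\<bar>" if
        "adapted p (T s) g" for g w
      using arg_cong[OF sq[OF that, of w], of sqrt] by simp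
    show "\<alpha> b \<noteq> 0"
    proof
      assume "\<alpha> b = 0"
      then have z: "\<alpha> v = 0" for v using alternating_form_basis[OF alt basis, of v] by simp
      \<comment> \<open>On the preimages of the tangential vectors of \<open>f\<close> the form
        \<open>\<alpha>\<close> takes the value \<open>Vol f\<close>, whose square is 1.\<close>
      have "B s (inv (B s) (f j)) = f j" if "p \<le> j" "j < DIM('a)" for j
        using adapted_T[OF t f, of j] that by (auto simp: T_def f_inv_into_f)
      then have "Vol f = \<alpha> (\<lambda>i. inv (B s) (f (p + i)))"
        unfolding \<alpha>_def using p_le_DIM
        by (intro multilinear_form_cong[OF alternating_form_imp_multilinear[OF Vol_alternating]])
          (auto simp: join_def)
      then show False using Vol_adapted[OF t f] z by simp
    qed
  qed
  then show ?thesis by blast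
qed

lemma Q_pos:
  assumes s: "s \<in> S"
  shows "0 < Q s"
proof -
  obtain \<alpha> where \<alpha>: "density_form s \<alpha>" using ex_density_form[OF s] by blast
  have "0 < \<alpha> b * \<alpha> b" using density_formD(2)[OF \<alpha>] by (simp add: zero_less_mult_iff) linarith
  then show ?thesis unfolding Q_def density_formD(3)[OF \<alpha>] by simp
qed

lemma wedge_eq_density:
  assumes s: "s \<in> S" and f: "adapted p (T s) f"
  shows "\<bar>wedge (DIM('a) - p) (\<lambda>i. component DIM('a) f (p + i)) (\<lambda>i. B s (w i))\<bar> = density s * \<bar>\<delta>
      w\<bar>"
proof -
  obtain \<alpha> where \<alpha>: "density_form s \<alpha>" using ex_density_form[OF s] by blast
  have "density s = \<bar>\<alpha> b\<bar>"
    unfolding density_def Q_def density_formD(3)[OF \<alpha>] by simp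
  then show ?thesis
    using density_formD(5)[OF \<alpha> f, of w] alternating_form_basis[OF density_formD(1)[OF \<alpha>] basis,
        of w]
    by (simp add: \<delta>_def abs_mult)
qed

text \<open>Cramer's rule, which shows that the tangential part of the variation is differentiable.\<close>

lemma Z_formula:
  assumes s: "s \<in> S"
  shows "Z s = (\<Sum>i<DIM('a) - p. (vol_product p (\<lambda>i. B s (b i)) ((\<lambda>i. B s (b i))(i := P s)) / Q s)
      *\<^sub>R b i)"
proof -
  obtain \<alpha> where \<alpha>: "density_form s \<alpha>" using ex_density_form[OF s] by blast
  have "vol_product p (\<lambda>i. B s (b i)) ((\<lambda>i. B s (b i))(i := P s)) / Q s = component (DIM('a) - p)
      b i (Z s)"
    if i: "i < DIM('a) - p" for i
    using density_formD(2)[OF \<alpha>]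
    unfolding density_formD(4)[OF \<alpha> i] Q_def density_formD(3)[OF \<alpha>]
      alternating_form_upd_basis[OF density_formD(1)[OF \<alpha>] basis i]
    by (simp add: Z_def)
  then show ?thesis by (simp add: sum_component[OF basis])
qed

section \<open>Derivative of the density at the base point\<close>

abbreviation "s0 \<equiv> (0::real, y0)"

definition D\<theta> :: "real \<times> 'b \<Rightarrow> real \<times> 'b \<Rightarrow> 'a" where
  "D\<theta> V V' = frechet_derivative (\<lambda>s. \<theta> s V') (at s0) V"

lemma D\<theta>: "((\<lambda>s. \<theta> s V) has_derivative (\<lambda>h. D\<theta> h V)) (at s0)"
  unfolding D\<theta>_def using differentiable_\<theta> frechet_derivative_works by blast

lemma linear_D\<theta>: "linear (\<lambda>h. D\<theta> h V)" "linear (D\<theta> h)"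
proof -
  show "linear (\<lambda>h. D\<theta> h V)" using D\<theta> by (rule has_derivative_linear)
  show "linear (D\<theta> h)"
  proof (rule linearI)
    fix v w c
    have "((\<lambda>s. \<theta> s v + \<theta> s w) has_derivative (\<lambda>h. D\<theta> h v + D\<theta> h w)) (at s0)"
      by (intro has_derivative_add D\<theta>)
    then have "((\<lambda>s. \<theta> s (v + w)) has_derivative (\<lambda>h. D\<theta> h v + D\<theta> h w)) (at s0)"
      by (rule has_derivative_transform_within_open[OF _ S]) (simp add: linear_add[OF linear_\<theta>])
    from fun_cong[OF has_derivative_unique[OF D\<theta> this], of h] show
        "D\<theta> h (v + w) = D\<theta> h v + D\<theta> h w" .
    have "((\<lambda>s. c *\<^sub>R \<theta> s v) has_derivative (\<lambda>h. c *\<^sub>R D\<theta> h v)) (at s0)"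
      by (intro has_derivative_scaleR_right D\<theta>)
    then have "((\<lambda>s. \<theta> s (c *\<^sub>R v)) has_derivative (\<lambda>h. c *\<^sub>R D\<theta> h v)) (at s0)"
      by (rule has_derivative_transform_within_open[OF _ S]) (simp add: linear_cmul[OF linear_\<theta>])
    from fun_cong[OF has_derivative_unique[OF D\<theta> this], of h] show "D\<theta> h (c *\<^sub>R v) = c *\<^sub>R D\<theta> h v" .
  qed
qed

text \<open>The trace of \<open>L V\<close> will be the logarithmic derivative of
  \<open>density\<close> in the direction \<open>V\<close>.\<close>

definition L :: "real \<times> 'b \<Rightarrow> 'b \<Rightarrow> 'b" where
  "L V w = pull s0 (D\<theta> V (0, w))"

lemma linear_L: "linear (L V)"
proof -
  have "linear (\<lambda>w::'b. (0::real, w))" by (rule linearI) auto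
  from linear_compose[OF linear_compose[OF this linear_D\<theta>(2)] linear_pull[OF S(2)]]
  show ?thesis by (simp add: L_def[abs_def] o_def)
qed

text \<open>Differentiating one slot puts an arbitrary vector there, which the polarised clause of
  \<open>density_form\<close> turns into \<open>L V (b i)\<close>; the slots add up to a trace. The
  factor 2 comes from the two equal arguments of \<open>vol_product\<close>.\<close>

lemma has_derivative_Q:
  "(Q has_derivative (\<lambda>V. 2 * (endo_trace (L V) * Q s0))) (at s0)"
proof -
  obtain \<alpha> where \<alpha>: "density_form s0 \<alpha>" using ex_density_form[OF S(2)] by blast
  let ?D = "\<lambda>i h. D\<theta> h (0, b i)"
  have "(Q has_derivative (\<lambda>h. (\<Sum>i<DIM('a) - p. vol_product p (\<lambda>i. B s0 (b i))
      ((\<lambda>i. B s0 (b i))(i := ?D i h))) +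
          (\<Sum>i<DIM('a) - p. vol_product p ((\<lambda>i. B s0 (b i))(i := ?D i h)) (\<lambda>i. B s0 (b i)))))
              (at s0)"
    unfolding Q_def[abs_def] B_def by (rule has_derivative_vol_product[OF p_le_DIM D\<theta> D\<theta>])
  moreover have "(\<Sum>i<DIM('a) - p. vol_product p (\<lambda>i. B s0 (b i)) ((\<lambda>i. B s0 (b i))(i := ?D i h)))
      = endo_trace (L h) * Q s0" for h
  proof -
    have "(\<Sum>i<DIM('a) - p. vol_product p (\<lambda>i. B s0 (b i)) ((\<lambda>i. B s0 (b i))(i := ?D i h))) =
        (\<Sum>i<DIM('a) - p. fact p * (\<alpha> b * \<alpha> (b(i := L h (b i)))))"
      by (intro sum.cong refl) (simp add: density_formD(4)[OF \<alpha>] L_def)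
    also have "\<dots> = fact p * \<alpha> b * (\<Sum>i<DIM('a) - p. \<alpha> (b(i := L h (b i))))"
      by (simp add: sum_distrib_left mult.assoc del: fun_upd_apply)
    also have "\<dots> = endo_trace (L h) * Q s0"
      unfolding alternating_form_endo_trace[OF density_formD(1)[OF \<alpha>] linear_L basis] Q_def
        density_formD(3)[OF \<alpha>] by simp
    finally show ?thesis .
  qed
  ultimately show ?thesis by (simp add: vol_product_commute[of _ "_(_ := _)"] del: fun_upd_apply)
qed

lemma has_derivative_density:
  "(density has_derivative (\<lambda>V. endo_trace (L V) * density s0)) (at s0)"
proof -
  have q: "0 < Q s0 / fact p" using Q_pos[OF S(2)] by simp
  have "((\<lambda>s. sqrt (Q s / fact p)) has_derivative
      (\<lambda>V. (2 * (endo_trace (L V) * Q s0) / fact p) * (inverse (sqrt (Q s0 / fact p)) / 2)))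
          (at s0)"
    using q by (intro DERIV_real_sqrt[THEN DERIV_compose_FDERIV]
        bounded_linear.has_derivative[OF bounded_linear_divide has_derivative_Q])
  moreover have "(2 * (endo_trace (L V) * Q s0) / fact p) * (inverse (sqrt (Q s0 / fact p)) / 2) =
      endo_trace (L V) * density s0" for V
  proof -
    have "(Q s0 / fact p) * inverse (sqrt (Q s0 / fact p)) = sqrt (Q s0 / fact p)"
      using q by (metis divide_inverse real_div_sqrt less_imp_le)
    moreover have "(2 * (endo_trace (L V) * Q s0) / fact p) * (inverse (sqrt (Q s0 / fact p)) / 2) =
        endo_trace (L V) * ((Q s0 / fact p) * inverse (sqrt (Q s0 / fact p)))"
      by simp
    ultimately show ?thesis unfolding density_def by (simp only:)
  qed
  ultimately show ?thesis by (simp add: density_def[abs_def])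
qed

section \<open>Tangential and normal parts of the variation field\<close>

lemma has_derivative_slice: "((\<lambda>y. (0::real, y)) has_derivative (\<lambda>h. (0, h))) (at y0)"
  by (auto intro!: derivative_eq_intros)

lemma has_derivative_slice_compose:
  fixes f :: "real \<times> 'b \<Rightarrow> 'c::real_normed_vector"
  shows "(f has_derivative f') (at s0) \<Longrightarrow> ((\<lambda>y. f (0, y)) has_derivative (\<lambda>h. f' (0, h))) (at y0)"
  by (rule has_derivative_compose[OF has_derivative_slice, of f f'])

lemma open_slice: "open {y. (0, y) \<in> S}"
proof -
  have "continuous_on UNIV (\<lambda>y::'b. (0::real, y))" by (intro continuous_intros)
  then have "open ((\<lambda>y. (0, y)) -` S)" using S(1) by (simp add: open_vimage)
  then show ?thesis by (simp add: vimage_def)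
qed

lemma differentiable_component_Z:
  assumes i: "i < DIM('a) - p"
  shows "(\<lambda>y. component (DIM('a) - p) b i (Z (0, y))) differentiable (at y0)"
proof -
  let ?q = "\<lambda>s. vol_product p (\<lambda>i. B s (b i)) ((\<lambda>i. B s (b i))(i := P s)) / Q s"
  have "(\<lambda>s. vol_product p (\<lambda>i. B s (b i)) ((\<lambda>i. B s (b i))(i := P s))) differentiable (at s0)"
  proof -
    define D' where "D' j = (if j = i then \<lambda>h. D\<theta> h (1, 0) else (\<lambda>h. D\<theta> h (0, b j)))" for j
    have 1: "((\<lambda>s. ((\<lambda>i. B s (b i))(i := P s)) j) has_derivative D' j) (at s0)" for j
      using D\<theta> by (auto simp: B_def P_def D'_def)
    have 2: "((\<lambda>s. B s (b j)) has_derivative (\<lambda>h. D\<theta> h (0, b j))) (at s0)" for j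
      using D\<theta> by (simp add: B_def)
    show ?thesis
      by (rule differentiableI, rule has_derivative_vol_product[where w' =
          "\<lambda>s. (\<lambda>i. B s (b i))(i := P s)", OF p_le_DIM 2 1])
  qed
  moreover have "Q s0 \<noteq> 0" using Q_pos[OF S(2)] by simp
  ultimately have "?q differentiable (at s0)"
    by (intro differentiable_divide differentiableI[OF has_derivative_Q])
  then obtain D where "(?q has_derivative D) (at s0)" by (auto simp: differentiable_def)
  then have "((\<lambda>y. ?q (0, y)) has_derivative (\<lambda>h. D (0, h))) (at y0)"
    by (rule has_derivative_slice_compose)
  then have "((\<lambda>y. component (DIM('a) - p) b i (Z (0, y))) has_derivative (\<lambda>h. D (0, h))) (at y0)"
    by (rule has_derivative_transform_within_open[OF _ open_slice])
      (use S(2) in \<open>simp_all add: Z_formula component_sum[OF basis i]\<close>)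
  then show ?thesis by (rule differentiableI)
qed

definition DZ :: "'b \<Rightarrow> 'b" where
  "DZ = frechet_derivative (\<lambda>y. Z (0, y)) (at y0)"

text \<open>The derivative is assembled from those of the components in \<open>b\<close>, which are
  quotients by Cramer's rule.\<close>

lemma DZ:
  "((\<lambda>y. Z (0, y)) has_derivative DZ) (at y0)"
  "i < DIM('a) - p \<Longrightarrow> ((\<lambda>y. component (DIM('a) - p) b i (Z (0, y))) has_derivative
      (\<lambda>h. component (DIM('a) - p) b i (DZ h))) (at y0)"
proof -
  define D where "D i = frechet_derivative (\<lambda>y. component (DIM('a) - p) b i (Z (0, y))) (at y0)"
      for i
  have D: "((\<lambda>y. component (DIM('a) - p) b i (Z (0, y))) has_derivative D i) (at y0)" if
      "i < DIM('a) - p" for i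
    using differentiable_component_Z[OF that] frechet_derivative_works unfolding D_def by blast
  have "((\<lambda>y. \<Sum>i<DIM('a) - p. component (DIM('a) - p) b i (Z (0, y)) *\<^sub>R b i) has_derivative
      (\<lambda>h. \<Sum>i<DIM('a) - p. D i h *\<^sub>R b i)) (at y0)"
    by (intro has_derivative_sum has_derivative_scaleR_left D) simp
  then have Z: "((\<lambda>y. Z (0, y)) has_derivative (\<lambda>h. \<Sum>i<DIM('a) - p. D i h *\<^sub>R b i)) (at y0)"
    by (simp add: sum_component[OF basis])
  then have DZ_eq: "DZ = (\<lambda>h. \<Sum>i<DIM('a) - p. D i h *\<^sub>R b i)"
    unfolding DZ_def by (rule frechet_derivative_at[symmetric])
  show "((\<lambda>y. Z (0, y)) has_derivative DZ) (at y0)" using Z by (simp add: DZ_eq)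
  show "((\<lambda>y. component (DIM('a) - p) b i (Z (0, y))) has_derivative
      (\<lambda>h. component (DIM('a) - p) b i (DZ h))) (at y0)" if "i < DIM('a) - p" for i
    using D[OF that] by (simp add: DZ_eq component_sum[OF basis that])
qed

lemma linear_expansion:
  assumes "linear g"
  shows "(\<Sum>i<DIM('a) - p. component (DIM('a) - p) b i z *\<^sub>R g (0, b i)) = g (0::real, z)"
proof -
  have "(0, z) = (\<Sum>i<DIM('a) - p. component (DIM('a) - p) b i z *\<^sub>R (0::real, b i))"
    by (simp only: prod_eq_iff fst_sum snd_sum fst_conv snd_conv scaleR_prod_def
        sum_component[OF basis]) simp
  then have "g (0, z) = g (\<Sum>i<DIM('a) - p. component (DIM('a) - p) b i z *\<^sub>R (0, b i))"
    by (rule arg_cong)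
  then show ?thesis by (simp only: linear_sum[OF assms] linear_cmul[OF assms])
qed

lemma P_split: "s \<in> S \<Longrightarrow> P s = P_perp s + B s (Z s)"
  by (simp add: P_perp_def Z_def B_pull)

text \<open>In \<open>B s (Z s)\<close> both the form and its argument vary; expanding
  \<open>Z\<close> in \<open>b\<close> turns it into a finite sum to which the product rule
  applies.\<close>

lemma has_derivative_P_perp:
  "((\<lambda>y. P_perp (0, y)) has_derivative
     (\<lambda>h. D\<theta> (0, h) (1, 0) - (D\<theta> (0, h) (0, Z s0) + B s0 (DZ h)))) (at y0)"
proof -
  have "((\<lambda>y. \<Sum>i<DIM('a) - p. component (DIM('a) - p) b i (Z (0, y)) *\<^sub>R \<theta> (0, y) (0, b i))
      has_derivative
     (\<lambda>h. \<Sum>i<DIM('a) - p. component (DIM('a) - p) b i (Z s0) *\<^sub>R D\<theta> (0, h) (0, b i) + component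
         (DIM('a) - p) b i (DZ h) *\<^sub>R \<theta> s0 (0, b i))) (at y0)"
    by (intro has_derivative_sum has_derivative_scaleR has_derivative_slice_compose[OF D\<theta>] DZ) simp
  then have *: "((\<lambda>y. \<Sum>i<DIM('a) - p. component (DIM('a) - p) b i (Z (0, y)) *\<^sub>R \<theta> (0, y)
      (0, b i)) has_derivative
      (\<lambda>h. D\<theta> (0, h) (0, Z s0) + B s0 (DZ h))) (at y0)"
    by (simp only: sum.distrib linear_expansion[OF linear_D\<theta>(2)]
        linear_expansion[OF linear_\<theta>[OF S(2)]] B_def)
  have "((\<lambda>y. \<theta> (0, y) (1, 0) - (\<Sum>i<DIM('a) - p. component (DIM('a) - p) b i (Z (0, y)) *\<^sub>R \<theta>
      (0, y) (0, b i))) has_derivative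
     (\<lambda>h. D\<theta> (0, h) (1, 0) - (D\<theta> (0, h) (0, Z s0) + B s0 (DZ h)))) (at y0)"
    by (intro has_derivative_diff * has_derivative_slice_compose[OF D\<theta>])
  then show ?thesis
    by (rule has_derivative_transform_within_open[OF _ open_slice])
      (use S(2) P_split in \<open>auto simp: linear_expansion[OF linear_\<theta>] P_def B_def\<close>)
qed

definition DP :: "'b \<Rightarrow> 'a" where
  "DP = frechet_derivative (\<lambda>y. P_perp (0, y)) (at y0)"

lemma DP: "((\<lambda>y. P_perp (0, y)) has_derivative DP) (at y0)"
  using differentiableI[OF has_derivative_P_perp] unfolding DP_def frechet_derivative_works .

lemma DP_eq: "DP h = D\<theta> (0, h) (1, 0) - (D\<theta> (0, h) (0, Z s0) + B s0 (DZ h))"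
  using has_derivative_unique[OF DP has_derivative_P_perp] by (rule fun_cong)

lemma linear_DP: "linear DP" using DP by (rule has_derivative_linear)

lemma linear_DZ: "linear DZ" using DZ(1) by (rule has_derivative_linear)

text \<open>
  Moving in the direction \<open>(1, - Z)\<close> displaces the submanifold by the normal part of the variation.
\<close>

lemma L_normal:
  "L (1, - Z s0) w = pull s0 (DP w) + DZ w - pull s0 (C (P_perp s0) (B s0 w))"
proof -
  note lp = linear_pull[OF S(2)]
  have 0: "(1, - Z s0) = (1, 0) + (-1) *\<^sub>R (0::real, Z s0)" by simp
  have "\<theta> s0 (1, - Z s0) = P s0 - B s0 (Z s0)"
    unfolding 0 linear_add[OF linear_\<theta>[OF S(2)]] linear_cmul[OF linear_\<theta>[OF S(2)]]
    by (simp add: P_def B_def)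
  then have 1: "\<theta> s0 (1, - Z s0) = P_perp s0" using P_split[OF S(2)] by simp
  have "D\<theta> (0, w) (1, - Z s0) = D\<theta> (0, w) (1, 0) - D\<theta> (0, w) (0, Z s0)"
    unfolding 0 linear_add[OF linear_D\<theta>(2)] linear_cmul[OF linear_D\<theta>(2)] by simp
  also have "\<dots> = DP w + B s0 (DZ w)" by (simp add: DP_eq)
  finally have "D\<theta> (1, - Z s0) (0, w) = DP w + B s0 (DZ w) - C (P_perp s0) (B s0 w)"
    using structure_eq[of "(0, w)" "(1, - Z s0)"] 1 by (simp add: D\<theta>_def B_def algebra_simps)
  then show ?thesis
    by (simp add: L_def linear_add[OF lp] linear_diff[OF lp] pull_B[OF S(2)])
qed

text \<open>\<open>L\<close> is additive in its direction, and \<open>(1, 0)\<close> is the normal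
  displacement \<open>(1, - Z)\<close> plus the displacement \<open>(0, Z)\<close> inside the
  submanifold. The last two traces will form the exterior derivative.\<close>

lemma density_normal:
  "endo_trace (L (1, 0)) = endo_trace (\<lambda>w. pull s0 (DP w)) - endo_trace
      (\<lambda>w. pull s0 (C (P_perp s0) (B s0 w)))
      + endo_trace DZ + endo_trace (L (0, Z s0))"
proof -
  let ?A = "\<lambda>w. pull s0 (DP w)" and ?C = "\<lambda>w. pull s0 (C (P_perp s0) (B s0 w))"
  have A: "linear ?A" using linear_compose[OF linear_DP linear_pull[OF S(2)]] by (simp add: o_def)
  have C: "linear ?C"
    using linear_compose[OF linear_compose[OF linear_B[OF S(2)] linear_C] linear_pull[OF S(2)]]
        by (simp add: o_def)
  have "L (1, 0) w = (?A w + DZ w) + - ?C w + L (0, Z s0) w" for w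
  proof -
    have "(1, 0) = (1, - Z s0) + (0::real, Z s0)" by simp
    then have "L (1, 0) w = L ((1, - Z s0) + (0, Z s0)) w" by (simp only:)
    also have "\<dots> = L (1, - Z s0) w + L (0, Z s0) w"
      unfolding L_def linear_add[OF linear_D\<theta>(1)] linear_add[OF linear_pull[OF S(2)]] ..
    finally show ?thesis by (simp add: L_normal)
  qed
  then have "endo_trace (L (1, 0)) = endo_trace (\<lambda>w. (?A w + DZ w) + - ?C w + L (0, Z s0) w)"
    by (rule arg_cong[OF ext])
  also have "\<dots> = endo_trace ?A + endo_trace DZ - endo_trace ?C + endo_trace (L (0, Z s0))"
  proof -
    note AZ = linear_compose_add[OF A linear_DZ] and nC = linear_compose_neg[OF C]
    show ?thesis
      using endo_trace_add[OF basis linear_compose_add[OF AZ nC] linear_L[of "(0, Z s0)"]]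
        endo_trace_add[OF basis AZ nC] endo_trace_add[OF basis A linear_DZ]
            endo_trace_uminus[OF basis C]
      by simp
  qed
  finally show ?thesis by simp
qed

text \<open>\<open>\<delta>\<close> is constant in the chart, so the exterior derivative of its
  contraction with a multiple \<open>\<rho>\<close> of \<open>Z\<close> is the divergence of
  \<open>\<rho> Z\<close> times \<open>\<delta>\<close>: the derivative of \<open>\<rho>\<close>
  along \<open>Z\<close> plus \<open>\<rho>\<close> times the trace of \<open>DZ\<close>. The
  constant \<open>c\<close> will be the orientation sign.\<close>

lemma exterior_derivative_density:
  "(\<Sum>i<DIM('a) - p. (-1) ^ i * frechet_derivative
      (\<lambda>y. c * density (0, y) * \<delta> (case_nat (Z (0, y)) (\<lambda>j. if j < i then v j else v (Suc j))))
          (at y0) (v i)) =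
   (endo_trace (L (0, Z s0)) + endo_trace DZ) * (c * density s0 * \<delta> v)"
proof -
  let ?u = "\<lambda>i z. case_nat z (\<lambda>j. if j < i then v j else v (Suc j))"
  let ?l = "\<lambda>h. endo_trace (L (0, h)) * density s0"
  have ld: "linear (\<lambda>h. endo_trace (L (0, h)) * density s0)"
    using has_derivative_slice_compose[OF has_derivative_density] by (rule has_derivative_linear)
  have "(-1) ^ i * frechet_derivative (\<lambda>y. c * density (0, y) * \<delta> (?u i (Z (0, y)))) (at y0) (v i) =
      c * \<delta> (v(i := ?l (v i) *\<^sub>R Z s0)) + c * density s0 * \<delta> (v(i := DZ (v i)))" if i: "i <
          DIM('a) - p" for i
  proof -
    note lin = multilinear_form_linear[OF alternating_form_imp_multilinear[OF \<delta>] i, of v]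
    \<comment> \<open>Putting \<open>z\<close> back into slot \<open>i\<close> costs
      \<open>(-1) ^ i\<close>, which cancels the sign in the exterior derivative.\<close>
    have \<delta>u: "\<delta> (?u i z) = (-1) ^ i * \<delta> (v(i := z))" for z
      by (rule alternating_form_case_nat[OF \<delta> i])
    have exp: "\<delta> (v(i := z)) = (\<Sum>j<DIM('a) - p. component (DIM('a) - p) b j z * \<delta> (v(i := b j)))"
        for z
    proof -
      have "\<delta> (v(i := z)) = \<delta> (v(i := (\<Sum>j<DIM('a) - p. component (DIM('a) - p) b j z *\<^sub>R b j)))"
        by (simp add: sum_component[OF basis])
      then show ?thesis by (simp add: linear_sum[OF lin] linear_cmul[OF lin] del: fun_upd_apply)
    qed
    have "((\<lambda>y. \<Sum>j<DIM('a) - p. component (DIM('a) - p) b j (Z (0, y)) * \<delta> (v(i := b j)))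
        has_derivative
        (\<lambda>h. \<Sum>j<DIM('a) - p. component (DIM('a) - p) b j (DZ h) * \<delta> (v(i := b j)))) (at y0)"
      by (intro has_derivative_sum has_derivative_mult_left DZ) simp
    then have d1: "((\<lambda>y. \<delta> (v(i := Z (0, y)))) has_derivative (\<lambda>h. \<delta> (v(i := DZ h)))) (at y0)"
      by (simp only: exp[symmetric])
    have d2: "((\<lambda>y. c * density (0, y)) has_derivative (\<lambda>h. c * ?l h)) (at y0)"
      by (intro has_derivative_mult_right has_derivative_slice_compose[OF has_derivative_density])
    have "((\<lambda>y. c * density (0, y) * ((-1) ^ i * \<delta> (v(i := Z (0, y))))) has_derivative
        (\<lambda>h. c * density s0 * ((-1) ^ i * \<delta> (v(i := DZ h))) + c * ?l h *
            ((-1) ^ i * \<delta> (v(i := Z s0))))) (at y0)"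
      by (intro has_derivative_mult d2 has_derivative_mult_right d1)
    then have "frechet_derivative (\<lambda>y. c * density (0, y) * \<delta> (?u i (Z (0, y)))) (at y0) =
       (\<lambda>h. c * density s0 * ((-1) ^ i * \<delta> (v(i := DZ h))) + c * ?l h *
           ((-1) ^ i * \<delta> (v(i := Z s0))))"
      unfolding \<delta>u by (rule frechet_derivative_at[symmetric])
    moreover have "(-1) ^ i * (-1) ^ i = (1::real)" by (simp flip: power_mult_distrib)
    moreover have "\<delta> (v(i := ?l (v i) *\<^sub>R Z s0)) = ?l (v i) * \<delta> (v(i := Z s0))"
      by (simp add: linear_cmul[OF lin] del: fun_upd_apply)
    ultimately show ?thesis
      by (simp add: distrib_left mult.left_commute[of "(-1) ^ i"] mult.assoc[symmetric] del:
          fun_upd_apply)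
        (simp add: mult_ac del: fun_upd_apply)
  qed
  then have "(\<Sum>i<DIM('a) - p. (-1) ^ i * frechet_derivative
      (\<lambda>y. c * density (0, y) * \<delta> (?u i (Z (0, y)))) (at y0) (v i)) =
     c * (\<Sum>i<DIM('a) - p. \<delta> (v(i := ?l (v i) *\<^sub>R Z s0))) + c * density s0 *
         (\<Sum>i<DIM('a) - p. \<delta> (v(i := DZ (v i))))"
    by (simp add: sum.distrib sum_distrib_left del: fun_upd_apply)
  \<comment> \<open>The terms that differentiate the density form the slot sum of a rank-one
    endomorphism, whose trace is the derivative along \<open>Z\<close>.\<close>
  also have "(\<Sum>i<DIM('a) - p. \<delta> (v(i := ?l (v i) *\<^sub>R Z s0))) = endo_trace (\<lambda>h. ?l h *\<^sub>R Z s0) * \<delta> v"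
    by (rule alternating_form_endo_trace[OF \<delta> _ basis])
      (use ld in \<open>auto simp: linear_iff scaleR_left_distrib\<close>)
  also have "endo_trace (\<lambda>h. ?l h *\<^sub>R Z s0) = ?l (Z s0)"
    by (rule endo_trace_rank_one[OF basis ld])
  also have "(\<Sum>i<DIM('a) - p. \<delta> (v(i := DZ (v i)))) = endo_trace DZ * \<delta> v"
    by (rule alternating_form_endo_trace[OF \<delta> linear_DZ basis])
  finally show ?thesis by (simp add: algebra_simps)
qed

theorem variation_of_density:
  "((\<lambda>u. c * density (u, y0) * \<delta> v) has_real_derivative
      (endo_trace (\<lambda>w. pull s0 (DP w)) - endo_trace (\<lambda>w. pull s0 (C (P_perp s0) (B s0 w)))) *
          (c * density s0 * \<delta> v) +
      (\<Sum>i<DIM('a) - p. (-1) ^ i * frechet_derivative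
        (\<lambda>y. c * density (0, y) * \<delta> (case_nat (Z (0, y)) (\<lambda>j. if j < i then v j else v (Suc j))))
            (at y0) (v i)))
    (at 0)"
proof -
  have "((\<lambda>u. (u, y0)) has_derivative (\<lambda>h. (h, 0))) (at 0)"
    by (auto intro!: derivative_eq_intros)
  then have d: "((\<lambda>u. density (u, y0)) has_derivative (\<lambda>h. endo_trace (L (h, 0)) * density s0))
      (at 0)"
    using has_derivative_compose[of "\<lambda>u. (u, y0)" "\<lambda>h. (h, 0)" 0 UNIV density]
        has_derivative_density by blast
  have "endo_trace (L (h, 0)) * density s0 = (endo_trace (L (1, 0)) * density s0) * h" for h
    using linear_cmul[OF has_derivative_linear[OF d], of h 1] by (simp add: mult_ac)
  from has_derivative_eq_rhs[OF d ext[OF this]]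
  have "((\<lambda>u. density (u, y0)) has_real_derivative endo_trace (L (1, 0)) * density s0) (at 0)"
    unfolding has_field_derivative_def .
  then have "((\<lambda>u. c * density (u, y0) * \<delta> v) has_real_derivative
      c * (endo_trace (L (1, 0)) * density s0) * \<delta> v) (at 0)"
    by (intro DERIV_cmult_right DERIV_cmult)
  then show ?thesis
    unfolding exterior_derivative_density density_normal by (simp add: algebra_simps)
qed

text \<open>In the basis of preimages of the tangential vectors of \<open>f\<close>, the diagonal
  entries are the components with index \<open>j \<ge> p\<close>. For \<open>j < d\<close> the
  vector \<open>f j\<close> is horizontal, \<open>C \<xi> (f j)\<close> is vertical, and
  \<open>component_vertical\<close> makes the entry 0.\<close>

lemma endo_trace_pull_vertical:
  assumes f: "adapted p (T s0) f" and \<xi>: "\<xi> \<in> H"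
    and C: "\<And>v w i. v \<in> H \<Longrightarrow> w \<in> H \<Longrightarrow> i < d \<Longrightarrow> C v w \<bullet> e i = 0"
  shows "endo_trace (\<lambda>w. pull s0 (C \<xi> (B s0 w))) =
      (\<Sum>j=d..<DIM('a). component DIM('a) f j (C \<xi> (f j)))"
proof -
  note t = transversal_T[OF S(2)]
  note tb = adapted_basis[OF t f]
  define g where "g i = inv (B s0) (f (p + i))" for i
  have Bg: "B s0 (g i) = f (p + i)" if "i < DIM('a) - p" for i
    using adapted_T[OF t f, of "p + i"] that by (auto simp: g_def T_def f_inv_into_f)
  have pull: "pull s0 v = (\<Sum>i<DIM('a) - p. component DIM('a) f (p + i) v *\<^sub>R g i)" for v
  proof (rule injD[OF inj_B[OF S(2)]])
    have "B s0 (pull s0 v) = (\<Sum>i=p..<DIM('a). component DIM('a) f i v *\<^sub>R f i)"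
      by (simp add: B_pull[OF S(2)] tan_proj_adapted(1)[OF t f])
    also have "\<dots> = (\<Sum>i<DIM('a) - p. component DIM('a) f (p + i) v *\<^sub>R f (p + i))"
      by (rule sum.reindex_bij_witness[of _ "\<lambda>j. p + j" "\<lambda>i. i - p"]) auto
    also have "\<dots> = B s0 (\<Sum>i<DIM('a) - p. component DIM('a) f (p + i) v *\<^sub>R g i)"
      by (simp add: linear_sum[OF linear_B[OF S(2)]] linear_cmul[OF linear_B[OF S(2)]] Bg)
    finally show "B s0 (pull s0 v) = B s0 (\<Sum>i<DIM('a) - p. component DIM('a) f (p + i) v *\<^sub>R g i)" .
  qed
  have tg: "tuple_basis (DIM('a) - p) g"
  proof (rule tuple_basisI)
    fix v
    have "v = (\<Sum>i<DIM('a) - p. component DIM('a) f (p + i) (B s0 v) *\<^sub>R g i)"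
      using pull[of "B s0 v"] by (simp add: pull_B[OF S(2)])
    also have "\<dots> \<in> span (g ` {..<DIM('a) - p})" by (intro span_sum span_scale span_base) auto
    finally show "v \<in> span (g ` {..<DIM('a) - p})" .
  next
    fix c assume "(\<Sum>j<DIM('a) - p. c j *\<^sub>R g j) = 0"
    then have "B s0 (\<Sum>j<DIM('a) - p. c j *\<^sub>R g j) = 0" by (simp add: linear_0[OF linear_B[OF S(2)]])
    then have "(\<Sum>j<DIM('a) - p. c j *\<^sub>R f (p + j)) = 0"
      by (simp add: linear_sum[OF linear_B[OF S(2)]] linear_cmul[OF linear_B[OF S(2)]] Bg)
    moreover have "(\<Sum>j<DIM('a) - p. c j *\<^sub>R f (p + j)) =
        (\<Sum>j<DIM('a). (if j < p then 0 else c (j - p)) *\<^sub>R f j)"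
    proof -
      have "(\<Sum>j<DIM('a). (if j < p then 0 else c (j - p)) *\<^sub>R f j) =
          (\<Sum>j=p..<DIM('a). c (j - p) *\<^sub>R f j)"
        by (intro sum.mono_neutral_cong_right) auto
      also have "\<dots> = (\<Sum>j<DIM('a) - p. c j *\<^sub>R f (p + j))"
        by (rule sum.reindex_bij_witness[of _ "\<lambda>j. p + j" "\<lambda>i. i - p"]) auto
      finally show ?thesis by simp
    qed
    ultimately have z: "(\<Sum>j<DIM('a). (if j < p then 0 else c (j - p)) *\<^sub>R f j) = 0" by simp
    show "\<forall>j<DIM('a) - p. c j = 0"
    proof (intro allI impI)
      fix j assume "j < DIM('a) - p"
      then show "c j = 0"
        using component_sum[OF tb, of "p + j" "\<lambda>j. if j < p then 0 else c (j - p)"] z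
        by (simp add: linear_0[OF linear_component[OF tb]])
    qed
  qed
  have lin: "linear (\<lambda>w. pull s0 (C \<xi> (B s0 w)))"
    using linear_compose[OF linear_compose[OF linear_B[OF S(2)] linear_C] linear_pull[OF S(2)]]
        by (simp add: o_def)
  have "endo_trace (\<lambda>w. pull s0 (C \<xi> (B s0 w))) =
      (\<Sum>i<DIM('a) - p. component DIM('a) f (p + i) (C \<xi> (f (p + i))))"
    unfolding endo_trace_eq[OF tg lin]
    by (intro sum.cong refl) (simp add: Bg pull component_sum[OF tg])
  also have "\<dots> = (\<Sum>i=p..<DIM('a). component DIM('a) f i (C \<xi> (f i)))"
    by (rule sum.reindex_bij_witness[of _ "\<lambda>i. i - p" "\<lambda>j. p + j"]) auto
  also have "\<dots> = (\<Sum>j=d..<DIM('a). component DIM('a) f j (C \<xi> (f j)))"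
  proof (rule sum.mono_neutral_right)
    show "\<forall>i\<in>{p..<DIM('a)} - {d..<DIM('a)}. component DIM('a) f i (C \<xi> (f i)) = 0"
      using component_vertical[OF t f C[OF \<xi> adapted_H[OF t f]]] by auto
  qed (use p_le[OF t] in auto)
  finally show ?thesis .
qed

end

section \<open>Charts and tangent maps\<close>

lemma isCont_eventually_in:
  assumes "isCont f x" "open S" "f x \<in> S"
  shows "\<forall>\<^sub>F y in nhds x. f y \<in> S"
proof -
  have "\<exists>U. open U \<and> x \<in> U \<and> (\<forall>y\<in>U. f y \<in> S)"
    using assms by (simp add: continuous_at_open)
  then show ?thesis by (simp add: eventually_nhds)
qed

lemma has_derivative_cong_nhds:
  assumes "(f has_derivative D) (at x)" "\<forall>\<^sub>F y in nhds x. f y = g y"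
  shows "(g has_derivative D) (at x)"
proof -
  obtain U where "open U" "x \<in> U" "\<forall>y\<in>U. f y = g y" using assms(2) unfolding eventually_nhds
      by blast
  then show ?thesis using has_derivative_transform_within_open[OF assms(1)] by blast
qed

text \<open>\<open>frechet_derivative\<close> is a choice among all derivatives, and equal germs
  have the same derivatives to choose from.\<close>

lemma frechet_derivative_cong_nhds:
  assumes "\<forall>\<^sub>F y in nhds x. f y = g y"
  shows "frechet_derivative f (at x) = frechet_derivative g (at x)"
proof -
  have "(f has_derivative D) (at x) \<longleftrightarrow> (g has_derivative D) (at x)" for D
    using has_derivative_cong_nhds[OF _ assms] has_derivative_cong_nhds[of g D x f] assms
    by (auto simp: eq_commute)
  then show ?thesis by (simp add: frechet_derivative_def)
qed

lemma differentiable_cong_open: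
  assumes "f differentiable (at x)" "open S" "x \<in> S" "\<And>y. y \<in> S \<Longrightarrow> f y = g y"
  shows "g differentiable (at x)"
proof -
  obtain D where "(f has_derivative D) (at x)" using assms(1) unfolding differentiable_def by blast
  from has_derivative_transform_within_open[OF this assms(2-4)] show ?thesis
      by (auto simp: differentiable_def)
qed

definition good_chart :: "('m::topological_space, 'b::real_normed_vector) chart \<Rightarrow> bool" where
  "good_chart c \<longleftrightarrow> open (fst c) \<and> open (snd c ` fst c) \<and> inj_on (snd c) (fst c) \<and>
     homeomorphism (fst c) (snd c ` fst c) (snd c) (chart_inv c)"

lemma good_chart_real: "good_chart (UNIV, id :: real \<Rightarrow> real)"
  unfolding good_chart_def chart_inv_def by (auto simp: homeomorphism_def inv_into_f_f)

context
  fixes c :: "('m::topological_space, 'b::real_normed_vector) chart"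
  assumes c: "good_chart c"
begin

lemma open_domain: "open (fst c)" and open_image: "open (snd c ` fst c)"
  using c by (auto simp: good_chart_def)

lemma chart_inv_chart: "x \<in> fst c \<Longrightarrow> chart_inv c (snd c x) = x"
  using c by (simp add: good_chart_def chart_inv_def)

lemma chart_chart_inv: "y \<in> snd c ` fst c \<Longrightarrow> snd c (chart_inv c y) = y"
  using chart_inv_chart by auto

lemma chart_inv_in: "y \<in> snd c ` fst c \<Longrightarrow> chart_inv c y \<in> fst c"
  using chart_inv_chart by auto

lemma continuous_on_chart_inv: "continuous_on (snd c ` fst c) (chart_inv c)"
  using c by (auto simp: good_chart_def homeomorphism_def)

lemma isCont_chart_inv: "y \<in> snd c ` fst c \<Longrightarrow> isCont (chart_inv c) y"
  using continuous_on_chart_inv open_image continuous_on_eq_continuous_at by blast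

end

lemma smooth_manifold_chart: "smooth_manifold A k \<Longrightarrow> c \<in> A \<Longrightarrow> good_chart c"
  by (simp add: smooth_manifold_def good_chart_def)

lemma chart_at:
  assumes "smooth_manifold A k"
  shows "chart_at A x \<in> A" "x \<in> fst (chart_at A x)"
proof -
  have "x \<in> (\<Union>c\<in>A. fst c)" using assms by (simp add: smooth_manifold_def)
  then have "\<exists>c. c \<in> A \<and> x \<in> fst c" by auto
  from someI_ex[OF this] show "chart_at A x \<in> A" "x \<in> fst (chart_at A x)"
    by (auto simp: chart_at_def)
qed

lemma has_derivative_frechet:
  "f differentiable (at x) \<Longrightarrow> (f has_derivative frechet_derivative f (at x)) (at x)"
  by (simp add: frechet_derivative_works)

lemma smooth_on_differentiable:
  assumes "smooth_on S f" "x \<in> S"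
  shows "f differentiable (at x)"
proof -
  have "times_differentiable_on (Suc 0) S f" using assms(1) by (simp only: smooth_on_def)
  then show ?thesis using assms(2) by simp
qed

lemma transition_differentiable:
  assumes "smooth_manifold A k" "c \<in> A" "c' \<in> A" "x \<in> fst c" "x \<in> fst c'"
  shows "(snd c' \<circ> chart_inv c) differentiable (at (snd c x))"
  using assms by (intro smooth_on_differentiable[of "snd c ` (fst c \<inter> fst c')"])
    (auto simp: smooth_manifold_def)

text \<open>The chain rule with the two transition maps. Continuity of \<open>f\<close> keeps its
  values in the domain of \<open>c'\<close> near \<open>x\<close>, so that the composite is the
  expression in the new charts.\<close>

lemma has_derivative_in_charts:
  assumes A: "smooth_manifold A k" and A': "smooth_manifold A' k'" and f: "isCont f x"
    and c: "c \<in> A" "x \<in> fst c" "c' \<in> A'" "f x \<in> fst c'"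
    and d: "d \<in> A" "x \<in> fst d" "d' \<in> A'" "f x \<in> fst d'"
    and D: "((\<lambda>y. snd c' (f (chart_inv c y))) has_derivative D) (at (snd c x))"
  shows "((\<lambda>y. snd d' (f (chart_inv d y))) has_derivative
      (\<lambda>h. frechet_derivative (snd d' \<circ> chart_inv c') (at (snd c' (f x)))
        (D (frechet_derivative (snd c \<circ> chart_inv d) (at (snd d x)) h)))) (at (snd d x))"
proof -
  note gc = smooth_manifold_chart[OF A c(1)] and gd = smooth_manifold_chart[OF A d(1)]
  note gc' = smooth_manifold_chart[OF A' c(3)] and gd' = smooth_manifold_chart[OF A' d(3)]
  have t1: "((snd c \<circ> chart_inv d) has_derivative frechet_derivative (snd c \<circ> chart_inv d)
      (at (snd d x))) (at (snd d x))"
    by (rule has_derivative_frechet[OF transition_differentiable[OF A d(1) c(1) d(2) c(2)]])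
  have t2: "((snd d' \<circ> chart_inv c') has_derivative frechet_derivative (snd d' \<circ> chart_inv c')
      (at (snd c' (f x)))) (at (snd c' (f x)))"
    by (rule has_derivative_frechet[OF transition_differentiable[OF A' c(3) d(3) c(4) d(4)]])
  have x: "(snd c \<circ> chart_inv d) (snd d x) = snd c x"
    using chart_inv_chart[OF gd d(2)] by simp
  have "((\<lambda>y. snd c' (f (chart_inv c ((snd c \<circ> chart_inv d) y)))) has_derivative
      (\<lambda>h. D (frechet_derivative (snd c \<circ> chart_inv d) (at (snd d x)) h))) (at (snd d x))"
    using D has_derivative_compose[OF t1, of "\<lambda>y. snd c' (f (chart_inv c y))" D] x by simp
  then have *: "((\<lambda>y. (snd d' \<circ> chart_inv c') (snd c'
      (f (chart_inv c ((snd c \<circ> chart_inv d) y))))) has_derivative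
      (\<lambda>h. frechet_derivative (snd d' \<circ> chart_inv c') (at (snd c' (f x)))
        (D (frechet_derivative (snd c \<circ> chart_inv d) (at (snd d x)) h)))) (at (snd d x))"
    using has_derivative_compose[of "\<lambda>y. snd c' (f (chart_inv c ((snd c \<circ> chart_inv d) y)))" _
        "snd d x" UNIV
        "snd d' \<circ> chart_inv c'"] t2 x chart_inv_chart[OF gc c(2)] by simp
  have dx: "snd d x \<in> snd d ` fst d" using d by simp
  have "isCont (chart_inv d) (snd d x)" using isCont_chart_inv[OF gd dx] .
  then have c1: "isCont (\<lambda>y. f (chart_inv d y)) (snd d x)"
    using f chart_inv_chart[OF gd d(2)] isCont_o2[of "snd d x" "chart_inv d" f] by simp
  have "\<forall>\<^sub>F y in nhds (snd d x). y \<in> snd d ` fst d"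
    using open_image[OF gd] dx by (rule eventually_nhds_in_open)
  moreover have "\<forall>\<^sub>F y in nhds (snd d x). chart_inv d y \<in> fst c"
    using isCont_eventually_in[OF isCont_chart_inv[OF gd dx] open_domain[OF gc]] c(2)
        chart_inv_chart[OF gd d(2)]
    by simp
  moreover have "\<forall>\<^sub>F y in nhds (snd d x). f (chart_inv d y) \<in> fst c'"
    using isCont_eventually_in[OF c1 open_domain[OF gc']] c(4) chart_inv_chart[OF gd d(2)] by simp
  ultimately have "\<forall>\<^sub>F y in nhds (snd d x).
      (snd d' \<circ> chart_inv c') (snd c' (f (chart_inv c ((snd c \<circ> chart_inv d) y)))) = snd d'
          (f (chart_inv d y))"
    by eventually_elim (simp add: chart_inv_chart[OF gc] chart_inv_chart[OF gc'])
  then show ?thesis by (rule has_derivative_cong_nhds[OF *])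
qed

context
  fixes A :: "('m::{t2_space,second_countable_topology}, 'b::real_normed_vector) atlas" and k :: nat
  assumes A: "smooth_manifold A k"
begin

lemma has_derivative_coord:
  assumes "c \<in> A" "x \<in> fst c"
  shows "((snd c \<circ> chart_inv (chart_at A x)) has_derivative coord A c x)
      (at (snd (chart_at A x) x))"
    and "((snd (chart_at A x) \<circ> chart_inv c) has_derivative uncoord A c x) (at (snd c x))"
  unfolding coord_def uncoord_def using assms chart_at[OF A, of x]
  by (auto intro!: has_derivative_frechet transition_differentiable[OF A] simp: comp_def[symmetric])

lemma linear_uncoord: "c \<in> A \<Longrightarrow> x \<in> fst c \<Longrightarrow> linear (uncoord A c x)"
  using has_derivative_coord(2) has_derivative_linear by blast

lemma has_derivative_chart_inverse:
  assumes "c \<in> A" "x \<in> fst c"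
  shows "((\<lambda>y. snd c (id (chart_inv c y))) has_derivative id) (at (snd c x))"
  by (rule has_derivative_transform_within_open[OF has_derivative_id[unfolded id_def[symmetric]]
      open_image[OF smooth_manifold_chart[OF A assms(1)]]])
    (use assms in \<open>auto simp: chart_inv_chart[OF smooth_manifold_chart[OF A assms(1)]]\<close>)

text \<open>The identity map has the identity as derivative in the chart \<open>d\<close>; computing
  the same derivative by way of \<open>c\<close> gives the composite of the two transition
  derivatives.\<close>

lemma coord_transition:
  assumes c: "c \<in> A" "x \<in> fst c" and d: "d \<in> A" "x \<in> fst d"
  shows "frechet_derivative (snd d \<circ> chart_inv c) (at (snd c x))
      (frechet_derivative (snd c \<circ> chart_inv d) (at (snd d x)) h) = h"
proof -
  have i: "isCont id x" by (simp add: id_def)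
  have "((\<lambda>y. snd d (id (chart_inv d y))) has_derivative
     (\<lambda>h. frechet_derivative (snd d \<circ> chart_inv c) (at (snd c (id x)))
        (id (frechet_derivative (snd c \<circ> chart_inv d) (at (snd d x)) h)))) (at (snd d x))"
    using c d by (intro has_derivative_in_charts[OF A A i c _ _ d] has_derivative_chart_inverse)
        auto
  from fun_cong[OF has_derivative_unique[OF this has_derivative_chart_inverse[OF d]], of h]
  show ?thesis by simp
qed

lemma uncoord_coord: "c \<in> A \<Longrightarrow> x \<in> fst c \<Longrightarrow> uncoord A c x (coord A c x v) = v"
  and coord_uncoord: "c \<in> A \<Longrightarrow> x \<in> fst c \<Longrightarrow> coord A c x (uncoord A c x v) = v"
  unfolding coord_def uncoord_def using chart_at[OF A, of x] by (auto intro: coord_transition)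

lemma coord_chart_at: "coord A (chart_at A x) x = id" "uncoord A (chart_at A x) x = id"
  using has_derivative_unique[OF has_derivative_coord(1)[OF chart_at[OF A]]
      has_derivative_chart_inverse[OF chart_at[OF A], unfolded id_apply o_def[symmetric]]]
    has_derivative_unique[OF has_derivative_coord(2)[OF chart_at[OF A]]
        has_derivative_chart_inverse[OF chart_at[OF A], unfolded id_apply o_def[symmetric]]]
  by (auto simp: comp_def)

end

text \<open>Continuity is a separate condition: chart maps are total functions with arbitrary values
  off their domains, so differentiability of the chart expression does not keep \<open>f\<close>
  inside the target chart.\<close>

definition mdiff ::
  "('m::t2_space, 'b::real_normed_vector) atlas \<Rightarrow> ('n::t2_space, 'c::real_normed_vector) atlas \<Rightarrow>
   ('m \<Rightarrow> 'n) \<Rightarrow> 'm \<Rightarrow> bool" where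
  "mdiff A A' f x \<longleftrightarrow> isCont f x \<and>
     (\<lambda>y. snd (chart_at A' (f x)) (f (chart_inv (chart_at A x) y))) differentiable
         (at (snd (chart_at A x) x))"

context
  fixes A :: "('m::{t2_space,second_countable_topology}, 'b::real_normed_vector) atlas" and k :: nat
    and A' :: "('n::{t2_space,second_countable_topology}, 'c::real_normed_vector) atlas" and k'
        :: nat
  assumes A: "smooth_manifold A k" and A': "smooth_manifold A' k'"
begin

lemma tangent_map_in_charts:
  assumes f: "isCont f x" and c: "c \<in> A" "x \<in> fst c" "c' \<in> A'" "f x \<in> fst c'"
    and D: "((\<lambda>y. snd c' (f (chart_inv c y))) has_derivative D) (at (snd c x))"
  shows "mdiff A A' f x" "tangent_map A A' f x v = uncoord A' c' (f x) (D (coord A c x v))"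
proof -
  note d = has_derivative_in_charts[OF A A' f c chart_at[OF A] chart_at[OF A'] D]
  show "mdiff A A' f x" using d f by (auto simp: mdiff_def differentiable_def)
  show "tangent_map A A' f x v = uncoord A' c' (f x) (D (coord A c x v))"
    using frechet_derivative_at[OF d, symmetric]
    by (simp add: tangent_map_def comp_def uncoord_def coord_def)
qed

lemma has_derivative_tangent_map:
  assumes f: "mdiff A A' f x" and c: "c \<in> A" "x \<in> fst c" "c' \<in> A'" "f x \<in> fst c'"
  shows "((\<lambda>y. snd c' (f (chart_inv c y))) has_derivative
      (\<lambda>h. coord A' c' (f x) (tangent_map A A' f x (uncoord A c x h)))) (at (snd c x))"
proof -
  have f': "isCont f x" using f by (simp add: mdiff_def)
  have "((\<lambda>y. snd (chart_at A' (f x)) (f (chart_inv (chart_at A x) y))) has_derivative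
      tangent_map A A' f x)
      (at (snd (chart_at A x) x))"
    using f has_derivative_frechet unfolding mdiff_def tangent_map_def comp_def by blast
  from has_derivative_in_charts[OF A A' f' chart_at[OF A] chart_at[OF A'] c this]
  show ?thesis by (simp add: coord_def uncoord_def)
qed

lemma linear_tangent_map: "mdiff A A' f x \<Longrightarrow> linear (tangent_map A A' f x)"
  unfolding mdiff_def tangent_map_def comp_def using has_derivative_frechet has_derivative_linear
      by blast

end

lemma tangent_map_compose:
  assumes A: "smooth_manifold A k" and A': "smooth_manifold A' k'" and A'':
      "smooth_manifold A'' k''"
    and f: "mdiff A A' f x" and g: "mdiff A' A'' g (f x)"
  shows "mdiff A A'' (\<lambda>x. g (f x)) x"
    and "tangent_map A A'' (\<lambda>x. g (f x)) x v = tangent_map A' A'' g (f x) (tangent_map A A' f x v)"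
proof -
  let ?c = "chart_at A x" and ?c' = "chart_at A' (f x)" and ?c'' = "chart_at A'' (g (f x))"
  have cont: "isCont f x" "isCont g (f x)" using f g by (auto simp: mdiff_def)
  then have gf: "isCont (\<lambda>x. g (f x)) x" by (rule isCont_o2)
  note gc = smooth_manifold_chart[OF A chart_at(1)[OF A]] and gc' =
      smooth_manifold_chart[OF A' chart_at(1)[OF A']]
  have x: "chart_inv ?c (snd ?c x) = x" using chart_inv_chart[OF gc chart_at(2)[OF A]] .
  have "((\<lambda>y. snd ?c'' (g (chart_inv ?c' (snd ?c' (f (chart_inv ?c y)))))) has_derivative
      (\<lambda>h. tangent_map A' A'' g (f x) (tangent_map A A' f x h))) (at (snd ?c x))"
    using has_derivative_compose[OF has_derivative_tangent_map[OF A A' f chart_at[OF A]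
        chart_at[OF A']],
        of "\<lambda>y. snd ?c'' (g (chart_inv ?c' y))"]
      has_derivative_tangent_map[OF A' A'' g chart_at[OF A'] chart_at[OF A'']]
    by (simp add: x coord_chart_at[OF A] coord_chart_at[OF A'] coord_chart_at[OF A''])
  moreover have "\<forall>\<^sub>F y in nhds (snd ?c x). f (chart_inv ?c y) \<in> fst ?c'"
  proof (rule isCont_eventually_in)
    have "isCont (chart_inv ?c) (snd ?c x)" using isCont_chart_inv[OF gc] chart_at(2)[OF A] by blast
    then show "isCont (\<lambda>y. f (chart_inv ?c y)) (snd ?c x)"
      using isCont_o2[of "snd ?c x" "chart_inv ?c" f] cont x by simp
  qed (use chart_at(2)[OF A'] open_domain[OF gc'] x in auto)
  then have "\<forall>\<^sub>F y in nhds (snd ?c x). snd ?c'' (g (chart_inv ?c' (snd ?c' (f (chart_inv ?c y)))))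
      = snd ?c'' (g (f (chart_inv ?c y)))"
    by eventually_elim (simp add: chart_inv_chart[OF gc'])
  ultimately have D: "((\<lambda>y. snd ?c'' (g (f (chart_inv ?c y)))) has_derivative
      (\<lambda>h. tangent_map A' A'' g (f x) (tangent_map A A' f x h))) (at (snd ?c x))"
    by (rule has_derivative_cong_nhds)
  show "mdiff A A'' (\<lambda>x. g (f x)) x"
    "tangent_map A A'' (\<lambda>x. g (f x)) x v = tangent_map A' A'' g (f x) (tangent_map A A' f x v)"
    using tangent_map_in_charts[OF A A'' gf chart_at[OF A] chart_at[OF A''] D]
    by (auto simp: coord_chart_at[OF A] coord_chart_at[OF A''])
qed

lemma tangent_map_ident:
  assumes A: "smooth_manifold A k"
  shows "tangent_map A A (\<lambda>x. x) x v = v"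
proof -
  have "isCont (\<lambda>x. x) x" by simp
  moreover have "((\<lambda>y. snd (chart_at A x) (chart_inv (chart_at A x) y)) has_derivative id)
      (at (snd (chart_at A x) x))"
    using has_derivative_chart_inverse[OF A chart_at[OF A]] by simp
  ultimately show ?thesis
    using tangent_map_in_charts(2)[OF A A, where f = "\<lambda>x. x", OF _ chart_at[OF A] chart_at[OF A]]
    by (simp add: coord_chart_at[OF A])
qed

lemma chart_at_real: "chart_at real_atlas t = (UNIV, id)"
  unfolding chart_at_def real_atlas_def by (rule some_equality) auto

lemma chart_inv_real: "chart_inv (UNIV, id) = (id :: real \<Rightarrow> real)"
  by (simp add: chart_inv_def fun_eq_iff inv_id)

text \<open>The first order gives tangent maps, the second the derivatives of invariant frames and
  of the pulled-back Maurer-Cartan form.\<close>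

definition twice_differentiable_on :: "'a::real_normed_vector set \<Rightarrow> ('a \<Rightarrow> 'c::real_normed_vector)
    \<Rightarrow> bool" where
  "twice_differentiable_on S f \<longleftrightarrow>
     (\<forall>x\<in>S. f differentiable (at x) \<and> (\<forall>v. (\<lambda>y. frechet_derivative f (at y) v) differentiable
         (at x)))"

lemma twice_differentiable_onD:
  assumes "twice_differentiable_on S f" "x \<in> S"
  shows "(f has_derivative frechet_derivative f (at x)) (at x)"
    "(\<lambda>y. frechet_derivative f (at y) v) differentiable (at x)"
  using assms by (auto simp: twice_differentiable_on_def frechet_derivative_works)

lemma smooth_on_twice_differentiable:
  assumes "smooth_on S f"
  shows "twice_differentiable_on S f"
proof -
  have "times_differentiable_on (Suc (Suc 0)) S f" using assms by (simp only: smooth_on_def)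
  then show ?thesis by (simp add: twice_differentiable_on_def)
qed

lemma twice_differentiable_on_cong:
  assumes f: "twice_differentiable_on S f" and S: "open S" and eq: "\<And>x. x \<in> S \<Longrightarrow> f x = g x"
  shows "twice_differentiable_on S g"
proof -
  have d: "(g has_derivative frechet_derivative f (at x)) (at x)" if "x \<in> S" for x
    using has_derivative_transform_within_open[OF twice_differentiable_onD(1)[OF f that] S that
        eq] .
  then have fd: "frechet_derivative f (at x) = frechet_derivative g (at x)" if "x \<in> S" for x
    using that frechet_derivative_at by blast
  have "(\<lambda>y. frechet_derivative g (at y) v) differentiable (at x)" if x: "x \<in> S" for x v
  proof -
    obtain D where D: "((\<lambda>y. frechet_derivative f (at y) v) has_derivative D) (at x)"
      using twice_differentiable_onD(2)[OF f x] unfolding differentiable_def by blast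
    have "((\<lambda>y. frechet_derivative g (at y) v) has_derivative D) (at x)"
      by (rule has_derivative_transform_within_open[OF D S x]) (simp add: fd)
    then show ?thesis by (rule differentiableI)
  qed
  then show ?thesis using d differentiableI unfolding twice_differentiable_on_def by blast
qed

definition chart_domain2 ::
  "('m, 'b) chart \<Rightarrow> ('n, 'c) chart \<Rightarrow> ('o, 'd) chart \<Rightarrow> ('m \<times> 'n) set \<Rightarrow> ('m \<times> 'n \<Rightarrow> 'o) \<Rightarrow> ('b \<times> 'c)
      set" where
  "chart_domain2 c c' c'' S f = {(y, z). y \<in> snd c ` fst c \<and> z \<in> snd c' ` fst c' \<and>
     (chart_inv c y, chart_inv c' z) \<in> S \<and> f (chart_inv c y, chart_inv c' z) \<in> fst c''}"

lemma smooth_map_prod_charts: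
  fixes c :: "('m::topological_space, 'b::real_normed_vector) chart"
    and c' :: "('n::topological_space, 'c::real_normed_vector) chart"
    and c'' :: "('o::topological_space, 'd::real_normed_vector) chart"
  assumes f: "smooth_map (prod_atlas A A') A'' S f" and S: "open S"
    and c: "c \<in> A" "good_chart c" and c': "c' \<in> A'" "good_chart c'" and c'': "c'' \<in> A''"
        "good_chart c''"
  shows "open (chart_domain2 c c' c'' S f)"
    and "twice_differentiable_on (chart_domain2 c c' c'' S f)
        (\<lambda>(y, z). snd c'' (f (chart_inv c y, chart_inv c' z)))"
proof -
  let ?pc = "(fst c \<times> fst c', map_prod (snd c) (snd c'))"
  let ?O = "chart_domain2 c c' c'' S f"
  let ?g = "\<lambda>p. (chart_inv c (fst p), chart_inv c' (snd p))"
  let ?I = "(snd c ` fst c) \<times> (snd c' ` fst c')"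
  have "continuous_on ?I ?g"
    by (intro continuous_on_Pair continuous_on_compose2[OF continuous_on_chart_inv[OF c(2)]
        continuous_on_fst]
        continuous_on_compose2[OF continuous_on_chart_inv[OF c'(2)] continuous_on_snd]
            continuous_on_id) auto
  moreover have "open ?I" using open_image[OF c(2)] open_image[OF c'(2)] by (rule open_Times)
  moreover have "open (f -` fst c'' \<inter> S)"
    using f S open_domain[OF c''(2)] continuous_on_open_vimage[OF S] by (auto simp: smooth_map_def)
  ultimately have "open (?g -` (f -` fst c'' \<inter> S) \<inter> ?I)"
    using continuous_on_open_vimage by blast
  moreover have "?g -` (f -` fst c'' \<inter> S) \<inter> ?I = ?O"
    by (auto simp: chart_domain2_def)
  ultimately show op: "open ?O" by simp
  have inj: "inj_on (map_prod (snd c) (snd c')) (fst c \<times> fst c')"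
    using c(2) c'(2) by (auto simp: good_chart_def inj_on_def)
  \<comment> \<open>\<open>chart_inv\<close> is an \<open>inv_into\<close>, so it is the pair of the
    two inverses only over the image of the product chart.\<close>
  have inv: "chart_inv ?pc (y, z) = (chart_inv c y, chart_inv c' z)" if "y \<in> snd c ` fst c"
      "z \<in> snd c' ` fst c'" for y z
    unfolding chart_inv_def[of ?pc] fst_conv snd_conv
    by (rule inv_into_f_eq[OF inj])
      (use that in \<open>auto simp: chart_inv_in[OF c(2)] chart_inv_in[OF c'(2)]
          chart_chart_inv[OF c(2)] chart_chart_inv[OF c'(2)]
         chart_inv_chart[OF c(2)] chart_inv_chart[OF c'(2)]\<close>)
  have set: "map_prod (snd c) (snd c') ` (fst c \<times> fst c' \<inter> S \<inter> f -` fst c'') = ?O"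
  proof (intro equalityI subsetI)
    fix q assume "q \<in> map_prod (snd c) (snd c') ` (fst c \<times> fst c' \<inter> S \<inter> f -` fst c'')"
    then show "q \<in> ?O"
      by (auto simp: chart_domain2_def chart_inv_chart[OF c(2)] chart_inv_chart[OF c'(2)])
  next
    fix q assume "q \<in> ?O"
    then obtain y z where q: "q = (y, z)" "y \<in> snd c ` fst c" "z \<in> snd c' ` fst c'"
      "(chart_inv c y, chart_inv c' z) \<in> S" "f (chart_inv c y, chart_inv c' z) \<in> fst c''"
      by (auto simp: chart_domain2_def)
    show "q \<in> map_prod (snd c) (snd c') ` (fst c \<times> fst c' \<inter> S \<inter> f -` fst c'')"
      by (rule image_eqI[of _ _ "(chart_inv c y, chart_inv c' z)"])
        (use q in \<open>simp_all add: chart_inv_in[OF c(2)] chart_inv_in[OF c'(2)]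
            chart_chart_inv[OF c(2)] chart_chart_inv[OF c'(2)]\<close>)
  qed
  have "?pc \<in> prod_atlas A A'" using c c' unfolding prod_atlas_def by blast
  then have "smooth_on (map_prod (snd c) (snd c') ` (fst c \<times> fst c' \<inter> S \<inter> f -` fst c''))
      (snd c'' \<circ> f \<circ> chart_inv ?pc)"
    using f c'' unfolding smooth_map_def by fastforce
  then have "twice_differentiable_on ?O (snd c'' \<circ> f \<circ> chart_inv ?pc)"
    unfolding set by (rule smooth_on_twice_differentiable)
  then show "twice_differentiable_on ?O (\<lambda>(y, z). snd c'' (f (chart_inv c y, chart_inv c' z)))"
    by (rule twice_differentiable_on_cong[OF _ op]) (auto simp: chart_domain2_def inv)
qed

lemma partial_derivative_snd:
  assumes "(f has_derivative D) (at (y, z))"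
  shows "((\<lambda>z. f (y, z)) has_derivative (\<lambda>h. D (0, h))) (at z)"
proof -
  have "((\<lambda>z. (y, z)) has_derivative (\<lambda>h. (0, h))) (at z)" by (auto intro!: derivative_eq_intros)
  from has_derivative_compose[OF this, of f D] assms show ?thesis by simp
qed

section \<open>The Maurer-Cartan form of the group\<close>

locale sub_riemannian_group =
  fixes G :: "('g::{t2_space,second_countable_topology}, 'a::euclidean_space) stratified_group"
  assumes G: "sub_riemannian_stratified_group G"
begin

abbreviation "M \<equiv> charts G"

lemma manifold: "smooth_manifold M DIM('a)"
  using G by (simp add: sub_riemannian_stratified_group_def lie_group_def)

lemma group: "group (mul G) (unt G) (ginv G)"
  using G by (simp add: sub_riemannian_stratified_group_def lie_group_def)

sublocale grp: group "mul G" "unt G" "ginv G"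
  by (rule group)

lemma smooth_mul: "smooth_map (prod_atlas M M) M UNIV (\<lambda>(x, y). mul G x y)"
  and smooth_inv: "smooth_map M M UNIV (ginv G)"
  using G by (simp_all add: sub_riemannian_stratified_group_def lie_group_def)

lemma good: "c \<in> M \<Longrightarrow> good_chart c"
  by (rule smooth_manifold_chart[OF manifold])

lemma chart_in: "chart_at M g \<in> M" "g \<in> fst (chart_at M g)"
  by (rule chart_at[OF manifold])+

lemma good_at: "good_chart (chart_at M g)"
  by (rule good[OF chart_in(1)])

lemma isCont_mul: "isCont (mul G g) h"
proof -
  have "continuous_on UNIV (\<lambda>(x, y). mul G x y)" using smooth_mul by (simp add: smooth_map_def)
  then have "continuous_on UNIV (\<lambda>y. (\<lambda>(x, y). mul G x y) (g, y))"
    by (rule continuous_on_compose2) (auto intro!: continuous_intros)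
  then show ?thesis by (simp add: continuous_on_eq_continuous_at)
qed

definition mul_chart :: "('g, 'a) chart \<Rightarrow> ('g, 'a) chart \<Rightarrow> ('g, 'a) chart \<Rightarrow> 'a \<times> 'a \<Rightarrow> 'a" where
  "mul_chart c c' c'' = (\<lambda>(y, z). snd c'' (mul G (chart_inv c y) (chart_inv c' z)))"

definition mul_domain :: "('g, 'a) chart \<Rightarrow> ('g, 'a) chart \<Rightarrow> ('g, 'a) chart \<Rightarrow> ('a \<times> 'a) set" where
  "mul_domain c c' c'' = {(y, z). y \<in> snd c ` fst c \<and> z \<in> snd c' ` fst c' \<and>
     mul G (chart_inv c y) (chart_inv c' z) \<in> fst c''}"

lemma mul_in_charts:
  assumes "c \<in> M" "c' \<in> M" "c'' \<in> M"
  shows "open (mul_domain c c' c'')" "twice_differentiable_on (mul_domain c c' c'')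
      (mul_chart c c' c'')"
  using smooth_map_prod_charts[OF smooth_mul open_UNIV assms(1) good[OF assms(1)] assms(2)
      good[OF assms(2)]
      assms(3) good[OF assms(3)]]
  by (simp_all add: mul_domain_def mul_chart_def chart_domain2_def)

lemma has_derivative_mul:
  assumes c: "c \<in> M" "c' \<in> M" "c'' \<in> M" and g: "g \<in> fst c" "h \<in> fst c'" "mul G g h \<in> fst c''"
  shows "((\<lambda>z. snd c'' (mul G g (chart_inv c' z))) has_derivative
     (\<lambda>v. frechet_derivative (mul_chart c c' c'') (at (snd c g, snd c' h)) (0, v))) (at (snd c' h))"
proof -
  have "(snd c g, snd c' h) \<in> mul_domain c c' c''"
    using g chart_inv_chart[OF good[OF c(1)]] chart_inv_chart[OF good[OF c(2)]]
        by (auto simp: mul_domain_def)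
  from partial_derivative_snd[OF twice_differentiable_onD(1)[OF mul_in_charts(2)[OF c] this]]
  show ?thesis using g chart_inv_chart[OF good[OF c(1)]] by (simp add: mul_chart_def)
qed

lemma mdiff_mul: "mdiff M M (mul G g) h"
  by (rule tangent_map_in_charts(1)[OF manifold manifold isCont_mul chart_in chart_in
        has_derivative_mul[OF chart_in(1) chart_in(1) chart_in(1) chart_in(2) chart_in(2)
            chart_in(2)]])

lemma tangent_map_mul:
  assumes c: "c \<in> M" "c' \<in> M" "c'' \<in> M" and g: "g \<in> fst c" "h \<in> fst c'" "mul G g h \<in> fst c''"
  shows "tangent_map M M (mul G g) h v = uncoord M c'' (mul G g h)
    (frechet_derivative (mul_chart c c' c'') (at (snd c g, snd c' h)) (0, coord M c' h v))"
  by (rule tangent_map_in_charts(2)[OF manifold manifold isCont_mul c(2) g(2) c(3) g(3)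
      has_derivative_mul[OF c g]])

lemma tangent_map_mul_mul:
  "tangent_map M M (mul G g) (mul G h x) (tangent_map M M (mul G h) x v) = tangent_map M M
      (mul G (mul G g h)) x v"
proof -
  have "(\<lambda>x. mul G g (mul G h x)) = mul G (mul G g h)" by (simp add: fun_eq_iff grp.assoc)
  then show ?thesis
    using tangent_map_compose(2)[OF manifold manifold manifold mdiff_mul mdiff_mul,
        where x = x and v = v, of g h] by simp
qed

lemma tangent_map_unit: "tangent_map M M (mul G (unt G)) x v = v"
proof -
  have "mul G (unt G) = (\<lambda>x. x)" by (simp add: fun_eq_iff grp.group_left_neutral)
  then show ?thesis by (simp add: tangent_map_ident[OF manifold])
qed

text \<open>The inner product of the type \<open>'a\<close> is unrelated to \<open>ip G\<close>. It
  serves as a fixed Euclidean model, in which \<open>e\<close> will represent the left-invariant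
  frame at every point.\<close>

definition e :: "nat \<Rightarrow> 'a" where "e = from_nat_into Basis"

lemma bij_e: "bij_betw e {..<DIM('a)} Basis"
  unfolding e_def by (rule bij_betw_from_nat_into_finite) simp

lemma orthonormal_e: "i < DIM('a) \<Longrightarrow> j < DIM('a) \<Longrightarrow> e i \<bullet> e j = (if i = j then 1 else 0)"
proof -
  assume ij: "i < DIM('a)" "j < DIM('a)"
  then have "e i \<in> Basis" "e j \<in> Basis" using bij_e by (auto simp: bij_betw_def)
  moreover have "e i = e j \<longleftrightarrow> i = j" using bij_e ij by (auto simp: bij_betw_def inj_on_def)
  ultimately show ?thesis by (simp add: inner_Basis)
qed

sublocale frame_space e "hdim G"
  by unfold_locales (auto simp: orthonormal_e dim_subset_UNIV)

lemma e_expansion: "v = (\<Sum>j<DIM('a). (v \<bullet> e j) *\<^sub>R e j)"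
  by (rule orthonormal_expansion[OF orthonormal]) (simp_all add: span_e)

lemma linear_ip: "linear (ip G v)" and ip_commute: "ip G v w = ip G w v"
  using G by (auto simp: sub_riemannian_stratified_group_def)

lemma ip_bas: "i < DIM('a) \<Longrightarrow> j < DIM('a) \<Longrightarrow> ip G (bas G i) (bas G j) = (if i = j then 1 else 0)"
  using G by (auto simp: sub_riemannian_stratified_group_def orthonormal_adapted_def)

lemma bas_basis: "tuple_basis DIM('a) (bas G)"
proof (rule tuple_basis_DIM)
  have ind: "\<forall>i<DIM('a). c i = 0" if "(\<Sum>j<DIM('a). c j *\<^sub>R bas G j) = 0" for c
  proof (intro allI impI)
    fix i assume i: "i < DIM('a)"
    have "ip G (bas G i) (\<Sum>j<DIM('a). c j *\<^sub>R bas G j) = (\<Sum>j<DIM('a). if j = i then c j else 0)"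
      unfolding linear_sum[OF linear_ip] linear_cmul[OF linear_ip]
      using i by (intro sum.cong) (auto simp: ip_bas)
    then show "c i = 0" using that i by (simp add: linear_0[OF linear_ip])
  qed
  have inj: "inj_on (bas G) {..<DIM('a)}"
  proof (rule inj_onI)
    fix i j assume "i \<in> {..<DIM('a)}" "j \<in> {..<DIM('a)}" "bas G i = bas G j"
    then show "i = j" using ip_bas[of i j] ip_bas[of i i] by (auto split: if_splits)
  qed
  have "independent (bas G ` {..<DIM('a)})"
  proof (rule independent_if_scalars_zero)
    fix f x assume f: "(\<Sum>x\<in>bas G ` {..<DIM('a)}. f x *\<^sub>R x) = 0" and x: "x \<in> bas G ` {..<DIM('a)}"
    have "(\<Sum>j<DIM('a). f (bas G j) *\<^sub>R bas G j) = 0" using f inj by (simp add: sum.reindex)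
    then show "f x = 0" using ind[of "f \<circ> bas G"] x by auto
  qed simp
  then show "span (bas G ` {..<DIM('a)}) = UNIV"
    using card_eq_dim[of "bas G ` {..<DIM('a)}" UNIV] inj by (auto simp: card_image dim_UNIV)
qed

text \<open>The linear isometry from the Lie algebra with \<open>ip G\<close> to the model that
  takes \<open>bas G\<close> to \<open>e\<close>.\<close>

definition \<phi> :: "'a \<Rightarrow> 'a" where
  "\<phi> v = (\<Sum>i<DIM('a). ip G (bas G i) v *\<^sub>R e i)"

lemma linear_\<phi>: "linear \<phi>"
  unfolding \<phi>_def[abs_def] using linear_ip
  by (intro linear_compose_sum ballI linearI) (auto simp: linear_add linear_cmul scaleR_add_left)

lemma \<phi>_bas: "j < DIM('a) \<Longrightarrow> \<phi> (bas G j) = e j"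
proof -
  assume j: "j < DIM('a)"
  have "\<phi> (bas G j) = (\<Sum>i<DIM('a). if i = j then e i else 0)"
    unfolding \<phi>_def using j by (intro sum.cong) (auto simp: ip_bas)
  then show ?thesis using j by simp
qed

lemma \<phi>_e: "j < DIM('a) \<Longrightarrow> \<phi> v \<bullet> e j = ip G (bas G j) v"
proof -
  assume j: "j < DIM('a)"
  have "\<phi> v \<bullet> e j = (\<Sum>i<DIM('a). if i = j then ip G (bas G i) v else 0)"
    unfolding \<phi>_def inner_sum_left using j by (intro sum.cong) (auto simp: orthonormal)
  then show ?thesis using j by simp
qed

lemma inner_\<phi>: "\<phi> v \<bullet> \<phi> w = ip G v w"
proof -
  have "\<phi> v \<bullet> \<phi> w = (\<Sum>i<DIM('a). ip G (bas G i) v * (e i \<bullet> \<phi> w))"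
    by (simp add: \<phi>_def[of v] inner_sum_left)
  also have "\<dots> = (\<Sum>i<DIM('a). component DIM('a) (bas G) i v * ip G w (bas G i))"
  proof (intro sum.cong refl)
    fix i assume i: "i \<in> {..<DIM('a)}"
    have "ip G (bas G i) v = ip G (bas G i) (\<Sum>j<DIM('a). component DIM('a) (bas G) j v *\<^sub>R bas G j)"
      by (simp add: sum_component[OF bas_basis])
    also have "\<dots> = (\<Sum>j<DIM('a). if j = i then component DIM('a) (bas G) j v else 0)"
      unfolding linear_sum[OF linear_ip] linear_cmul[OF linear_ip]
      using i by (intro sum.cong) (auto simp: ip_bas)
    finally have "ip G (bas G i) v = component DIM('a) (bas G) i v" using i by simp
    then show "ip G (bas G i) v * (e i \<bullet> \<phi> w) = component DIM('a) (bas G) i v * ip G w (bas G i)"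
      using i \<phi>_e[of i w] by (simp add: inner_commute ip_commute)
  qed
  also have "\<dots> = ip G w (\<Sum>i<DIM('a). component DIM('a) (bas G) i v *\<^sub>R bas G i)"
    by (simp add: linear_sum[OF linear_ip] linear_cmul[OF linear_ip])
  finally show ?thesis by (simp add: sum_component[OF bas_basis] ip_commute)
qed

lemma inj_\<phi>: "inj \<phi>"
proof (rule linear_injective_0[OF linear_\<phi>, THEN iffD2], intro allI impI)
  fix v assume "\<phi> v = 0"
  then have "ip G v v = 0" using inner_\<phi>[of v v] by simp
  then show "v = 0" using G unfolding sub_riemannian_stratified_group_def by (metis less_irrefl)
qed

text \<open>The Maurer-Cartan form read in the model. It is an isometry from every tangent space of
  the group, so that vectors at different points can be compared and differentiated.\<close>

definition \<kappa> :: "'g \<Rightarrow> 'a \<Rightarrow> 'a" where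
  "\<kappa> g v = \<phi> (tangent_map M M (mul G (ginv G g)) g v)"

lemma linear_\<kappa>: "linear (\<kappa> g)"
  using linear_compose[OF linear_tangent_map[OF manifold manifold mdiff_mul] linear_\<phi>]
  by (simp add: \<kappa>_def[abs_def] o_def)

lemma \<kappa>_left_field: "\<kappa> g (left_field G v g) = \<phi> v"
proof -
  have "tangent_map M M (mul G (ginv G g)) (mul G g (unt G))
      (tangent_map M M (mul G g) (unt G) v) = v"
    unfolding tangent_map_mul_mul by (simp add: grp.left_inverse tangent_map_unit)
  then show ?thesis by (simp add: \<kappa>_def left_field_def grp.right_neutral)
qed

lemma \<kappa>_frame: "j < DIM('a) \<Longrightarrow> \<kappa> g (frame G g j) = e j"
  by (simp add: frame_def \<kappa>_left_field \<phi>_bas)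

lemma \<kappa>_mul: "\<kappa> (mul G a g) (tangent_map M M (mul G a) g v) = \<kappa> g v"
proof -
  have "mul G (ginv G (mul G a g)) a = ginv G g"
    by (metis grp.assoc grp.inverse_distrib_swap grp.left_inverse grp.right_neutral)
  then show ?thesis by (simp add: \<kappa>_def tangent_map_mul_mul)
qed

lemma inj_\<kappa>: "inj (\<kappa> g)"
proof (rule injI)
  fix v w assume "\<kappa> g v = \<kappa> g w"
  then have "tangent_map M M (mul G (ginv G g)) g v = tangent_map M M (mul G (ginv G g)) g w"
    using inj_\<phi> by (simp add: \<kappa>_def inj_eq)
  then have "tangent_map M M (mul G g) (mul G (ginv G g) g)
      (tangent_map M M (mul G (ginv G g)) g v) =
      tangent_map M M (mul G g) (mul G (ginv G g) g)
          (tangent_map M M (mul G (ginv G g)) g w)" by simp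
  then show "v = w" unfolding tangent_map_mul_mul by (simp add: grp.right_inverse tangent_map_unit)
qed

lemma bij_\<kappa>: "bij (\<kappa> g)"
  unfolding bij_def by (intro conjI inj_\<kappa> linear_injective_imp_surjective linear_\<kappa>) simp

lemma metric_\<kappa>: "metric G g v w = \<kappa> g v \<bullet> \<kappa> g w"
  by (simp add: metric_def Let_def \<kappa>_def inner_\<phi>)

lemma layer_indices_1: "layer_indices G 1 = {..<hdim G}"
  by (auto simp: layer_indices_def)

lemma step_ge_1: "1 \<le> step G"
  using G by (simp add: sub_riemannian_stratified_group_def stratified_def)

lemma span_bas_layer: "span (bas G ` {..<hdim G}) = layer G 1"
  using G step_ge_1 unfolding sub_riemannian_stratified_group_def orthonormal_adapted_def
      layer_indices_1[symmetric]
  by simp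

lemma \<kappa>_horizontal: "\<kappa> g ` horizontal G g = H"
proof -
  have "\<kappa> g ` horizontal G g = \<phi> ` layer G 1"
    by (simp add: horizontal_def image_image \<kappa>_left_field)
  also have "\<dots> = span (\<phi> ` bas G ` {..<hdim G})"
    by (simp only: linear_span_image[OF linear_\<phi>] span_bas_layer)
  also have "\<phi> ` bas G ` {..<hdim G} = e ` {..<hdim G}"
    using d_le by (auto simp: image_image \<phi>_bas intro!: image_cong)
  finally show ?thesis unfolding H_def .
qed

text \<open>
  \<open>E c\<close> is the left-invariant frame and \<open>K c\<close> the Maurer-Cartan form in the chart \<open>c\<close>; \<open>C g\<close> is
  the bracket of left-invariant fields at \<open>g\<close>, carried over to the coordinates given by \<open>\<kappa>\<close>.
\<close>

definition E :: "('g, 'a) chart \<Rightarrow> nat \<Rightarrow> 'a \<Rightarrow> 'a" where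
  "E c j z = coord M c (chart_inv c z) (frame G (chart_inv c z) j)"

definition K :: "('g, 'a) chart \<Rightarrow> 'a \<Rightarrow> 'a \<Rightarrow> 'a" where
  "K c z v = \<kappa> (chart_inv c z) (uncoord M c (chart_inv c z) v)"

definition brackets :: "'g \<Rightarrow> nat \<Rightarrow> nat \<Rightarrow> 'a" where
  "brackets g i j = lie_bracket M (\<lambda>x. frame G x i) (\<lambda>x. frame G x j) g"

definition C :: "'g \<Rightarrow> 'a \<Rightarrow> 'a \<Rightarrow> 'a" where
  "C g v w = (\<Sum>i<DIM('a). \<Sum>j<DIM('a). ((v \<bullet> e i) * (w \<bullet> e j)) *\<^sub>R \<kappa> g (brackets g i j))"

lemma linear_C: "linear (C g v)"
  unfolding C_def[abs_def]
  by (intro linear_compose_sum ballI linearI) (auto simp: inner_add_left algebra_simps)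

section \<open>Differentiability and structure equation near a point of the group\<close>

context
  fixes g0 :: 'g
begin

abbreviation "c0 \<equiv> chart_at M g0"

text \<open>In charts a left-invariant field is the partial derivative of the multiplication at the
  pair of the point and the unit; a second derivative of the multiplication differentiates it in the
  point.\<close>

lemma differentiable_E: "E c0 j differentiable (at (snd c0 g0))"
proof -
  let ?ce = "chart_at M (unt G)"
  let ?m = "mul_chart c0 ?ce c0"
  have E: "E c0 j z = frechet_derivative ?m (at (z, snd ?ce (unt G))) (0, bas G j)" if z:
      "z \<in> snd c0 ` fst c0" for z
  proof -
    let ?g = "chart_inv c0 z"
    have g: "?g \<in> fst c0" "snd c0 ?g = z" using z chart_inv_in[OF good_at]
        chart_chart_inv[OF good_at] by auto
    have e: "mul G ?g (unt G) \<in> fst c0" using g by (simp add: grp.right_neutral)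
    show ?thesis
      unfolding E_def frame_def left_field_def
      using tangent_map_mul[OF chart_in(1) chart_in(1) chart_in(1) g(1) chart_in(2) e, where v =
          "bas G j"] g
      by (simp add: grp.right_neutral coord_chart_at[OF manifold]
          coord_uncoord[OF manifold chart_in(1)])
  qed
  have in_dom: "(snd c0 g0, snd ?ce (unt G)) \<in> mul_domain c0 ?ce c0"
    using chart_in(2) by (auto simp: mul_domain_def chart_inv_chart[OF good_at chart_in(2)]
        grp.right_neutral)
  have "(\<lambda>z. frechet_derivative ?m (at (z, snd ?ce (unt G))) (0, bas G j)) differentiable
      (at (snd c0 g0))"
    by (rule differentiable_compose[of "\<lambda>q. frechet_derivative ?m (at q) (0, bas G j)"
        "\<lambda>z. (z, snd ?ce (unt G))"])
      (auto intro!: twice_differentiable_onD(2)[OF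
          mul_in_charts(2)[OF chart_in(1) chart_in(1) chart_in(1)] in_dom]
        intro: differentiableI[OF has_derivative_Pair[OF has_derivative_ident
            has_derivative_const]])
  then show ?thesis
    by (rule differentiable_cong_open[OF _ open_image[OF good_at]]) (use chart_in(2) E in auto)
qed

text \<open>The Maurer-Cartan form at a point translates by the inverse of that point, so this
  inverse has to stay in one chart, the one around \<open>ginv G g0\<close>.\<close>

definition Z0 :: "'a set" where
  "Z0 = {z \<in> snd c0 ` fst c0. ginv G (chart_inv c0 z) \<in> fst (chart_at M (ginv G g0))}"

lemma open_Z0: "open Z0"
proof -
  have "continuous_on UNIV (ginv G)" using smooth_inv by (simp add: smooth_map_def)
  then have "continuous_on (snd c0 ` fst c0) (\<lambda>z. ginv G (chart_inv c0 z))"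
    by (rule continuous_on_compose2[OF _ continuous_on_chart_inv[OF good_at]]) auto
  then have "open ((\<lambda>z. ginv G (chart_inv c0 z)) -` fst (chart_at M (ginv G g0)) \<inter> snd c0 ` fst c0)"
    using continuous_on_open_vimage[OF open_image[OF good_at]] open_domain[OF good_at] by blast
  moreover have "(\<lambda>z. ginv G (chart_inv c0 z)) -` fst (chart_at M (ginv G g0)) \<inter> snd c0 ` fst c0
      = Z0"
    by (auto simp: Z0_def)
  ultimately show ?thesis by simp
qed

lemma in_Z0: "snd c0 g0 \<in> Z0"
  using chart_in(2) by (auto simp: Z0_def chart_inv_chart[OF good_at chart_in(2)])

lemma Z0_chart: "z \<in> Z0 \<Longrightarrow> chart_inv c0 z \<in> fst c0"
  using chart_inv_in[OF good_at] by (auto simp: Z0_def)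

text \<open>Translation by the inverse is a partial derivative of the multiplication at the pair of
  the inverse and the point, and both of these depend differentiably on \<open>z\<close>.\<close>

lemma differentiable_K: "(\<lambda>z. K c0 z v) differentiable (at (snd c0 g0))"
proof -
  let ?ce = "chart_at M (unt G)" and ?ci = "chart_at M (ginv G g0)"
  let ?m = "mul_chart ?ci c0 ?ce"
  let ?i = "snd ?ci \<circ> ginv G \<circ> chart_inv c0"
  have K: "K c0 z v = \<phi> (frechet_derivative ?m (at (?i z, z)) (0, v))" if z: "z \<in> Z0" for z
  proof -
    let ?g = "chart_inv c0 z"
    have g: "?g \<in> fst c0" "snd c0 ?g = z" "ginv G ?g \<in> fst ?ci"
      using z chart_inv_in[OF good_at] chart_chart_inv[OF good_at] by (auto simp: Z0_def)
    have e: "mul G (ginv G ?g) ?g \<in> fst ?ce" using chart_in(2) by (simp add: grp.left_inverse)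
    show ?thesis
      unfolding K_def \<kappa>_def
      using tangent_map_mul[OF chart_in(1) chart_in(1) chart_in(1) g(3) g(1) e, where v =
          "uncoord M c0 ?g v"] g
      by (simp add: grp.left_inverse coord_chart_at[OF manifold]
          coord_uncoord[OF manifold chart_in(1)])
  qed
  have i: "?i differentiable (at (snd c0 g0))"
  proof (rule smooth_on_differentiable)
    show "smooth_on (snd c0 ` (fst c0 \<inter> UNIV \<inter> ginv G -` fst ?ci)) ?i"
      by (rule bspec[OF bspec[OF conjunct2[OF smooth_inv[unfolded smooth_map_def]] chart_in(1)]
          chart_in(1)])
    show "snd c0 g0 \<in> snd c0 ` (fst c0 \<inter> UNIV \<inter> ginv G -` fst ?ci)"
      using chart_in(2) by (intro imageI) simp
  qed
  have in_dom: "(?i (snd c0 g0), snd c0 g0) \<in> mul_domain ?ci c0 ?ce"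
    using chart_in(2) by (auto simp: mul_domain_def chart_inv_chart[OF good_at chart_in(2)]
        grp.left_inverse)
  have "(\<lambda>z. frechet_derivative ?m (at (?i z, z)) (0, v)) differentiable (at (snd c0 g0))"
  proof (rule differentiable_compose[of "\<lambda>q. frechet_derivative ?m (at q) (0, v)" "\<lambda>z. (?i z, z)"])
    show "(\<lambda>q. frechet_derivative ?m (at q) (0, v)) differentiable (at (?i (snd c0 g0), snd c0 g0))"
      by (rule twice_differentiable_onD(2)[OF mul_in_charts(2)[OF chart_in(1) chart_in(1)
          chart_in(1)] in_dom])
    show "(\<lambda>z. (?i z, z)) differentiable (at (snd c0 g0))"
      using has_derivative_Pair[OF has_derivative_frechet[OF i] has_derivative_ident]
          by (rule differentiableI)
  qed
  then have "(\<lambda>z. \<phi> (frechet_derivative ?m (at (?i z, z)) (0, v))) differentiable (at (snd c0 g0))"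
    by (rule differentiable_compose[of \<phi> "\<lambda>z. frechet_derivative ?m (at (?i z, z)) (0, v)",
          OF linear_imp_differentiable[OF linear_\<phi>]])
  then show ?thesis
    by (rule differentiable_cong_open[OF _ open_Z0 in_Z0]) (simp add: K)
qed

lemma linear_K: "z \<in> Z0 \<Longrightarrow> linear (K c0 z)"
  using linear_compose[OF linear_uncoord[OF manifold chart_in(1) Z0_chart] linear_\<kappa>]
  by (simp add: K_def[abs_def] o_def)

lemma K_E: "z \<in> Z0 \<Longrightarrow> j < DIM('a) \<Longrightarrow> K c0 z (E c0 j z) = e j"
  by (simp add: K_def E_def uncoord_coord[OF manifold chart_in(1) Z0_chart] \<kappa>_frame)

lemma K_g0: "K c0 (snd c0 g0) = \<kappa> g0"
  by (simp add: K_def[abs_def] chart_inv_chart[OF good_at chart_in(2)] coord_chart_at[OF manifold])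

lemma E_g0: "E c0 j (snd c0 g0) = frame G g0 j"
  by (simp add: E_def chart_inv_chart[OF good_at chart_in(2)] coord_chart_at[OF manifold])

lemma brackets_g0: "brackets g0 i j =
  frechet_derivative (E c0 j) (at (snd c0 g0)) (E c0 i (snd c0 g0)) -
  frechet_derivative (E c0 i) (at (snd c0 g0)) (E c0 j (snd c0 g0))"
  unfolding E_g0 by (simp add: brackets_def lie_bracket_def Let_def E_def[abs_def])

lemma group_structure_equation:
  fixes f :: "'x::real_normed_vector \<Rightarrow> 'a"
  assumes S: "open S" "s \<in> S" and f: "\<And>t. t \<in> S \<Longrightarrow> (f has_derivative f' t) (at t)"
    and f2: "\<And>c. (\<lambda>t. f' t c) differentiable (at s)" and s: "f s = snd c0 g0"
  shows "(\<lambda>t. K c0 (f t) (f' t v)) differentiable (at s)"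
    and "frechet_derivative (\<lambda>t. K c0 (f t) (f' t b)) (at s) a -
         frechet_derivative (\<lambda>t. K c0 (f t) (f' t a)) (at s) b = - C g0 (\<kappa> g0 (f' s a))
             (\<kappa> g0 (f' s b))"
  using structure_equation[OF S f f2 open_Z0, of "K c0" "E c0" e] in_Z0 linear_K inj_\<kappa>
      differentiable_K differentiable_E K_E
    e_expansion
  unfolding s K_g0 C_def brackets_g0 by simp_all

end


text \<open>Otherwise \<open>layer G 1\<close>, which is hidden in \<open>hdim G\<close>, is rewritten to \<open>layer G (Suc 0)\<close>.\<close>

declare One_nat_def [simp del]

lemma \<kappa>_unt: "\<kappa> (unt G) = \<phi>"
proof -
  have "ginv G (unt G) = unt G" by (metis grp.left_inverse grp.right_neutral)
  then show ?thesis by (simp add: \<kappa>_def[abs_def] tangent_map_unit)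
qed

lemma brackets_unt: "brackets (unt G) i j = bracket G (bas G i) (bas G j)"
  by (simp add: brackets_def bracket_def frame_def)

lemma C_e:
  assumes "i < DIM('a)" "j < DIM('a)"
  shows "C g (e i) (e j) = \<kappa> g (brackets g i j)"
proof -
  have "C g (e i) (e j) = (\<Sum>i'<DIM('a). \<Sum>j'<DIM('a). if i' = i then if j' = j then \<kappa> g
      (brackets g i' j') else 0 else 0)"
    unfolding C_def using assms by (intro sum.cong) (auto simp: orthonormal)
  also have "\<dots> = (\<Sum>i'<DIM('a). if i' = i then \<Sum>j'<DIM('a). if j' = j then \<kappa> g (brackets g i' j')
      else 0 else 0)"
    by (intro sum.cong) auto
  finally show ?thesis using assms by simp
qed

text \<open>
  In the charts at the unit and at \<open>g0\<close>, left translation by \<open>g0\<close> pulls the Maurer-Cartan form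
  back to itself, so that both brackets are read off the same exterior derivative.
\<close>

lemma left_invariant_brackets:
  assumes ij: "i < DIM('a)" "j < DIM('a)"
  shows "\<kappa> g0 (brackets g0 i j) = \<phi> (bracket G (bas G i) (bas G j))"
proof -
  let ?c0 = "chart_at M g0" and ?ce = "chart_at M (unt G)"
  let ?m = "mul_chart ?c0 ?ce ?c0"
  define s where "s = snd ?ce (unt G)"
  define l where "l h = snd ?c0 (mul G g0 (chart_inv ?ce h))" for h
  define l' where "l' h v = frechet_derivative ?m (at (snd ?c0 g0, h)) (0, v)" for h v
  define S where "S = {h \<in> snd ?ce ` fst ?ce. mul G g0 (chart_inv ?ce h) \<in> fst ?c0}"
  have S: "h \<in> S \<Longrightarrow> chart_inv ?ce h \<in> fst ?ce \<and> snd ?ce (chart_inv ?ce h) = h \<and> mul G g0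
      (chart_inv ?ce h) \<in> fst ?c0" for h
    using chart_inv_in[OF good_at] chart_chart_inv[OF good_at] by (auto simp: S_def)
  have "continuous_on UNIV (mul G g0)" using isCont_mul
      by (simp add: continuous_on_eq_continuous_at)
  then have "continuous_on (snd ?ce ` fst ?ce) (\<lambda>h. mul G g0 (chart_inv ?ce h))"
    by (rule continuous_on_compose2[OF _ continuous_on_chart_inv[OF good_at]]) auto
  then have "open ((\<lambda>h. mul G g0 (chart_inv ?ce h)) -` fst ?c0 \<inter> snd ?ce ` fst ?ce)"
    using continuous_on_open_vimage[OF open_image[OF good_at]] open_domain[OF good_at] by blast
  moreover have "(\<lambda>h. mul G g0 (chart_inv ?ce h)) -` fst ?c0 \<inter> snd ?ce ` fst ?ce = S"
    by (auto simp: S_def)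
  ultimately have oS: "open S" by simp
  have sS: "s \<in> S"
    using chart_in(2) by (auto simp: S_def s_def chart_inv_chart[OF good_at chart_in(2)]
        grp.right_neutral)
  have ls: "l s = snd ?c0 g0"
    by (simp add: l_def s_def chart_inv_chart[OF good_at chart_in(2)] grp.right_neutral)
  have dl: "(l has_derivative l' h) (at h)" if "h \<in> S" for h
    using has_derivative_mul[OF chart_in(1) chart_in(1) chart_in(1) chart_in(2), of
        "chart_inv ?ce h" "unt G" g0 g0] S[OF that]
    by (simp add: l_def[abs_def] l'_def[abs_def])
  have dl': "(\<lambda>h. l' h v) differentiable (at s)" for v
    unfolding l'_def
  proof (rule differentiable_compose[of "\<lambda>q. frechet_derivative ?m (at q) (0, v)"
      "\<lambda>h. (snd ?c0 g0, h)"])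
    have "(snd ?c0 g0, s) \<in> mul_domain ?c0 ?ce ?c0"
      using sS chart_in(2) by (auto simp: mul_domain_def S_def
          chart_inv_chart[OF good_at chart_in(2)])
    then show "(\<lambda>q. frechet_derivative ?m (at q) (0, v)) differentiable (at (snd ?c0 g0, s))"
      by (rule twice_differentiable_onD(2)[OF mul_in_charts(2)[OF chart_in(1) chart_in(1)
          chart_in(1)]])
    show "(\<lambda>h. (snd ?c0 g0, h)) differentiable (at s)"
      by (rule differentiableI[OF has_derivative_Pair[OF has_derivative_const
          has_derivative_ident]])
  qed
  have inv: "K ?c0 (l h) (l' h v) = K ?ce h v" if h: "h \<in> S" for h v
  proof -
    let ?g = "chart_inv ?ce h"
    have lg: "chart_inv ?c0 (l h) = mul G g0 ?g" using S[OF h]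
        by (simp add: l_def chart_inv_chart[OF good_at])
    have "tangent_map M M (mul G g0) ?g (uncoord M ?ce ?g v) = uncoord M ?c0 (mul G g0 ?g) (l' h v)"
      using tangent_map_mul[OF chart_in(1) chart_in(1) chart_in(1) chart_in(2), of ?g "unt G" g0
          g0 "uncoord M ?ce ?g v"]
        S[OF h] coord_uncoord[OF manifold chart_in(1)]
      by (simp add: l'_def)
    then show ?thesis using \<kappa>_mul[of g0 ?g "uncoord M ?ce ?g v"] by (simp add: K_def lg)
  qed
  have ev: "\<forall>\<^sub>F h in nhds s. K ?c0 (l h) (l' h v) = K ?ce h v" for v
    using eventually_nhds_in_open[OF oS sS] by (rule eventually_mono) (rule inv)
  have \<kappa>l: "\<kappa> g0 (l' s v) = \<phi> v" for v
    using inv[OF sS, of v] by (simp add: ls K_g0) (simp add: s_def K_g0 \<kappa>_unt)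
  have "- C g0 (\<phi> a) (\<phi> b) = - C (unt G) (\<phi> a) (\<phi> b)" for a b
    using group_structure_equation(2)[OF oS sS dl dl' ls, of b a]
      group_structure_equation(2)[OF oS sS has_derivative_ident, of "unt G" b a]
    by (simp add: frechet_derivative_cong_nhds[OF ev] \<kappa>l) (simp add: s_def \<kappa>_unt)
  from this[of "bas G i" "bas G j"] show ?thesis
    using ij by (simp add: \<phi>_bas C_e brackets_unt \<kappa>_unt)
qed

lemma bas_layer: "i < hdim G \<Longrightarrow> bas G i \<in> layer G 1"
  using span_bas_layer span_base[of "bas G i" "bas G ` {..<hdim G}"] by blast

text \<open>The bracket lies in the second layer, which is orthogonal to the first. If there is only
  one layer, the first is also the last and its brackets vanish.\<close>

lemma bracket_vertical:
  assumes "i < hdim G" "j < hdim G" "l < hdim G"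
  shows "ip G (bas G l) (bracket G (bas G i) (bas G j)) = 0"
proof (cases "step G = 1")
  case True
  have "\<forall>j\<in>{1..step G}. \<forall>v\<in>layer G j. \<forall>w\<in>layer G (step G). bracket G v w = 0"
    using G by (simp add: sub_riemannian_stratified_group_def stratified_def)
  then have "bracket G (bas G i) (bas G j) = 0"
    using True bas_layer[OF assms(1)] bas_layer[OF assms(2)] by simp
  then show ?thesis by (simp add: linear_0[OF linear_ip])
next
  case False
  then have st: "1 < step G" using step_ge_1 by simp
  have "\<forall>j. 1 \<le> j \<and> j < step G \<longrightarrow>
        span {bracket G v w | v w. v \<in> layer G 1 \<and> w \<in> layer G j} = layer G (Suc j)"
    using G by (simp add: sub_riemannian_stratified_group_def stratified_def)
  then have sp: "span {bracket G v w | v w. v \<in> layer G 1 \<and> w \<in> layer G 1} = layer G (Suc 1)"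
    using st by blast
  have "bracket G (bas G i) (bas G j) \<in> {bracket G v w | v w. v \<in> layer G 1 \<and> w \<in> layer G 1}"
    using bas_layer[OF assms(1)] bas_layer[OF assms(2)] by blast
  from span_base[OF this] have b: "bracket G (bas G i) (bas G j) \<in> layer G (Suc 1)"
    by (simp only: sp)
  have "\<forall>j\<in>{1..step G}. \<forall>k\<in>{1..step G}. j \<noteq> k \<longrightarrow> (\<forall>v\<in>layer G j. \<forall>w\<in>layer G k. ip G v w = 0)"
    using G by (simp add: sub_riemannian_stratified_group_def)
  moreover have "1 \<in> {1..step G}" "Suc 1 \<in> {1..step G}" "1 \<noteq> Suc 1" using st by auto
  ultimately show ?thesis using bas_layer[OF assms(3)] b by blast
qed

lemma H_inner:
  assumes "v \<in> H" "hdim G \<le> i" "i < DIM('a)"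
  shows "v \<bullet> e i = 0"
  using assms(1) unfolding H_def
proof (induction rule: span_induct_alt)
  case (step c x y)
  then obtain j where j: "j < hdim G" "x = e j" by blast
  then have "x \<bullet> e i = 0" using orthonormal[of j i] assms by auto
  then show ?case using step.IH by (simp add: inner_add_left)
qed simp

text \<open>Left invariance moves the brackets of the frame to the unit, where
  \<open>bracket_vertical\<close> applies; terms with a non-horizontal index have a zero
  coefficient.\<close>

lemma C_vertical:
  assumes v: "v \<in> H" and w: "w \<in> H" and l: "l < hdim G"
  shows "C g v w \<bullet> e l = 0"
proof -
  have "((v \<bullet> e i) * (w \<bullet> e j)) * (\<kappa> g (brackets g i j) \<bullet> e l) = 0" if "i < DIM('a)"
      "j < DIM('a)" for i j
  proof (cases "i < hdim G \<and> j < hdim G")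
    case True
    have "l < DIM('a)" using l d_le by (rule less_le_trans)
    then have "\<kappa> g (brackets g i j) \<bullet> e l = 0"
      using True l that by (simp only: left_invariant_brackets \<phi>_e bracket_vertical)
    then show ?thesis by simp
  next
    case False
    then show ?thesis using H_inner[OF v _ that(1)] H_inner[OF w _ that(2)]
        by (metis mult_eq_0_iff not_le)
  qed
  then show ?thesis
    unfolding C_def inner_sum_left inner_scaleR_left by (intro sum.neutral ballI)
        (simp only: lessThan_iff)
qed

section \<open>The geometric notions in frame coordinates\<close>

lemma tuple_basis_\<kappa>:
  assumes "tuple_basis DIM('a) (\<lambda>i. \<kappa> g (f i))"
  shows "dual f j v = component DIM('a) (\<lambda>i. \<kappa> g (f i)) j (\<kappa> g v)"
proof -
  have "linear (inv (\<kappa> g))" "bij (inv (\<kappa> g))"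
    using linear_\<kappa> bij_\<kappa> by (auto intro: bij_imp_bij_inv inj_linear_imp_inv_linear simp: bij_is_inj)
  from tuple_basis_image(2)[OF assms this, of j "\<kappa> g v"] show ?thesis
    by (simp add: dual_eq_component inj_\<kappa>)
qed

lemma dual_frame:
  assumes j: "j < DIM('a)"
  shows "dual (frame G g) j v = \<kappa> g v \<bullet> e j"
proof -
  have "(\<lambda>i. \<kappa> g (frame G g i)) ` {..<DIM('a)} = e ` {..<DIM('a)}" by (auto simp: \<kappa>_frame)
  then have tb: "tuple_basis DIM('a) (\<lambda>i. \<kappa> g (frame G g i))"
    using tuple_basis_DIM[of "\<lambda>i. \<kappa> g (frame G g i)"] span_e by simp
  have "component DIM('a) (\<lambda>i. \<kappa> g (frame G g i)) j
      (\<Sum>i<DIM('a). (\<kappa> g v \<bullet> e i) *\<^sub>R \<kappa> g (frame G g i)) = \<kappa> g v \<bullet> e j"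
    by (rule component_sum[OF tb j])
  moreover have "(\<Sum>i<DIM('a). (\<kappa> g v \<bullet> e i) *\<^sub>R \<kappa> g (frame G g i)) = \<kappa> g v"
    by (simp add: \<kappa>_frame e_expansion[symmetric])
  ultimately show ?thesis by (simp add: tuple_basis_\<kappa>[OF tb])
qed

lemma torsion_\<kappa>: "\<kappa> g (torsion G g v w) = - C g (\<kappa> g v) (\<kappa> g w)"
proof -
  have "torsion G g v w = - (\<Sum>i<DIM('a). \<Sum>j<DIM('a). ((\<kappa> g v \<bullet> e i) * (\<kappa> g w \<bullet> e j)) *\<^sub>R brackets
      g i j)"
    by (simp add: torsion_def dual_frame brackets_def sum_negf)
  then show ?thesis
    by (simp add: C_def linear_neg[OF linear_\<kappa>] linear_sum[OF linear_\<kappa>] linear_cmul[OF linear_\<kappa>])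
qed

lemma \<kappa>_normal_space: "\<kappa> g ` normal_space G g T = N (\<kappa> g ` T)"
proof (intro equalityI subsetI)
  fix w assume "w \<in> \<kappa> g ` normal_space G g T"
  then obtain w' where w': "w = \<kappa> g w'" "w' \<in> horizontal G g"
      "\<forall>v\<in>T \<inter> horizontal G g. metric G g v w' = 0"
    by (auto simp: normal_space_def)
  have "w \<in> H" unfolding \<kappa>_horizontal[of g, symmetric] using w' by blast
  moreover have "v \<bullet> w = 0" if v: "v \<in> \<kappa> g ` T \<inter> H" for v
  proof -
    obtain v' where v': "v = \<kappa> g v'" "v' \<in> T" using v by blast
    moreover have "v' \<in> horizontal G g"
    proof -
      have "\<kappa> g v' \<in> \<kappa> g ` horizontal G g" unfolding \<kappa>_horizontal using v v'(1) by simp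
      then show ?thesis by (simp only: inj_image_mem_iff[OF inj_\<kappa>])
    qed
    ultimately show ?thesis using w' by (auto simp: metric_\<kappa>)
  qed
  ultimately show "w \<in> N (\<kappa> g ` T)" by (simp add: N_def)
next
  fix w assume w: "w \<in> N (\<kappa> g ` T)"
  then have "w \<in> \<kappa> g ` horizontal G g" unfolding \<kappa>_horizontal by (simp add: N_def)
  then obtain w' where w': "w = \<kappa> g w'" "w' \<in> horizontal G g" by blast
  have "metric G g v w' = 0" if "v \<in> T \<inter> horizontal G g" for v
  proof -
    have "\<kappa> g v \<in> \<kappa> g ` T \<inter> H" unfolding \<kappa>_horizontal[of g, symmetric] using that by blast
    then show ?thesis using w w'(1) by (auto simp: N_def metric_\<kappa>)
  qed
  then show "w \<in> \<kappa> g ` normal_space G g T" using w' by (auto simp: normal_space_def)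
qed

lemma adapted_basis_\<kappa>: "adapted_basis G p g T f \<longleftrightarrow> adapted p (\<kappa> g ` T) (\<lambda>i. \<kappa> g (f i))"
proof -
  have sp: "span (f ` I) = X \<longleftrightarrow> span ((\<lambda>i. \<kappa> g (f i)) ` I) = \<kappa> g ` X" for I X
  proof -
    have "span ((\<lambda>i. \<kappa> g (f i)) ` I) = \<kappa> g ` span (f ` I)"
      by (simp add: linear_span_image[OF linear_\<kappa>, symmetric] image_image)
    then show ?thesis by (simp add: inj_image_eq_iff[OF inj_\<kappa>])
  qed
  have int: "\<kappa> g ` (T \<inter> horizontal G g) = \<kappa> g ` T \<inter> H"
    by (simp only: image_Int[OF inj_\<kappa>] \<kappa>_horizontal)
  have fr: "f j = frame G g j - (\<Sum>\<alpha><p. a \<alpha> *\<^sub>R f \<alpha>) \<longleftrightarrow> \<kappa> g (f j) = e j - (\<Sum>\<alpha><p. a \<alpha> *\<^sub>R \<kappa> g (f \<alpha>))"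
    if "j < DIM('a)" for j a
  proof -
    have "\<kappa> g (frame G g j - (\<Sum>\<alpha><p. a \<alpha> *\<^sub>R f \<alpha>)) = e j - (\<Sum>\<alpha><p. a \<alpha> *\<^sub>R \<kappa> g (f \<alpha>))"
      using that by (simp add: linear_diff[OF linear_\<kappa>] linear_sum[OF linear_\<kappa>]
          linear_cmul[OF linear_\<kappa>] \<kappa>_frame)
    then show ?thesis using inj_eq[OF inj_\<kappa>] by metis
  qed
  have "(\<forall>j\<in>{hdim G..<DIM('a)}. (\<exists>a. f j = frame G g j - (\<Sum>\<alpha><p. a \<alpha> *\<^sub>R f \<alpha>)) \<and> f j \<in> T) \<longleftrightarrow>
    (\<forall>j\<in>{hdim G..<DIM('a)}. (\<exists>a. \<kappa> g (f j) = e j - (\<Sum>\<alpha><p. a \<alpha> *\<^sub>R \<kappa> g (f \<alpha>))) \<and> \<kappa> g (f j) \<in> \<kappa> g ` T)"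
    by (intro ball_cong refl) (simp add: fr inj_image_mem_iff[OF inj_\<kappa>])
  then show ?thesis
    unfolding adapted_basis_def adapted_def sp int \<kappa>_normal_space \<kappa>_horizontal metric_\<kappa> by blast
qed

lemma tan_part_\<kappa>:
  assumes t: "transversal p (\<kappa> g ` T)"
  shows "\<kappa> g (tan_part G g T v) = tan_proj (\<kappa> g ` T) (\<kappa> g v)"
proof -
  have mem: "t \<in> T \<and> v - t \<in> normal_space G g T \<longleftrightarrow> \<kappa> g t \<in> \<kappa> g ` T \<and> \<kappa> g v - \<kappa> g t \<in> N (\<kappa> g ` T)"
      for t
    by (simp only: \<kappa>_normal_space[symmetric] linear_diff[OF linear_\<kappa>, symmetric]
        inj_image_mem_iff[OF inj_\<kappa>])
  obtain t where t': "\<kappa> g t = tan_proj (\<kappa> g ` T) (\<kappa> g v)"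
    using bij_\<kappa>[of g] by (metis bij_pointE)
  have "tan_part G g T v = t"
    unfolding tan_part_def
  proof (rule the_equality)
    show "t \<in> T \<and> v - t \<in> normal_space G g T"
      unfolding mem t' using tan_proj_in[OF t] by blast
    fix s assume "s \<in> T \<and> v - s \<in> normal_space G g T"
    then have "\<kappa> g s \<in> \<kappa> g ` T \<and> \<kappa> g v - \<kappa> g s \<in> N (\<kappa> g ` T)" by (simp only: mem)
    then have "\<kappa> g s = \<kappa> g t"
      unfolding t' by (intro tan_proj_eqI[OF subspace_T[OF t], symmetric]) auto
    then show "s = t" using inj_\<kappa> by (simp add: inj_eq)
  qed
  then show ?thesis using t' by simp
qed

text \<open>An adapted basis in the model is carried back by the inverse of
  \<open>\<kappa> g\<close>, so the choice in \<open>some_adapted_basis\<close> has a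
  witness.\<close>

lemma some_adapted_basis_\<kappa>:
  assumes "transversal p (\<kappa> g ` T)"
  shows "adapted p (\<kappa> g ` T) (\<lambda>i. \<kappa> g (some_adapted_basis G p g T i))"
proof -
  obtain f where "adapted p (\<kappa> g ` T) f" using adapted_exists[OF assms] by blast
  then have "adapted p (\<kappa> g ` T) (\<lambda>i. \<kappa> g (inv (\<kappa> g) (f i)))"
    using bij_\<kappa>[of g] by (simp add: bij_is_surj surj_f_inv_f)
  then have "adapted_basis G p g T (\<lambda>i. inv (\<kappa> g) (f i))" by (simp only: adapted_basis_\<kappa>)
  then have "adapted_basis G p g T (some_adapted_basis G p g T)"
    unfolding some_adapted_basis_def by (rule someI[where P = "adapted_basis G p g T"])
  then show ?thesis by (simp only: adapted_basis_\<kappa>)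
qed

end

section \<open>Variations of non-horizontal immersions\<close>

lemma smooth_manifold_real: "smooth_manifold real_atlas 1"
proof -
  have c: "times_differentiable_on k UNIV (\<lambda>x::real. a::real)" for k a
    by (induction k arbitrary: a) auto
  have "times_differentiable_on k UNIV (\<lambda>x::real. x)" for k
    using c by (cases k) (auto simp: frechet_derivative_ident[unfolded id_def])
  then have "smooth_on UNIV (id :: real \<Rightarrow> real)" by (simp add: smooth_on_def id_def)
  moreover have "\<exists>B::real set. finite B \<and> independent B \<and> span B = UNIV \<and> card B = 1"
    by (rule exI[of _ "{1}"]) (auto simp: span_singleton intro: range_eqI[of _ _ "_ :: real"])
  ultimately show ?thesis
    using good_chart_real
    by (auto simp: smooth_manifold_def real_atlas_def good_chart_def chart_inv_real)
qed

text \<open>\<open>F 0\<close> stands for the given immersion, and the point \<open>x\<close> is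
  fixed: everything is computed in the preferred charts around \<open>x\<close> and
  \<open>F 0 x\<close>.\<close>

locale nonhorizontal_variation = sub_riemannian_group G
  for G :: "('g::{t2_space,second_countable_topology}, 'a::euclidean_space) stratified_group" +
  fixes A :: "('m::{t2_space,second_countable_topology}, 'b::real_normed_vector) atlas"
    and \<omega> :: "'m \<Rightarrow> (nat \<Rightarrow> 'b) \<Rightarrow> real" and F :: "real \<Rightarrow> 'm \<Rightarrow> 'g" and \<epsilon> :: real and p :: nat and x
        :: 'm
  assumes p_le_n: "p \<le> DIM('a)" and A: "smooth_manifold A (DIM('a) - p)"
    and \<omega>: "orientation_form A (DIM('a) - p) \<omega>" and var: "variation G A (F 0) \<epsilon> F"
begin

abbreviation "cx \<equiv> chart_at A x"
abbreviation "cg \<equiv> chart_at M (F 0 x)"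
abbreviation "y0 \<equiv> snd cx x"

definition Fh :: "real \<times> 'b \<Rightarrow> 'a" where "Fh = (\<lambda>(u, y). snd cg (F u (chart_inv cx y)))"

definition Dom :: "(real \<times> 'b) set" where
  "Dom = {(u, y). u \<in> {-\<epsilon><..<\<epsilon>} \<and> y \<in> snd cx ` fst cx \<and> F u (chart_inv cx y) \<in> fst cg}"

definition \<theta> :: "real \<times> 'b \<Rightarrow> real \<times> 'b \<Rightarrow> 'a" where
  "\<theta> s V = K cg (Fh s) (frechet_derivative Fh (at s) V)"

lemma eps: "0 < \<epsilon>" and smooth_F: "smooth_map (prod_atlas real_atlas A) M ({-\<epsilon><..<\<epsilon>} \<times> UNIV)
    (\<lambda>(u, x). F u x)"
  using var by (simp_all add: variation_def)

lemma immersion_F: "u \<in> {-\<epsilon><..<\<epsilon>} \<Longrightarrow> immersion G A (F u)"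
  and non_horizontal_F: "u \<in> {-\<epsilon><..<\<epsilon>} \<Longrightarrow> non_horizontal G A (F u)"
  using var by (simp_all add: variation_def)

lemma cx: "cx \<in> A" "x \<in> fst cx" "good_chart cx"
  using chart_at[OF A] smooth_manifold_chart[OF A chart_at(1)[OF A]] by auto

lemma Dom_smooth: "open Dom" "twice_differentiable_on Dom Fh"
proof -
  have eq: "chart_domain2 (UNIV, id) cx cg ({-\<epsilon><..<\<epsilon>} \<times> UNIV) (\<lambda>(u, x). F u x) = Dom"
    by (auto simp: chart_domain2_def Dom_def chart_inv_real)
  have "(\<lambda>(y, z). snd cg ((\<lambda>(u, x). F u x) (chart_inv (UNIV, id) y, chart_inv cx z))) = Fh"
    by (auto simp: Fh_def chart_inv_real)
  moreover have "(UNIV, id) \<in> real_atlas" by (simp add: real_atlas_def)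
  moreover have "open ({-\<epsilon><..<\<epsilon>} \<times> (UNIV::'m set))" by (intro open_Times) auto
  ultimately show "open Dom" "twice_differentiable_on Dom Fh"
    using smooth_map_prod_charts[OF smooth_F _ _ good_chart_real cx(1,3) chart_in(1) good_at, of
        "F 0 x"]
    by (simp_all add: eq)
qed

lemma in_Dom: "(0, y0) \<in> Dom"
  using eps cx chart_in(2) by (auto simp: Dom_def chart_inv_chart[OF cx(3) cx(2)])

lemma DomD:
  assumes "(u, y) \<in> Dom"
  shows "u \<in> {-\<epsilon><..<\<epsilon>}" "chart_inv cx y \<in> fst cx" "snd cx (chart_inv cx y) = y"
    "F u (chart_inv cx y) \<in> fst cg" "chart_inv cg (Fh (u, y)) = F u (chart_inv cx y)"
    "Fh (u, y) = snd cg (F u (chart_inv cx y))"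
  using assms chart_inv_in[OF cx(3)] chart_chart_inv[OF cx(3)] chart_inv_chart[OF good_at]
  by (auto simp: Dom_def Fh_def)

lemma isCont_F: "u \<in> {-\<epsilon><..<\<epsilon>} \<Longrightarrow> isCont (F u) y"
  using immersion_F by (simp add: immersion_def smooth_map_def continuous_on_eq_continuous_at)

lemma isCont_F_time: "isCont (\<lambda>u. F u y) 0"
proof -
  have "continuous_on ({-\<epsilon><..<\<epsilon>} \<times> UNIV) (\<lambda>(u, x). F u x)" using smooth_F
      by (simp add: smooth_map_def)
  then have "continuous_on {-\<epsilon><..<\<epsilon>} (\<lambda>u. (\<lambda>(u, x). F u x) (u, y))"
    by (rule continuous_on_compose2) (auto intro!: continuous_intros)
  then show ?thesis using eps by (simp add: continuous_on_eq_continuous_at)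
qed

lemma has_derivative_Fh: "s \<in> Dom \<Longrightarrow> (Fh has_derivative frechet_derivative Fh (at s)) (at s)"
  by (rule twice_differentiable_onD(1)[OF Dom_smooth(2)])

lemma tangent_map_F:
  assumes "(u, y) \<in> Dom"
  shows "mdiff A M (F u) (chart_inv cx y)"
    "tangent_map A M (F u) (chart_inv cx y) v =
      uncoord M cg (F u (chart_inv cx y)) (frechet_derivative Fh (at (u, y))
          (0, coord A cx (chart_inv cx y) v))"
proof -
  note D = DomD[OF assms]
  have "((\<lambda>z. Fh (u, z)) has_derivative (\<lambda>h. frechet_derivative Fh (at (u, y)) (0, h))) (at y)"
    by (rule partial_derivative_snd[OF has_derivative_Fh[OF assms]])
  then have d: "((\<lambda>z. snd cg (F u (chart_inv cx z))) has_derivative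
      (\<lambda>h. frechet_derivative Fh (at (u, y)) (0, h))) (at (snd cx (chart_inv cx y)))"
    by (simp add: Fh_def D(3))
  note t = tangent_map_in_charts[OF A manifold isCont_F[OF D(1)] cx(1) D(2) chart_in(1) D(4) d]
  show "mdiff A M (F u) (chart_inv cx y)" by (rule t(1))
  show "tangent_map A M (F u) (chart_inv cx y) v =
      uncoord M cg (F u (chart_inv cx y)) (frechet_derivative Fh (at (u, y))
          (0, coord A cx (chart_inv cx y) v))"
    by (rule t(2))
qed

lemma \<theta>_space:
  assumes "(u, y) \<in> Dom"
  shows "\<theta> (u, y) (0, w) =
    \<kappa> (F u (chart_inv cx y)) (tangent_map A M (F u) (chart_inv cx y)
        (uncoord A cx (chart_inv cx y) w))"
  using DomD[OF assms]
  by (simp add: \<theta>_def K_def tangent_map_F[OF assms] coord_uncoord[OF A cx(1)])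

lemma \<theta>_time:
  assumes "(0, y) \<in> Dom"
  shows "\<theta> (0, y) (1, 0) = \<kappa> (F 0 (chart_inv cx y)) (variation_field G F (chart_inv cx y))"
proof -
  note D = DomD[OF assms]
  let ?y = "chart_inv cx y"
  have "((\<lambda>u. (u, y)) has_derivative (\<lambda>h. (h, 0))) (at 0)" by (auto intro!: derivative_eq_intros)
  from has_derivative_compose[OF this has_derivative_Fh[OF assms]]
  have d: "((\<lambda>u. snd cg (F (chart_inv (UNIV, id) u) ?y)) has_derivative
      (\<lambda>h. frechet_derivative Fh (at (0, y)) (h, 0)))
      (at (snd (UNIV, id) 0))"
    by (simp add: Fh_def chart_inv_real)
  have r: "(UNIV, id) \<in> real_atlas" "0 \<in> fst (UNIV, id)" by (auto simp: real_atlas_def)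
  have "tangent_map real_atlas M (\<lambda>u. F u ?y) 0 1 =
      uncoord M cg (F 0 ?y) (frechet_derivative Fh (at (0, y))
          (coord real_atlas (UNIV, id) 0 1, 0))"
    by (rule tangent_map_in_charts(2)[OF smooth_manifold_real manifold isCont_F_time r
        chart_in(1) D(4) d])
  moreover have "coord real_atlas (UNIV, id) 0 = id"
    using coord_chart_at(1)[OF smooth_manifold_real, of 0] by (simp add: chart_at_real)
  ultimately show ?thesis using D by (simp add: \<theta>_def K_def variation_field_def)
qed

lemma surj_uncoord: "y' \<in> fst cx \<Longrightarrow> surj (uncoord A cx y')"
  using uncoord_coord[OF A cx(1)] by (metis surjI)

lemma inj_uncoord: "y' \<in> fst cx \<Longrightarrow> inj (uncoord A cx y')"
  using coord_uncoord[OF A cx(1)] by (metis injI)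

lemma range_\<theta>:
  assumes "(u, y) \<in> Dom"
  shows "range (\<lambda>w. \<theta> (u, y) (0, w)) = \<kappa> (F u (chart_inv cx y)) ` tangent_image G A (F u)
      (chart_inv cx y)"
proof -
  have "range (\<lambda>w. \<theta> (u, y) (0, w)) = \<kappa> (F u (chart_inv cx y)) ` tangent_map A M (F u)
      (chart_inv cx y) `
      range (uncoord A cx (chart_inv cx y))"
    by (simp add: \<theta>_space[OF assms] image_image)
  then show ?thesis
    using surj_uncoord[OF DomD(2)[OF assms]] by (simp add: tangent_image_def)
qed

lemma inj_\<theta>:
  assumes "(u, y) \<in> Dom"
  shows "inj (\<lambda>w. \<theta> (u, y) (0, w))"
proof -
  have "inj (tangent_map A M (F u) (chart_inv cx y))"
    using immersion_F[OF DomD(1)[OF assms]] by (simp add: immersion_def)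
  then show ?thesis
    unfolding \<theta>_space[OF assms] using inj_uncoord[OF DomD(2)[OF assms]] inj_\<kappa>
    by (simp add: inj_def)
qed

lemma linear_\<theta>:
  assumes "s \<in> Dom"
  shows "linear (\<theta> s)"
proof -
  obtain u y where s: "s = (u, y)" by (cases s)
  note D = DomD[OF assms[unfolded s]]
  have "linear (uncoord M cg (F u (chart_inv cx y)))"
      by (rule linear_uncoord[OF manifold chart_in(1) D(4)])
  from linear_compose[OF linear_compose[OF has_derivative_linear[OF has_derivative_Fh[OF assms]]
      this] linear_\<kappa>[of "F u (chart_inv cx y)"]]
  show ?thesis using D(5) by (simp add: \<theta>_def[abs_def] K_def s o_def)
qed

lemma ex_basis: "\<exists>b::nat \<Rightarrow> 'b. tuple_basis (DIM('a) - p) b"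
proof -
  obtain B :: "'b set" where "finite B" "independent B" "span B = UNIV" "card B = DIM('a) - p"
    using A unfolding smooth_manifold_def by blast
  then show ?thesis using ex_tuple_basis[of B] by metis
qed

lemma transversal_\<theta>:
  assumes "s \<in> Dom"
  shows "transversal p (range (\<lambda>w. \<theta> s (0, w)))"
proof -
  obtain u y where s: "s = (u, y)" by (cases s)
  note D = DomD[OF assms[unfolded s]]
  let ?B = "\<lambda>w. \<theta> s (0, w)" and ?g = "F u (chart_inv cx y)"
  have "linear (\<lambda>w::'b. (0::real, w))" by (rule linearI) auto
  from linear_compose[OF this linear_\<theta>[OF assms]] have lin: "linear ?B" by (simp add: o_def)
  have inj: "inj ?B" using inj_\<theta> assms s by simp
  obtain b :: "nat \<Rightarrow> 'b" where b: "tuple_basis (DIM('a) - p) b" using ex_basis by blast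
  have ind: "independent (b ` {..<DIM('a) - p})" and card:
      "card (b ` {..<DIM('a) - p}) = DIM('a) - p"
    and sp: "span (b ` {..<DIM('a) - p}) = UNIV"
    using b by (auto simp: tuple_basis_def card_image)
  have "independent (?B ` b ` {..<DIM('a) - p})"
    using linear_independent_injective_image[OF lin ind] inj by (simp add: inj_on_subset[OF inj])
  moreover have "span (?B ` b ` {..<DIM('a) - p}) = range ?B"
      by (simp only: linear_span_image[OF lin] sp)
  moreover have "card (?B ` b ` {..<DIM('a) - p}) = DIM('a) - p"
    using card inj by (metis card_image inj_on_subset subset_UNIV)
  ultimately have "dim (range ?B) = DIM('a) - p"
    by (metis dim_eq_card_independent dim_span)
  moreover have "\<exists>t\<in>range ?B. \<exists>h\<in>H. v = t + h" for v
  proof -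
    obtain v' where v': "v = \<kappa> ?g v'" using bij_\<kappa>[of ?g] by (metis bij_pointE)
    have "v' \<in> {v + w | v w. v \<in> tangent_image G A (F u) (chart_inv cx y) \<and> w \<in> horizontal G ?g}"
      using non_horizontal_F[OF D(1)] unfolding non_horizontal_def by auto
    then obtain t h where th: "v' = t + h" "t \<in> tangent_image G A (F u) (chart_inv cx y)"
        "h \<in> horizontal G ?g"
      by blast
    have "\<kappa> ?g t \<in> range ?B" using th(2) range_\<theta> assms s by simp
    moreover have "\<kappa> ?g h \<in> H" unfolding \<kappa>_horizontal[of ?g, symmetric] using th(3) by blast
    ultimately show ?thesis using v' th(1) by (metis linear_add linear_\<kappa>)
  qed
  ultimately show ?thesis
    using linear_subspace_image[OF lin subspace_UNIV] p_le_n by (simp add: transversal_def)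
qed

definition b :: "nat \<Rightarrow> 'b" where "b = (SOME b. tuple_basis (DIM('a) - p) b)"

lemma basis_b: "tuple_basis (DIM('a) - p) b"
  unfolding b_def using ex_basis by (rule someI_ex)

lemma Fh_base: "Fh (0, y0) = snd cg (F 0 x)"
  by (simp add: Fh_def chart_inv_chart[OF cx(3) cx(2)])

sublocale fam: transversal_family e "hdim G" p Dom y0 \<theta> "C (F 0 x)" b
proof (intro transversal_family.intro transversal_family_axioms.intro)
  show "frame_space e (hdim G)" by (rule frame_space_axioms)
  show "open Dom" by (rule Dom_smooth(1))
  show "(0, y0) \<in> Dom" by (rule in_Dom)
  show "tuple_basis (DIM('a) - p) b" by (rule basis_b)
  show "linear (\<theta> s)" if "s \<in> Dom" for s using that by (rule linear_\<theta>)
  show "transversal p (range (\<lambda>w. \<theta> s (0, w)))" if "s \<in> Dom" for s using that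
      by (rule transversal_\<theta>)
  show "inj (\<lambda>w. \<theta> s (0, w))" if "s \<in> Dom" for s using that by (cases s) (simp add: inj_\<theta>)
  have d2: "(\<lambda>t. frechet_derivative Fh (at t) c) differentiable (at (0, y0))" for c
    by (rule twice_differentiable_onD(2)[OF Dom_smooth(2) in_Dom])
  note eq = group_structure_equation[OF Dom_smooth(1) in_Dom has_derivative_Fh d2 Fh_base]
  have \<theta>0: "\<theta> (0, y0) V = \<kappa> (F 0 x) (frechet_derivative Fh (at (0, y0)) V)" for V
    by (simp add: \<theta>_def Fh_base K_g0)
  show "(\<lambda>s. \<theta> s V) differentiable (at (0, y0))" for V
    unfolding \<theta>_def by (rule eq(1))
  show "frechet_derivative (\<lambda>s. \<theta> s V') (at (0, y0)) V - frechet_derivative (\<lambda>s. \<theta> s V)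
      (at (0, y0)) V' =
      - C (F 0 x) (\<theta> (0, y0) V) (\<theta> (0, y0) V')" for V V'
    using eq(2)[of V' V] unfolding \<theta>0 by (simp only: \<theta>_def[abs_def])
  show "linear (C (F 0 x) v)" for v by (rule linear_C)
qed

abbreviation "s0 \<equiv> (0::real, y0)"

lemma B_eq:
  "(u, y) \<in> Dom \<Longrightarrow> fam.B (u, y) w =
    \<kappa> (F u (chart_inv cx y)) (tangent_map A M (F u) (chart_inv cx y)
        (uncoord A cx (chart_inv cx y) w))"
  by (simp add: fam.B_def \<theta>_space)

lemma T_eq:
  "(u, y) \<in> Dom \<Longrightarrow> fam.T (u, y) = \<kappa> (F u (chart_inv cx y)) ` tangent_image G A (F u)
      (chart_inv cx y)"
  by (simp add: fam.T_def fam.B_def[abs_def] range_\<theta>)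

lemma inj_tangent_map: "(u, y) \<in> Dom \<Longrightarrow> inj (tangent_map A M (F u) (chart_inv cx y))"
  using immersion_F[OF DomD(1)] by (simp add: immersion_def)

section \<open>Orientation and the pulled-back volume\<close>

lemma alternating_form_in_chart:
  assumes y: "y \<in> snd cx ` fst cx"
  shows "alternating_form (DIM('a) - p) (form_in_chart A cx \<omega> y)"
proof -
  have "alternating_form (DIM('a) - p) (\<omega> (chart_inv cx y))" using \<omega>
      by (simp add: orientation_form_def)
  from alternating_form_compose_linear[OF this linear_uncoord[OF A cx(1) chart_inv_in[OF cx(3) y]]]
  show ?thesis by (simp add: form_in_chart_def[abs_def])
qed

text \<open>The orientation form on the given vectors is its value on the tangential adapted vectors
  times \<open>W\<close>. Hence the sign factor of the volume form times \<open>W\<close> is the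
  sign of the orientation form on the given vectors times the absolute value of \<open>W\<close>,
  and neither depends on the chosen adapted basis.\<close>

lemma pulled_back_volume_eq:
  assumes s: "(u, y) \<in> Dom"
  shows "pulled_back_volume G p A \<omega> (F u) (chart_inv cx y)
      (\<lambda>j. uncoord A cx (chart_inv cx y) (w j)) =
    sgn (form_in_chart A cx \<omega> y b) * fam.density (u, y) * fam.\<delta> w"
proof -
  let ?y = "chart_inv cx y"
  let ?g = "F u ?y" and ?tm = "tangent_map A M (F u) ?y" and ?T = "tangent_image G A (F u) ?y"
  let ?k = "DIM('a) - p"
  define f where "f = some_adapted_basis G p ?g ?T"
  define f' where "f' i = \<kappa> ?g (f i)" for i
  define b' where "b' i = inv ?tm (f (p + i))" for i
  define W where "W = wedge ?k (\<lambda>i. component DIM('a) f' (p + i)) (\<lambda>j. fam.B (u, y) (w j))"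
  have t: "transversal p (\<kappa> ?g ` ?T)" using fam.transversal_T[OF s] by (simp only: T_eq[OF s])
  have ad: "adapted p (\<kappa> ?g ` ?T) f'"
    unfolding f'_def f_def by (rule some_adapted_basis_\<kappa>[OF t])
  have tb: "tuple_basis DIM('a) f'" by (rule adapted_basis[OF t ad])
  have dual: "dual f j v = component DIM('a) f' j (\<kappa> ?g v)" for j v
    using tuple_basis_\<kappa>[of ?g f] tb by (simp add: f'_def[abs_def])
  have tmi: "inj ?tm" by (rule inj_tangent_map[OF s])
  have lin: "linear ?tm" by (rule linear_tangent_map[OF A manifold tangent_map_F(1)[OF s]])
  have W: "wedge ?k (\<lambda>i. dual f (p + i)) (\<lambda>j. ?tm (uncoord A cx ?y (w j))) = W"
    by (simp add: W_def wedge_def dual B_eq[OF s])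
  have tb': "?tm (b' i) = f (p + i)" if "i < ?k" for i
  proof -
    have "f' (p + i) \<in> \<kappa> ?g ` ?T" using that by (intro adapted_T[OF t ad]) auto
    then have "f (p + i) \<in> ?T" unfolding f'_def by (simp only: inj_image_mem_iff[OF inj_\<kappa>])
    then show ?thesis unfolding b'_def tangent_image_def by (rule f_inv_into_f)
  qed
  have exp: "v = (\<Sum>i<?k. dual f (p + i) (?tm v) *\<^sub>R b' i)" for v
  proof (rule injD[OF tmi], rule injD[OF inj_\<kappa>[of ?g]])
    have "\<kappa> ?g (?tm v) \<in> \<kappa> ?g ` ?T" by (simp add: tangent_image_def)
    from expansion_T[OF t ad this]
    show "\<kappa> ?g (?tm v) = \<kappa> ?g (?tm (\<Sum>i<?k. dual f (p + i) (?tm v) *\<^sub>R b' i))"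
      by (simp add: linear_sum[OF lin] linear_cmul[OF lin] linear_sum[OF linear_\<kappa>]
          linear_cmul[OF linear_\<kappa>] tb' dual f'_def[symmetric])
  qed
  have "alternating_form ?k (\<omega> ?y)" using \<omega> by (simp add: orientation_form_def)
  then have "\<omega> ?y (\<lambda>j. uncoord A cx ?y (w j)) = \<omega> ?y b' * W"
    unfolding W[symmetric] by (rule alternating_form_top) (rule exp)
  then have 1: "\<omega> ?y b' * W = form_in_chart A cx \<omega> y b * fam.\<delta> w"
    using alternating_form_basis[OF alternating_form_in_chart basis_b, of y w] s
    by (simp add: form_in_chart_def fam.\<delta>_def Dom_def)
  have ad': "adapted p (fam.T (u, y)) f'" using ad by (simp only: T_eq[OF s])
  have 2: "\<bar>W\<bar> = fam.density (u, y) * \<bar>fam.\<delta> w\<bar>"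
    unfolding W_def by (rule fam.wedge_eq_density[OF s ad'])
  have "pulled_back_volume G p A \<omega> (F u) ?y (\<lambda>j. uncoord A cx ?y (w j)) = sgn (\<omega> ?y b') * W"
    unfolding pulled_back_volume_def mu_volume_form_def Let_def f_def[symmetric] W
    by (simp add: b'_def[abs_def])
  also have "\<dots> = sgn (\<omega> ?y b' * W) * \<bar>W\<bar>"
    by (simp add: sgn_mult mult.assoc sgn_mult_abs)
  also have "\<dots> = sgn (form_in_chart A cx \<omega> y b) * fam.density (u, y) * (sgn (fam.\<delta> w) * \<bar>fam.\<delta> w\<bar>)"
    unfolding 1 2 by (simp add: sgn_mult)
  finally show ?thesis by (simp add: sgn_mult_abs)
qed

lemma form_base: "form_in_chart A cx \<omega> y0 w = \<omega> x w"
  by (simp add: form_in_chart_def chart_inv_chart[OF cx(3) cx(2)] coord_chart_at[OF A])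

text \<open>A continuous function keeps its sign near a point where it is not 0;
  \<open>\<omega>\<close> is nonzero on the basis \<open>b\<close> since it does not vanish at
  \<open>x\<close>. The sign thus behaves as a constant under differentiation in the chart.\<close>

lemma sign_locally_constant:
  "\<forall>\<^sub>F y in nhds y0. sgn (form_in_chart A cx \<omega> y b) = sgn (form_in_chart A cx \<omega> y0 b)"
proof -
  let ?f = "\<lambda>y. form_in_chart A cx \<omega> y b"
  have y0: "y0 \<in> snd cx ` fst cx" using cx by simp
  obtain v where "\<omega> x v \<noteq> 0" using \<omega> unfolding orientation_form_def by blast
  then have nz: "?f y0 \<noteq> 0"
    using alternating_form_basis[OF alternating_form_in_chart[OF y0] basis_b, of v]
        by (auto simp: form_base)
  have "continuous_on (snd cx ` fst cx) ?f" using \<omega> cx(1) unfolding orientation_form_def by blast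
  then have c: "isCont ?f y0" using y0 continuous_on_eq_continuous_at[OF open_image[OF cx(3)]]
      by blast
  show ?thesis
  proof (cases "0 < ?f y0")
    case True
    have "\<forall>\<^sub>F y in nhds y0. ?f y \<in> {0<..}" by (rule isCont_eventually_in[OF c]) (use True in auto)
    then show ?thesis by eventually_elim (use True in auto)
  next
    case False
    have "\<forall>\<^sub>F y in nhds y0. ?f y \<in> {..<0}" by (rule isCont_eventually_in[OF c])
        (use False nz in auto)
    then show ?thesis by eventually_elim (use False nz in auto)
  qed
qed

lemma Dom_slices: "\<forall>\<^sub>F u in nhds 0. (u, y0) \<in> Dom" "\<forall>\<^sub>F y in nhds y0. (0, y) \<in> Dom"
proof -
  have "isCont (\<lambda>u. (u, y0)) 0" "isCont (\<lambda>y. (0::real, y)) y0" by (auto intro!: continuous_intros)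
  then show "\<forall>\<^sub>F u in nhds 0. (u, y0) \<in> Dom" "\<forall>\<^sub>F y in nhds y0. (0, y) \<in> Dom"
    using isCont_eventually_in[OF _ Dom_smooth(1)] in_Dom by blast+
qed

definition sg :: real where "sg = sgn (form_in_chart A cx \<omega> y0 b)"

lemma volume_in_time:
  "\<forall>\<^sub>F u in nhds 0. sg * fam.density (u, y0) * fam.\<delta> v = pulled_back_volume G p A \<omega> (F u) x v"
  using Dom_slices(1)
  by eventually_elim
    (simp add: sg_def pulled_back_volume_eq[of _ y0 v, symmetric] chart_inv_chart[OF cx(3) cx(2)]
        coord_chart_at[OF A])

abbreviation "W \<equiv> variation_field G F"
abbreviation "W_top \<equiv> \<lambda>y. tan_part G (F 0 y) (tangent_image G A (F 0) y) (W y)"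
abbreviation "W_perp \<equiv> \<lambda>y. perp_part G (F 0 y) (tangent_image G A (F 0) y) (W y)"

lemma tan_part_eq:
  assumes s: "(0, y) \<in> Dom"
  shows "\<kappa> (F 0 (chart_inv cx y)) (tan_part G (F 0 (chart_inv cx y))
      (tangent_image G A (F 0) (chart_inv cx y)) v) =
    tan_proj (fam.T (0, y)) (\<kappa> (F 0 (chart_inv cx y)) v)"
  using fam.transversal_T[OF s] unfolding T_eq[OF s] by (rule tan_part_\<kappa>)

lemma W_perp_eq:
  assumes s: "(0, y) \<in> Dom"
  shows "\<kappa> (F 0 (chart_inv cx y)) (W_perp (chart_inv cx y)) = fam.P_perp (0, y)"
  by (simp add: perp_part_def linear_diff[OF linear_\<kappa>] tan_part_eq[OF s] fam.P_perp_def fam.P_def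
      \<theta>_time[OF s])

lemma inv_tangent_map_eq:
  assumes s: "(0, y) \<in> Dom"
  shows "inv (tangent_map A M (F 0) (chart_inv cx y))
      (tan_part G (F 0 (chart_inv cx y)) (tangent_image G A (F 0) (chart_inv cx y)) v) =
    uncoord A cx (chart_inv cx y) (fam.pull (0, y) (\<kappa> (F 0 (chart_inv cx y)) v))"
proof -
  let ?tm = "tangent_map A M (F 0) (chart_inv cx y)"
  have "\<kappa> (F 0 (chart_inv cx y)) (?tm (uncoord A cx (chart_inv cx y)
      (fam.pull (0, y) (\<kappa> (F 0 (chart_inv cx y)) v)))) =
     \<kappa> (F 0 (chart_inv cx y)) (tan_part G (F 0 (chart_inv cx y))
         (tangent_image G A (F 0) (chart_inv cx y)) v)"
    unfolding tan_part_eq[OF s] B_eq[OF s, symmetric] by (rule fam.B_pull[OF s])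
  then have "?tm (uncoord A cx (chart_inv cx y) (fam.pull (0, y) (\<kappa> (F 0 (chart_inv cx y)) v))) =
     tan_part G (F 0 (chart_inv cx y)) (tangent_image G A (F 0) (chart_inv cx y)) v"
    by (rule injD[OF inj_\<kappa>])
  then show ?thesis by (metis inv_f_f inj_tangent_map[OF s])
qed

text \<open>The exterior derivative at \<open>x\<close> depends only on the germ at
  \<open>y0\<close>, so agreement near \<open>y0\<close> suffices; the sign has to be constant
  there, not just at the point.\<close>

lemma interior_product_eq:
  "\<forall>\<^sub>F y in nhds y0. form_in_chart A cx (interior_product
      (\<lambda>y. inv (tangent_map A M (F 0) y) (W_top y))
      (pulled_back_volume G p A \<omega> (F 0))) y w = sg * fam.density (0, y) * fam.\<delta>
          (case_nat (fam.Z (0, y)) w)"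
  using Dom_slices(2) sign_locally_constant
proof eventually_elim
  case (elim y)
  have "(case_nat (uncoord A cx (chart_inv cx y) (fam.Z (0, y)))
      (\<lambda>j. uncoord A cx (chart_inv cx y) (w j))) =
     (\<lambda>j. uncoord A cx (chart_inv cx y) (case_nat (fam.Z (0, y)) w j))"
    by (auto simp: fun_eq_iff split: nat.split)
  moreover have "inv (tangent_map A M (F 0) (chart_inv cx y)) (W_top (chart_inv cx y)) =
      uncoord A cx (chart_inv cx y) (fam.Z (0, y))"
    by (simp add: inv_tangent_map_eq[OF elim(1)] fam.Z_def fam.P_def \<theta>_time[OF elim(1)])
  ultimately show ?case
    using pulled_back_volume_eq[OF elim(1), of "case_nat (fam.Z (0, y)) w"] elim(2)
    by (simp add: form_in_chart_def[of _ _ "interior_product _ _"] interior_product_def sg_def)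
qed

lemma exterior_derivative_eq:
  "exterior_derivative A (DIM('a) - p) (interior_product
      (\<lambda>y. inv (tangent_map A M (F 0) y) (W_top y))
      (pulled_back_volume G p A \<omega> (F 0))) x v =
   (\<Sum>i<DIM('a) - p. (-1) ^ i * frechet_derivative
      (\<lambda>y. sg * fam.density (0, y) * fam.\<delta> (case_nat (fam.Z (0, y))
          (\<lambda>j. if j < i then v j else v (Suc j)))) (at y0) (v i))"
  unfolding exterior_derivative_def Let_def frechet_derivative_cong_nhds[OF interior_product_eq] ..

text \<open>The frame components of a field are the coordinates of its image under
  \<open>\<kappa>\<close>, so the flat connection is ordinary differentiation in the model.\<close>

lemma flat_connection_eq: "\<kappa> (F 0 x) (flat_connection G A (F 0) W_perp x X) = fam.DP X"
proof -
  have d: "tangent_map A real_atlas (\<lambda>y. dual (frame G (F 0 y)) j (W_perp y)) x X = fam.DP X \<bullet> e j"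
    if j: "j < DIM('a)" for j
  proof -
    have ev: "\<forall>\<^sub>F y in nhds y0. fam.P_perp (0, y) \<bullet> e j = dual (frame G (F 0 (chart_inv cx y))) j
        (W_perp (chart_inv cx y))"
      using Dom_slices(2) by eventually_elim (simp only: dual_frame[OF j] W_perp_eq)
    have "((\<lambda>y. fam.P_perp (0, y) \<bullet> e j) has_derivative (\<lambda>h. fam.DP h \<bullet> e j)) (at y0)"
      by (intro has_derivative_inner_left fam.DP)
    from has_derivative_cong_nhds[OF this ev]
    have "frechet_derivative (\<lambda>y. dual (frame G (F 0 (chart_inv cx y))) j
        (W_perp (chart_inv cx y))) (at y0) =
        (\<lambda>h. fam.DP h \<bullet> e j)"
      by (rule frechet_derivative_at[symmetric])
    then show ?thesis by (simp add: tangent_map_def chart_at_real comp_def)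
  qed
  show ?thesis
    unfolding flat_connection_def
    by (simp add: d linear_sum[OF linear_\<kappa>] linear_cmul[OF linear_\<kappa>] \<kappa>_frame e_expansion[symmetric])
qed

text \<open>The minus signs in \<open>weingarten\<close> and \<open>mean_curvature\<close> cancel;
  what remains is the tangential part of the flat derivative of \<open>W_perp\<close>, read in the
  source.\<close>

lemma mean_curvature_eq:
  "mean_curvature G A (F 0) W_perp x = endo_trace (\<lambda>w. fam.pull s0 (fam.DP w))"
proof -
  have x: "chart_inv cx y0 = x" by (rule chart_inv_chart[OF cx(3) cx(2)])
  let ?tm = "tangent_map A M (F 0) x"
  have inj: "inj ?tm" and lin: "linear ?tm"
    using inj_tangent_map[OF in_Dom] linear_tangent_map[OF A manifold
        tangent_map_F(1)[OF in_Dom]] by (simp_all only: x)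
  have "weingarten G A (F 0) W_perp x X = - fam.pull s0 (fam.DP X)" for X
  proof -
    let ?t = "tan_part G (F 0 x) (tangent_image G A (F 0) x) (flat_connection G A (F 0) W_perp x X)"
    have i: "inv ?tm ?t = fam.pull s0 (fam.DP X)"
      using inv_tangent_map_eq[OF in_Dom, of "flat_connection G A (F 0) W_perp x X"]
      by (simp add: x coord_chart_at[OF A] flat_connection_eq)
    \<comment> \<open>\<open>inv\<close> of the tangent map is a genuine inverse only on its range;
      membership of \<open>?t\<close> there allows the minus sign to be taken out.\<close>
    have "\<kappa> (F 0 x) ?t \<in> fam.T s0"
      using tan_part_eq[OF in_Dom] tan_proj_in(1)[OF fam.transversal_T[OF in_Dom]] by (simp add: x)
    then have "?t \<in> range ?tm"
      unfolding T_eq[OF in_Dom] x by (simp add: inj_image_mem_iff[OF inj_\<kappa>] tangent_image_def)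
    then have "?tm (inv ?tm ?t) = ?t" by (rule f_inv_into_f)
    then have "?tm (- fam.pull s0 (fam.DP X)) = - ?t" by (simp add: linear_neg[OF lin] i)
    then have "inv ?tm (- ?t) = - fam.pull s0 (fam.DP X)"
      using inv_f_f[OF inj, of "- fam.pull s0 (fam.DP X)"] by simp
    then show ?thesis by (simp only: weingarten_def)
  qed
  then have "weingarten G A (F 0) W_perp x = (\<lambda>X. - fam.pull s0 (fam.DP X))" by (rule ext)
  then have "mean_curvature G A (F 0) W_perp x = - endo_trace (\<lambda>X. - fam.pull s0 (fam.DP X))"
    by (simp only: mean_curvature_def)
  also have "\<dots> = endo_trace (\<lambda>w. fam.pull s0 (fam.DP w))"
    using endo_trace_uminus[OF basis_b, of "\<lambda>w. fam.pull s0 (fam.DP w)"]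
      linear_compose[OF fam.linear_DP fam.linear_pull[OF in_Dom]] by (simp add: o_def)
  finally show ?thesis .
qed

text \<open>The torsion is \<open>- C\<close> in frame coordinates and \<open>P_perp\<close> is
  horizontal, so \<open>endo_trace_pull_vertical\<close> turns the sum over the non-horizontal
  indices into a trace over the whole tangent space.\<close>

lemma mean_torsion_eq:
  "mean_torsion G p A (F 0) W_perp x = - endo_trace
      (\<lambda>w. fam.pull s0 (C (F 0 x) (fam.P_perp s0) (fam.B s0 w)))"
proof -
  have x: "chart_inv cx y0 = x" by (rule chart_inv_chart[OF cx(3) cx(2)])
  let ?g = "F 0 x" and ?T = "tangent_image G A (F 0) x"
  define f where "f = some_adapted_basis G p ?g ?T"
  define f' where "f' i = \<kappa> ?g (f i)" for i
  have T: "fam.T s0 = \<kappa> ?g ` ?T" using T_eq[OF in_Dom] by (simp only: x)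
  have t: "transversal p (\<kappa> ?g ` ?T)" using fam.transversal_T[OF in_Dom] by (simp only: T)
  have ad: "adapted p (\<kappa> ?g ` ?T) f'"
    unfolding f'_def f_def by (rule some_adapted_basis_\<kappa>[OF t])
  have tb: "tuple_basis DIM('a) f'" by (rule adapted_basis[OF t ad])
  have dual: "dual f j v = component DIM('a) f' j (\<kappa> ?g v)" for j v
    using tuple_basis_\<kappa>[of ?g f] tb by (simp add: f'_def[abs_def])
  have \<xi>: "\<kappa> ?g (W_perp x) = fam.P_perp s0" using W_perp_eq[OF in_Dom] by (simp only: x)
  have "fam.P_perp s0 \<in> H"
    using tan_proj_in(2)[OF fam.transversal_T[OF in_Dom], of "fam.P s0"]
        by (simp add: fam.P_perp_def N_def)
  from fam.endo_trace_pull_vertical[OF ad[folded T] this C_vertical]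
  have "endo_trace (\<lambda>w. fam.pull s0 (C ?g (fam.P_perp s0) (fam.B s0 w))) =
      (\<Sum>j=hdim G..<DIM('a). component DIM('a) f' j (C ?g (fam.P_perp s0) (f' j)))"
    by blast
  moreover have "mean_torsion G p A (F 0) W_perp x =
      (\<Sum>j=hdim G..<DIM('a). - component DIM('a) f' j (C ?g (fam.P_perp s0) (f' j)))"
    unfolding mean_torsion_def Let_def f_def[symmetric] dual torsion_\<kappa> \<xi> f'_def[symmetric]
    by (simp add: linear_neg[OF linear_component[OF tb]])
  ultimately show ?thesis by (simp add: sum_negf)
qed

theorem first_variation:
  "((\<lambda>u. pulled_back_volume G p A \<omega> (F u) x v) has_real_derivative
      (mean_curvature G A (F 0) W_perp x + mean_torsion G p A (F 0) W_perp x) *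
          pulled_back_volume G p A \<omega> (F 0) x v +
      exterior_derivative A (DIM('a) - p) (interior_product
          (\<lambda>y. inv (tangent_map A M (F 0) y) (W_top y))
        (pulled_back_volume G p A \<omega> (F 0))) x v) (at 0)"
proof -
  have v: "sg * fam.density s0 * fam.\<delta> v = pulled_back_volume G p A \<omega> (F 0) x v"
    using eventually_nhds_x_imp_x[OF volume_in_time] .
  show ?thesis
    using fam.variation_of_density[of sg v]
    unfolding exterior_derivative_eq mean_curvature_eq mean_torsion_eq v[symmetric]
        has_field_derivative_def
    by (intro has_derivative_cong_nhds[OF _ volume_in_time]) simp
qed

end

theorem theorem4:
  fixes G :: "('g::{t2_space,second_countable_topology}, 'a::euclidean_space) stratified_group"
    and A :: "('m::{t2_space,second_countable_topology}, 'b::real_normed_vector) atlas"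
    and \<omega> :: "'m \<Rightarrow> (nat \<Rightarrow> 'b) \<Rightarrow> real"
    and \<iota> :: "'m \<Rightarrow> 'g"
    and F :: "real \<Rightarrow> 'm \<Rightarrow> 'g"
    and \<epsilon> :: real
    and n p :: nat
    and W W_top W_perp :: "'m \<Rightarrow> 'a"
    and \<Gamma> :: "real \<Rightarrow> 'm \<Rightarrow> (nat \<Rightarrow> 'b) \<Rightarrow> real"
    and x :: 'm and v :: "nat \<Rightarrow> 'b"
  assumes "sub_riemannian_stratified_group G" and "n = DIM('a)"
    and "p \<le> n" and "smooth_manifold A (n - p)" and "orientation_form A (n - p) \<omega>"
    and "immersion G A \<iota>" and "non_horizontal G A \<iota>"
    and "variation G A \<iota> \<epsilon> F"
  defines "W \<equiv> variation_field G F"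
    and "W_top \<equiv> \<lambda>y. tan_part G (\<iota> y) (tangent_image G A \<iota> y) (W y)"
    and "W_perp \<equiv> \<lambda>y. perp_part G (\<iota> y) (tangent_image G A \<iota> y) (W y)"
    and "\<Gamma> \<equiv> \<lambda>u. pulled_back_volume G p A \<omega> (F u)"
  shows "((\<lambda>u. \<Gamma> u x v) has_real_derivative
            (mean_curvature G A \<iota> W_perp x + mean_torsion G p A \<iota> W_perp x) * \<Gamma> 0 x v +
            exterior_derivative A (n - p)
              (interior_product (\<lambda>y. inv (tangent_map A (charts G) \<iota> y) (W_top y)) (\<Gamma> 0)) x v)
         (at 0)"
proof -
  have \<iota>: "F 0 = \<iota>" using assms(8) by (simp add: variation_def)
  interpret nonhorizontal_variation G A \<omega> F \<epsilon> p x
    using assms(1-5,8) by unfold_locales (simp_all add: \<iota>)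
  show ?thesis
    using first_variation[of v] unfolding W_def W_top_def W_perp_def \<Gamma>_def \<iota> assms(2) .
qed

end
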